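(* Let $K$ be a field, $n$ a positive integer, $E$ a graph, and $v$ and $w$ vertices in $E$ (they may be the same). Let $e_1, e_2, \ldots, e_n$ be distinct edges in $E$ with $s(e_i) = v$ and $r(e_i) = w$ for all $1\le i\le n$. Let $P=(p_{i,j})$ and $Q = (q_{i, j})$ be elements of $M_n(L_K(E))$ such that $wP=Pw$, $wQ=Qw$ and $wPQ = wQP = wI_n$. Then the following statements hold: (i) There exists a unique homomorphism $\varphi_{P, Q}:L_K(E)\to L_K(E)$ of $K$-algebras satisfying $$\varphi_{P, Q}(u)=u,\quad \varphi_{P, Q}(e)=e\quad\text{and}\quad \varphi_{P, Q}(e^* )=e^*$$ for all $u\in E^0$ and $e\in E^1\setminus \{ e_1,\ldots ,e_n\}$, and $$\varphi_{P, Q}(e_i) = \sum^n_{k=1}e_kp_{k,i}\quad\text{and}\quad \varphi_{P, Q}(e^*_i) = \sum^n_{k=1}q_{i,k}e^*_k$$ for all $1\le i\le n$. (ii) If $w\varphi_{P, Q}(p_{i,j})= wp_{i,j}$ for all $1\le i, j\le n$, or $w\varphi_{P, Q}(q_{i,j})= wq_{i,j}$ for all $1\le i, j\le n$, then $\varphi_{P, Q}$ is an isomorphism and $\varphi_{P, Q}^{-1}=\varphi_{Q, P}$, where $\varphi_{Q,P}$ denotes the homomorphism obtained in (i) with the roles of $P$ and $Q$ interchanged.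
   Context: A (directed) graph $E=(E^0,E^1,s,r)$ consists of two disjoint sets $E^0$ (vertices) and $E^1$ (edges), of arbitrary cardinality, with maps $s,r:E^1\to E^0$ (source and range). A vertex $v$ is regular if $0<|s^{-1}(v)|<\infty$. For a field $K$, the Leavitt path algebra $L_K(E)$ is the $K$-algebra (not necessarily unital) generated by the union of $E^0$ and two disjoint copies $E^1$ and $\{e^*\mid e\in E^1\}$ of $E^1$, subject to the following relations for all $v,w\in E^0$ and $e,f\in E^1$: (1) $vw=\delta_{v,w}w$; (2) $s(e)e=e=e\,r(e)$ and $e^*s(e)=e^*=r(e)e^*$; (3) $e^*f=\delta_{e,f}r(e)$; (4) $v=\sum_{e\in s^{-1}(v)}ee^*$ for every regular vertex $v$. For $a\in L_K(E)$ and a matrix $P=(p_{i,j})\in M_n(L_K(E))$, $aP=(ap_{i,j})$ and $Pa=(p_{i,j}a)$ (entrywise multiplication); $wI_n$ is the diagonal matrix all of whose diagonal entries equal $w$. Homomorphisms of $K$-algebras are not required to preserve an identity. *)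

theory Defs
  imports "HOL-Algebra.FiniteProduct" "Graph_Theory.Digraph"
begin

section \<open>Algebras over a field, not necessarily unital\<close>

record ('k, 'a) nu_algebra = "'a partial_object" +
  azero :: 'a
  aadd :: "'a \<Rightarrow> 'a \<Rightarrow> 'a"
  amult :: "'a \<Rightarrow> 'a \<Rightarrow> 'a"
  ascale :: "'k \<Rightarrow> 'a \<Rightarrow> 'a"

locale nu_algebra =
  fixes A :: "('k :: field, 'a) nu_algebra"
  assumes zero_closed: "azero A \<in> carrier A"
    and add_closed: "\<lbrakk>a \<in> carrier A; b \<in> carrier A\<rbrakk> \<Longrightarrow> aadd A a b \<in> carrier A"
    and mult_closed: "\<lbrakk>a \<in> carrier A; b \<in> carrier A\<rbrakk> \<Longrightarrow> amult A a b \<in> carrier A"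
    and scale_closed: "a \<in> carrier A \<Longrightarrow> ascale A r a \<in> carrier A"
    and add_assoc: "\<lbrakk>a \<in> carrier A; b \<in> carrier A; c \<in> carrier A\<rbrakk>
      \<Longrightarrow> aadd A (aadd A a b) c = aadd A a (aadd A b c)"
    and add_comm: "\<lbrakk>a \<in> carrier A; b \<in> carrier A\<rbrakk> \<Longrightarrow> aadd A a b = aadd A b a"
    and add_zero: "a \<in> carrier A \<Longrightarrow> aadd A a (azero A) = a"
    and add_neg: "a \<in> carrier A \<Longrightarrow> aadd A a (ascale A (- 1) a) = azero A"
    and scale_one: "a \<in> carrier A \<Longrightarrow> ascale A 1 a = a"
    and scale_scale: "a \<in> carrier A \<Longrightarrow> ascale A r (ascale A s a) = ascale A (r * s) a"
    and scale_add_left: "a \<in> carrier A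
      \<Longrightarrow> ascale A (r + s) a = aadd A (ascale A r a) (ascale A s a)"
    and scale_add_right: "\<lbrakk>a \<in> carrier A; b \<in> carrier A\<rbrakk>
      \<Longrightarrow> ascale A r (aadd A a b) = aadd A (ascale A r a) (ascale A r b)"
    and mult_assoc: "\<lbrakk>a \<in> carrier A; b \<in> carrier A; c \<in> carrier A\<rbrakk>
      \<Longrightarrow> amult A (amult A a b) c = amult A a (amult A b c)"
    and distrib_right: "\<lbrakk>a \<in> carrier A; b \<in> carrier A; c \<in> carrier A\<rbrakk>
      \<Longrightarrow> amult A (aadd A a b) c = aadd A (amult A a c) (amult A b c)"
    and distrib_left: "\<lbrakk>a \<in> carrier A; b \<in> carrier A; c \<in> carrier A\<rbrakk>
      \<Longrightarrow> amult A a (aadd A b c) = aadd A (amult A a b) (amult A a c)"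
    and scale_mult_left: "\<lbrakk>a \<in> carrier A; b \<in> carrier A\<rbrakk>
      \<Longrightarrow> amult A (ascale A r a) b = ascale A r (amult A a b)"
    and scale_mult_right: "\<lbrakk>a \<in> carrier A; b \<in> carrier A\<rbrakk>
      \<Longrightarrow> amult A a (ascale A r b) = ascale A r (amult A a b)"

definition asum :: "('k, 'a) nu_algebra \<Rightarrow> ('i \<Rightarrow> 'a) \<Rightarrow> 'i set \<Rightarrow> 'a" where
  "asum A f I = finprod \<lparr>carrier = carrier A, monoid.mult = aadd A, one = azero A\<rparr> f I"

text \<open>Maps are required to be extensional outside the carrier, so that equality of
  homomorphisms as HOL functions is equality as maps on the carrier.\<close>

definition alg_hom ::
  "('k, 'a) nu_algebra \<Rightarrow> ('k, 'b) nu_algebra \<Rightarrow> ('a \<Rightarrow> 'b) set" where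
  "alg_hom A B = {\<phi> \<in> carrier A \<rightarrow>\<^sub>E carrier B.
     (\<forall>a\<in>carrier A. \<forall>b\<in>carrier A. \<phi> (aadd A a b) = aadd B (\<phi> a) (\<phi> b)) \<and>
     (\<forall>a\<in>carrier A. \<forall>b\<in>carrier A. \<phi> (amult A a b) = amult B (\<phi> a) (\<phi> b)) \<and>
     (\<forall>r. \<forall>a\<in>carrier A. \<phi> (ascale A r a) = ascale B r (\<phi> a))}"

definition alg_iso ::
  "('k, 'a) nu_algebra \<Rightarrow> ('k, 'b) nu_algebra \<Rightarrow> ('a \<Rightarrow> 'b) set" where
  "alg_iso A B = {\<phi> \<in> alg_hom A B. bij_betw \<phi> (carrier A) (carrier B)}"


section \<open>Matrices over an algebra, indexed by $1,\dots,n$\<close>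

definition mats :: "('k, 'a) nu_algebra \<Rightarrow> nat \<Rightarrow> (nat \<times> nat \<Rightarrow> 'a) set" where
  "mats A n = {1..n} \<times> {1..n} \<rightarrow>\<^sub>E carrier A"

definition mat_prod ::
  "('k, 'a) nu_algebra \<Rightarrow> nat \<Rightarrow> (nat \<times> nat \<Rightarrow> 'a) \<Rightarrow> (nat \<times> nat \<Rightarrow> 'a)
    \<Rightarrow> nat \<times> nat \<Rightarrow> 'a" where
  "mat_prod A n P Q = (\<lambda>(i, j) \<in> {1..n} \<times> {1..n}.
     asum A (\<lambda>k. amult A (P (i, k)) (Q (k, j))) {1..n})"

definition mat_lmult ::
  "('k, 'a) nu_algebra \<Rightarrow> nat \<Rightarrow> 'a \<Rightarrow> (nat \<times> nat \<Rightarrow> 'a) \<Rightarrow> nat \<times> nat \<Rightarrow> 'a" where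
  "mat_lmult A n a P = (\<lambda>(i, j) \<in> {1..n} \<times> {1..n}. amult A a (P (i, j)))"

definition mat_rmult ::
  "('k, 'a) nu_algebra \<Rightarrow> nat \<Rightarrow> (nat \<times> nat \<Rightarrow> 'a) \<Rightarrow> 'a \<Rightarrow> nat \<times> nat \<Rightarrow> 'a" where
  "mat_rmult A n P a = (\<lambda>(i, j) \<in> {1..n} \<times> {1..n}. amult A (P (i, j)) a)"

definition mat_diag :: "('k, 'a) nu_algebra \<Rightarrow> nat \<Rightarrow> 'a \<Rightarrow> nat \<times> nat \<Rightarrow> 'a" where
  "mat_diag A n a = (\<lambda>(i, j) \<in> {1..n} \<times> {1..n}. if i = j then a else azero A)"


section \<open>Algebras given by generators and relations\<close>

datatype (dead 'k, gens: 'g) aterm =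
    Gen 'g
  | Zero
  | Add "('k, 'g) aterm" "('k, 'g) aterm"
  | Mult "('k, 'g) aterm" "('k, 'g) aterm"
  | Scale 'k "('k, 'g) aterm"

definition terms :: "'g set \<Rightarrow> ('k, 'g) aterm set" where
  "terms X = {t. gens t \<subseteq> X}"

text \<open>The least congruence on the terms over \<open>X\<close> that contains \<open>R\<close> and makes the quotient
  an algebra over the field; thus the quotient is the algebra generated by \<open>X\<close> subject to the
  relations \<open>R\<close>, and it has no identity unless the relations force one.\<close>

inductive alg_cong ::
  "'g set \<Rightarrow> ('k :: field, 'g) aterm rel \<Rightarrow> ('k, 'g) aterm \<Rightarrow> ('k, 'g) aterm \<Rightarrow> bool"
  for X :: "'g set" and R :: "('k, 'g) aterm rel"
where
  rel: "\<lbrakk>(a, b) \<in> R; a \<in> terms X; b \<in> terms X\<rbrakk> \<Longrightarrow> alg_cong X R a b"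
| refl: "a \<in> terms X \<Longrightarrow> alg_cong X R a a"
| sym: "alg_cong X R a b \<Longrightarrow> alg_cong X R b a"
| trans: "\<lbrakk>alg_cong X R a b; alg_cong X R b c\<rbrakk> \<Longrightarrow> alg_cong X R a c"
| add: "\<lbrakk>alg_cong X R a a'; alg_cong X R b b'\<rbrakk> \<Longrightarrow> alg_cong X R (Add a b) (Add a' b')"
| mult: "\<lbrakk>alg_cong X R a a'; alg_cong X R b b'\<rbrakk> \<Longrightarrow> alg_cong X R (Mult a b) (Mult a' b')"
| scale: "alg_cong X R a a' \<Longrightarrow> alg_cong X R (Scale r a) (Scale r a')"
| add_assoc: "{a, b, c} \<subseteq> terms X
    \<Longrightarrow> alg_cong X R (Add (Add a b) c) (Add a (Add b c))"
| add_comm: "{a, b} \<subseteq> terms X \<Longrightarrow> alg_cong X R (Add a b) (Add b a)"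
| add_zero: "a \<in> terms X \<Longrightarrow> alg_cong X R (Add a Zero) a"
| add_neg: "a \<in> terms X \<Longrightarrow> alg_cong X R (Add a (Scale (- 1) a)) Zero"
| scale_one: "a \<in> terms X \<Longrightarrow> alg_cong X R (Scale 1 a) a"
| scale_scale: "a \<in> terms X \<Longrightarrow> alg_cong X R (Scale r (Scale s a)) (Scale (r * s) a)"
| scale_add_left: "a \<in> terms X
    \<Longrightarrow> alg_cong X R (Scale (r + s) a) (Add (Scale r a) (Scale s a))"
| scale_add_right: "{a, b} \<subseteq> terms X
    \<Longrightarrow> alg_cong X R (Scale r (Add a b)) (Add (Scale r a) (Scale r b))"
| mult_assoc: "{a, b, c} \<subseteq> terms X
    \<Longrightarrow> alg_cong X R (Mult (Mult a b) c) (Mult a (Mult b c))"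
| distrib_right: "{a, b, c} \<subseteq> terms X
    \<Longrightarrow> alg_cong X R (Mult (Add a b) c) (Add (Mult a c) (Mult b c))"
| distrib_left: "{a, b, c} \<subseteq> terms X
    \<Longrightarrow> alg_cong X R (Mult a (Add b c)) (Add (Mult a b) (Mult a c))"
| scale_mult_left: "{a, b} \<subseteq> terms X
    \<Longrightarrow> alg_cong X R (Mult (Scale r a) b) (Scale r (Mult a b))"
| scale_mult_right: "{a, b} \<subseteq> terms X
    \<Longrightarrow> alg_cong X R (Mult a (Scale r b)) (Scale r (Mult a b))"

definition cls ::
  "'g set \<Rightarrow> ('k :: field, 'g) aterm rel \<Rightarrow> ('k, 'g) aterm \<Rightarrow> ('k, 'g) aterm set" where
  "cls X R t = {t'. alg_cong X R t t'}"

definition presented_algebra ::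
  "'g set \<Rightarrow> ('k :: field, 'g) aterm rel \<Rightarrow> ('k, ('k, 'g) aterm set) nu_algebra" where
  "presented_algebra X R = \<lparr>
     carrier = cls X R ` terms X,
     azero = cls X R Zero,
     aadd = (\<lambda>S T. \<Union>a\<in>S. \<Union>b\<in>T. cls X R (Add a b)),
     amult = (\<lambda>S T. \<Union>a\<in>S. \<Union>b\<in>T. cls X R (Mult a b)),
     ascale = (\<lambda>r S. \<Union>a\<in>S. cls X R (Scale r a))\<rparr>"

lemma terms_simps [simp]:
  "Gen g \<in> terms X \<longleftrightarrow> g \<in> X"
  "Zero \<in> terms X"
  "Add a b \<in> terms X \<longleftrightarrow> a \<in> terms X \<and> b \<in> terms X"
  "Mult a b \<in> terms X \<longleftrightarrow> a \<in> terms X \<and> b \<in> terms X"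
  "Scale r a \<in> terms X \<longleftrightarrow> a \<in> terms X"
  by (auto simp: terms_def)

lemma alg_cong_terms: "alg_cong X R a b \<Longrightarrow> a \<in> terms X \<and> b \<in> terms X"
  by (induction rule: alg_cong.induct) auto

lemma cls_eq_iff:
  assumes "a \<in> terms X"
  shows "cls X R a = cls X R b \<longleftrightarrow> alg_cong X R a b"
proof
  assume "cls X R a = cls X R b"
  moreover have "a \<in> cls X R a" using assms by (simp add: cls_def alg_cong.refl)
  ultimately have "alg_cong X R b a" by (simp add: cls_def)
  then show "alg_cong X R a b" by (rule alg_cong.sym)
next
  assume ab: "alg_cong X R a b"
  have "alg_cong X R a t \<longleftrightarrow> alg_cong X R b t" for t
    using alg_cong.trans[OF ab] alg_cong.trans[OF alg_cong.sym[OF ab]] by blast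
  then show "cls X R a = cls X R b" by (simp add: cls_def)
qed

lemma presented_algebra_ops:
  assumes "a \<in> terms X" and "b \<in> terms X"
  shows "aadd (presented_algebra X R) (cls X R a) (cls X R b) = cls X R (Add a b)"
    and "amult (presented_algebra X R) (cls X R a) (cls X R b) = cls X R (Mult a b)"
    and "ascale (presented_algebra X R) r (cls X R a) = cls X R (Scale r a)"
proof -
  have eq: "cls X R t = cls X R t'" if "alg_cong X R t t'" for t t'
    using that alg_cong_terms[OF that] by (simp add: cls_eq_iff)
  have U: "(\<Union>x\<in>S. \<Union>y\<in>T. f x y) = f x0 y0"
    if "x0 \<in> S" "y0 \<in> T" "\<And>x y. x \<in> S \<Longrightarrow> y \<in> T \<Longrightarrow> f x y = f x0 y0"
    for S T :: "('a, 'b) aterm set" and f :: "_ \<Rightarrow> _ \<Rightarrow> ('a, 'b) aterm set" and x0 y0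
    using that by blast
  have a: "a \<in> cls X R a" and b: "b \<in> cls X R b"
    using assms by (simp_all add: cls_def alg_cong.refl)
  have "(\<Union>x\<in>cls X R a. \<Union>y\<in>cls X R b. cls X R (Add x y)) = cls X R (Add a b)"
    by (rule U[OF a b], rule eq) (simp add: cls_def alg_cong.add alg_cong.sym)
  moreover have "(\<Union>x\<in>cls X R a. \<Union>y\<in>cls X R b. cls X R (Mult x y)) = cls X R (Mult a b)"
    by (rule U[OF a b], rule eq) (simp add: cls_def alg_cong.mult alg_cong.sym)
  moreover have "(\<Union>x\<in>cls X R a. \<Union>y\<in>cls X R a. cls X R (Scale r x)) = cls X R (Scale r a)"
    by (rule U[OF a a], rule eq) (simp add: cls_def alg_cong.scale alg_cong.sym)
  moreover have "(\<Union>x\<in>cls X R a. \<Union>y\<in>cls X R a. cls X R (Scale r x))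
      = (\<Union>x\<in>cls X R a. cls X R (Scale r x))"
    using a by blast
  ultimately show "aadd (presented_algebra X R) (cls X R a) (cls X R b) = cls X R (Add a b)"
    and "amult (presented_algebra X R) (cls X R a) (cls X R b) = cls X R (Mult a b)"
    and "ascale (presented_algebra X R) r (cls X R a) = cls X R (Scale r a)"
    by (simp_all add: presented_algebra_def)
qed

lemma nu_algebra_presented_algebra: "nu_algebra (presented_algebra X R)"
proof -
  have c: "carrier (presented_algebra X R) = cls X R ` terms X"
    and z: "azero (presented_algebra X R) = cls X R Zero"
    by (simp_all add: presented_algebra_def)
  show ?thesis
    by unfold_locales
      (auto simp: c z presented_algebra_ops cls_eq_iff
        alg_cong.add_assoc alg_cong.add_comm alg_cong.add_zero alg_cong.add_neg
        alg_cong.scale_one alg_cong.scale_scale alg_cong.scale_add_left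
        alg_cong.scale_add_right alg_cong.mult_assoc alg_cong.distrib_right
        alg_cong.distrib_left alg_cong.scale_mult_left alg_cong.scale_mult_right
        intro!: imageI del: equalityI)
qed


section \<open>Leavitt path algebras\<close>

text \<open>Source and range are \<open>tail\<close> and \<open>head\<close>. \<open>Ghost e\<close> stands for $e^*$.\<close>

datatype ('v, 'e) lpa_gen = Vert 'v | Edge 'e | Ghost 'e

definition lpa_gens :: "('v, 'e) pre_digraph \<Rightarrow> ('v, 'e) lpa_gen set" where
  "lpa_gens E = Vert ` verts E \<union> Edge ` arcs E \<union> Ghost ` arcs E"

definition regular_vertex :: "('v, 'e) pre_digraph \<Rightarrow> 'v \<Rightarrow> bool" where
  "regular_vertex E v \<longleftrightarrow> v \<in> verts E \<and> out_arcs E v \<noteq> {} \<and> finite (out_arcs E v)"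

text \<open>In \<open>ck2\<close> the sum over the edges emitted by \<open>v\<close> is written as a term once for every
  enumeration of these edges.\<close>

inductive_set lpa_rels :: "('v, 'e) pre_digraph \<Rightarrow> ('k, ('v, 'e) lpa_gen) aterm rel"
  for E :: "('v, 'e) pre_digraph"
where
  vertex: "\<lbrakk>v \<in> verts E; w \<in> verts E\<rbrakk> \<Longrightarrow>
    (Mult (Gen (Vert v)) (Gen (Vert w)), if v = w then Gen (Vert w) else Zero) \<in> lpa_rels E"
| source_edge: "e \<in> arcs E \<Longrightarrow>
    (Mult (Gen (Vert (tail E e))) (Gen (Edge e)), Gen (Edge e)) \<in> lpa_rels E"
| edge_range: "e \<in> arcs E \<Longrightarrow>
    (Mult (Gen (Edge e)) (Gen (Vert (head E e))), Gen (Edge e)) \<in> lpa_rels E"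
| ghost_source: "e \<in> arcs E \<Longrightarrow>
    (Mult (Gen (Ghost e)) (Gen (Vert (tail E e))), Gen (Ghost e)) \<in> lpa_rels E"
| range_ghost: "e \<in> arcs E \<Longrightarrow>
    (Mult (Gen (Vert (head E e))) (Gen (Ghost e)), Gen (Ghost e)) \<in> lpa_rels E"
| ck1: "\<lbrakk>e \<in> arcs E; f \<in> arcs E\<rbrakk> \<Longrightarrow>
    (Mult (Gen (Ghost e)) (Gen (Edge f)), if e = f then Gen (Vert (head E e)) else Zero)
      \<in> lpa_rels E"
| ck2: "\<lbrakk>regular_vertex E v; set es = out_arcs E v; distinct es\<rbrakk> \<Longrightarrow>
    (Gen (Vert v), foldr Add (map (\<lambda>e. Mult (Gen (Edge e)) (Gen (Ghost e))) es) Zero)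
      \<in> lpa_rels E"

type_synonym ('k, 'v, 'e) lpa = "('k, ('v, 'e) lpa_gen) aterm set"

definition leavitt_path_algebra ::
  "('v, 'e) pre_digraph \<Rightarrow> ('k :: field, ('k, 'v, 'e) lpa) nu_algebra" where
  "leavitt_path_algebra E = presented_algebra (lpa_gens E) (lpa_rels E)"

definition lpa_vert :: "('v, 'e) pre_digraph \<Rightarrow> 'v \<Rightarrow> ('k :: field, 'v, 'e) lpa" where
  "lpa_vert E u = cls (lpa_gens E) (lpa_rels E) (Gen (Vert u))"

definition lpa_edge :: "('v, 'e) pre_digraph \<Rightarrow> 'e \<Rightarrow> ('k :: field, 'v, 'e) lpa" where
  "lpa_edge E e = cls (lpa_gens E) (lpa_rels E) (Gen (Edge e))"

definition lpa_ghost :: "('v, 'e) pre_digraph \<Rightarrow> 'e \<Rightarrow> ('k :: field, 'v, 'e) lpa" where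
  "lpa_ghost E e = cls (lpa_gens E) (lpa_rels E) (Gen (Ghost e))"


section \<open>The homomorphisms $\varphi_{P,Q}$\<close>

definition is_lpa_phi ::
  "('v, 'e) pre_digraph \<Rightarrow> nat \<Rightarrow> (nat \<Rightarrow> 'e)
    \<Rightarrow> (nat \<times> nat \<Rightarrow> ('k :: field, 'v, 'e) lpa) \<Rightarrow> (nat \<times> nat \<Rightarrow> ('k, 'v, 'e) lpa)
    \<Rightarrow> (('k, 'v, 'e) lpa \<Rightarrow> ('k, 'v, 'e) lpa) \<Rightarrow> bool" where
  "is_lpa_phi E n e P Q \<phi> \<longleftrightarrow>
     \<phi> \<in> alg_hom (leavitt_path_algebra E) (leavitt_path_algebra E) \<and>
     (\<forall>u\<in>verts E. \<phi> (lpa_vert E u) = lpa_vert E u) \<and>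
     (\<forall>f\<in>arcs E - e ` {1..n}.
        \<phi> (lpa_edge E f) = lpa_edge E f \<and> \<phi> (lpa_ghost E f) = lpa_ghost E f) \<and>
     (\<forall>i\<in>{1..n}.
        \<phi> (lpa_edge E (e i)) = asum (leavitt_path_algebra E)
          (\<lambda>k. amult (leavitt_path_algebra E) (lpa_edge E (e k)) (P (k, i))) {1..n} \<and>
        \<phi> (lpa_ghost E (e i)) = asum (leavitt_path_algebra E)
          (\<lambda>k. amult (leavitt_path_algebra E) (Q (i, k)) (lpa_ghost E (e k))) {1..n})"

definition lpa_phi ::
  "('v, 'e) pre_digraph \<Rightarrow> nat \<Rightarrow> (nat \<Rightarrow> 'e)
    \<Rightarrow> (nat \<times> nat \<Rightarrow> ('k :: field, 'v, 'e) lpa) \<Rightarrow> (nat \<times> nat \<Rightarrow> ('k, 'v, 'e) lpa)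
    \<Rightarrow> ('k, 'v, 'e) lpa \<Rightarrow> ('k, 'v, 'e) lpa" where
  "lpa_phi E n e P Q = (THE \<phi>. is_lpa_phi E n e P Q \<phi>)"

end

theory Submission
  imports Defs "HOL-Computational_Algebra.Polynomial" "HOL-Library.Sublist" "Graph_Theory.Arc_Walk"
begin

text \<open>
  The images of the generators under $\varphi_{P,Q}$ satisfy the defining relations because only the
  corner entries \<open>w p\<^sub>i\<^sub>j\<close> and \<open>w q\<^sub>i\<^sub>j\<close> matter, and these form mutually inverse matrices over \<open>w L w\<close>. If
  $\varphi_{P,Q}$ fixes the corner entries of one matrix, it fixes those of its inverse, and then
  $\varphi_{P,Q} \circ \varphi_{Q,P}$ is the identity on generators. So $\varphi_{P,Q}$ is surjective, and
  what remains is a Hopfian property: a surjective endomorphism of \<open>L\<close> that fixes all vertices is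
  injective.

  Reduction as in the theorem that every nonzero ideal contains a multiple of a vertex or a polynomial
  in a cycle without exit shows that a nonzero kernel would contain an element \<open>r u + \<Sum> c\<^sub>i p\<^sub>i\<close> with
  \<open>r \<noteq> 0\<close> and closed paths \<open>p\<^sub>i\<close> of positive length at \<open>u\<close>. Conjugating by paths through exits removes
  terms until either only \<open>r u\<close> is left, which is fixed by the endomorphism, or \<open>u\<close> lies on a cycle
  without exit. In the latter case \<open>u L u\<close> is a quotient of a Laurent polynomial ring, hence
  Noetherian, and surjectivity implies injectivity there. That the element itself is not zero is
  read off a graded representation.
\<close>

section \<open>Non-unital algebras\<close>

text \<open>The composite computed on generators is one-sided. \<open>\<phi>\<close> =
  \<open>\<phi>_{P,Q}\<close> is known to fix the corner entries, but the same for
  \<open>\<phi>_{Q,P}\<close> would follow only after \<open>\<phi>\<close> is known to be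
  injective, so the opposite composite is out of reach and a genuine injectivity theorem is needed.
  The familiar uniqueness theorems do not supply it: the entries of P and Q are arbitrary, so
  \<open>\<phi>\<close> need not respect degrees, and cycles without exits are not excluded. Fixing
  the vertices alone does not suffice at such cycles: for a single loop, L is K[x, 1/x], and sending
  x to 1 fixes the vertex but kills x - 1. Surjectivity is what rules this out. The graph is
  arbitrary, so L may lack an identity and an infinite emitter has no CK2 relation. Both are met by
  writing elements as finite lists of scaled monomials p q*, which involve finitely many vertices
  and edges. Lists may repeat a monomial; their length is what the reductions decrease, and no
  independence of monomials is ever required.\<close>

definition lsum :: "('k, 'a) nu_algebra \<Rightarrow> ('i \<Rightarrow> 'a) \<Rightarrow> 'i list \<Rightarrow> 'a" where
  "lsum A f xs = foldr (\<lambda>x acc. aadd A (f x) acc) xs (azero A)"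

context nu_algebra
begin

abbreviation add_A (infixl "\<^bold>+" 65) where "a \<^bold>+ b \<equiv> aadd A a b"
abbreviation mult_A (infixl "\<^bold>*" 70) where "a \<^bold>* b \<equiv> amult A a b"
abbreviation scale_A (infixr "\<^bold>." 75) where "r \<^bold>. a \<equiv> ascale A r a"
abbreviation zero_A ("\<^bold>0") where "\<^bold>0 \<equiv> azero A"

lemmas closed [simp, intro] = zero_closed add_closed mult_closed scale_closed

declare add_zero [simp]

lemma add_zero_left [simp]: "a \<in> carrier A \<Longrightarrow> \<^bold>0 \<^bold>+ a = a"
  using add_comm[of "\<^bold>0" a] by simp

lemma add_left_cancel:
  assumes "a \<in> carrier A" "b \<in> carrier A" "c \<in> carrier A"
  shows "a \<^bold>+ b = a \<^bold>+ c \<longleftrightarrow> b = c"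
proof
  assume h: "a \<^bold>+ b = a \<^bold>+ c"
  have cancel: "((- 1) \<^bold>. a) \<^bold>+ (a \<^bold>+ x) = x" if "x \<in> carrier A" for x
  proof -
    have "((- 1) \<^bold>. a) \<^bold>+ (a \<^bold>+ x) = (a \<^bold>+ (- 1) \<^bold>. a) \<^bold>+ x"
      using assms(1) that by (simp only: add_assoc[symmetric] scale_closed add_comm[of a "(- 1) \<^bold>. a"])
    then show ?thesis using assms that by (simp add: add_neg)
  qed
  have "b = ((- 1) \<^bold>. a) \<^bold>+ (a \<^bold>+ b)" by (rule cancel[OF assms(2), symmetric])
  also have "\<dots> = c" unfolding h by (rule cancel[OF assms(3)])
  finally show "b = c" .
qed simp

lemma add_eq_self_iff:
  assumes "a \<in> carrier A" "b \<in> carrier A"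
  shows "a \<^bold>+ b = a \<longleftrightarrow> b = \<^bold>0"
  using add_left_cancel[of a b "\<^bold>0"] assms by simp

lemma add_left_comm:
  assumes "a \<in> carrier A" "b \<in> carrier A" "c \<in> carrier A"
  shows "a \<^bold>+ (b \<^bold>+ c) = b \<^bold>+ (a \<^bold>+ c)"
  using assms by (simp only: add_assoc[symmetric] add_comm[of a b])

lemma scale_zero_left [simp]:
  assumes "a \<in> carrier A" shows "0 \<^bold>. a = \<^bold>0"
proof -
  have "0 \<^bold>. a \<^bold>+ 0 \<^bold>. a = 0 \<^bold>. a"
    using scale_add_left[OF assms, of 0 0] by simp
  then show ?thesis using assms by (simp add: add_eq_self_iff)
qed

lemma scale_zero_right [simp]: "r \<^bold>. \<^bold>0 = \<^bold>0"
  using scale_scale[of "\<^bold>0" r 0] by simp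

lemma mult_zero_left [simp]: "a \<in> carrier A \<Longrightarrow> \<^bold>0 \<^bold>* a = \<^bold>0"
  using scale_mult_left[of "\<^bold>0" a 0] by simp

lemma mult_zero_right [simp]: "a \<in> carrier A \<Longrightarrow> a \<^bold>* \<^bold>0 = \<^bold>0"
  using scale_mult_right[of a "\<^bold>0" 0] by simp

lemma comm_monoid_add: "comm_monoid \<lparr>carrier = carrier A, monoid.mult = aadd A, one = azero A\<rparr>"
  by unfold_locales (auto simp: add_assoc add_comm add_left_comm)

section \<open>Finite sums over index sets and along lists\<close>

lemma asum_empty [simp]: "asum A f {} = \<^bold>0"
proof -
  interpret M: comm_monoid "\<lparr>carrier = carrier A, monoid.mult = aadd A, one = azero A\<rparr>"
    by (rule comm_monoid_add)
  show ?thesis using M.finprod_empty[of f] by (simp add: asum_def)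
qed

lemma asum_closed [simp, intro]:
  assumes "\<And>i. i \<in> I \<Longrightarrow> f i \<in> carrier A"
  shows "asum A f I \<in> carrier A"
proof -
  interpret M: comm_monoid "\<lparr>carrier = carrier A, monoid.mult = aadd A, one = azero A\<rparr>"
    by (rule comm_monoid_add)
  show ?thesis using M.finprod_closed[of f I] assms by (auto simp: asum_def)
qed

lemma asum_insert [simp]:
  assumes "finite I" "j \<notin> I" "f j \<in> carrier A" "\<And>i. i \<in> I \<Longrightarrow> f i \<in> carrier A"
  shows "asum A f (insert j I) = f j \<^bold>+ asum A f I"
proof -
  interpret M: comm_monoid "\<lparr>carrier = carrier A, monoid.mult = aadd A, one = azero A\<rparr>"
    by (rule comm_monoid_add)
  show ?thesis using M.finprod_insert[of I j f] assms by (auto simp: asum_def)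
qed

text \<open>The graph \<open>foldSetD\<close> of the fold behind \<open>finprod\<close> looks at the
  summands only at indices in the set. Pointwise agreement there suffices without any closure
  condition, so rewriting under a sum creates no goals about the carrier.\<close>

lemma asum_cong:
  assumes "I = J" "\<And>i. i \<in> J \<Longrightarrow> f i = g i"
  shows "asum A f I = asum A g J"
proof -
  have mono: "(I, x) \<in> foldSetD D F' e" if "(I, x) \<in> foldSetD D F e" "\<And>i. i \<in> I \<Longrightarrow> F i = F' i"
    for I x D e and F F' :: "_ \<Rightarrow> 'a \<Rightarrow> 'a"
    using that by (induction I x rule: foldSetD.induct) (auto intro!: foldSetD.intros)
  have "(J, x) \<in> foldSetD D (op \<circ> f) e \<longleftrightarrow> (J, x) \<in> foldSetD D (op \<circ> g) e"
    for x D e and op :: "'a \<Rightarrow> 'a \<Rightarrow> 'a"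
    by (rule iffI; erule mono) (simp_all add: assms(2))
  then show ?thesis
    using assms(1) by (simp add: asum_def finprod_def foldD_def)
qed

lemma asum_zero: "finite I \<Longrightarrow> asum A (\<lambda>i. \<^bold>0) I = \<^bold>0"
  by (induction I rule: finite_induct) auto

lemma asum_neutral:
  assumes "finite I" "\<And>i. i \<in> I \<Longrightarrow> f i = \<^bold>0"
  shows "asum A f I = \<^bold>0"
  using asum_cong[of I I f "\<lambda>_. \<^bold>0"] assms by (simp add: asum_zero)

lemma asum_add:
  assumes "finite I" "\<And>i. i \<in> I \<Longrightarrow> f i \<in> carrier A" "\<And>i. i \<in> I \<Longrightarrow> g i \<in> carrier A"
  shows "asum A (\<lambda>i. f i \<^bold>+ g i) I = asum A f I \<^bold>+ asum A g I"
  using assms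
  by (induction I rule: finite_induct) (auto simp: add_assoc add_left_comm)

lemma mult_asum:
  assumes "finite I" "\<And>i. i \<in> I \<Longrightarrow> f i \<in> carrier A" "a \<in> carrier A"
  shows "a \<^bold>* asum A f I = asum A (\<lambda>i. a \<^bold>* f i) I"
  using assms by (induction I rule: finite_induct) (auto simp: distrib_left)

lemma asum_mult:
  assumes "finite I" "\<And>i. i \<in> I \<Longrightarrow> f i \<in> carrier A" "a \<in> carrier A"
  shows "asum A f I \<^bold>* a = asum A (\<lambda>i. f i \<^bold>* a) I"
  using assms by (induction I rule: finite_induct) (auto simp: distrib_right)

lemma asum_swap:
  assumes "finite I" "finite J" "\<And>i j. i \<in> I \<Longrightarrow> j \<in> J \<Longrightarrow> f i j \<in> carrier A"
  shows "asum A (\<lambda>i. asum A (f i) J) I = asum A (\<lambda>j. asum A (\<lambda>i. f i j) I) J"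
  using assms(1,3)
proof (induction I rule: finite_induct)
  case empty
  then show ?case using assms(2) by (simp add: asum_zero)
next
  case (insert x I)
  have "asum A (\<lambda>i. asum A (f i) J) (insert x I) = asum A (f x) J \<^bold>+ asum A (\<lambda>j. asum A (\<lambda>i. f i j) I) J"
    using insert by simp
  also have "\<dots> = asum A (\<lambda>j. f x j \<^bold>+ asum A (\<lambda>i. f i j) I) J"
    using insert assms(2) by (simp add: asum_add)
  also have "\<dots> = asum A (\<lambda>j. asum A (\<lambda>i. f i j) (insert x I)) J"
    using insert by (intro asum_cong) auto
  finally show ?case .
qed

lemma asum_delta:
  assumes "finite I" "j \<in> I" "f j \<in> carrier A"
  shows "asum A (\<lambda>i. if i = j then f i else \<^bold>0) I = f j"
proof -
  have I: "I = insert j (I - {j})" using assms by auto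
  have "asum A (\<lambda>i. if i = j then f i else \<^bold>0) (insert j (I - {j}))
      = f j \<^bold>+ asum A (\<lambda>i. if i = j then f i else \<^bold>0) (I - {j})"
    using assms by (subst asum_insert) auto
  also have "asum A (\<lambda>i. if i = j then f i else \<^bold>0) (I - {j}) = \<^bold>0"
    using assms by (intro asum_neutral) auto
  finally show ?thesis using I assms by simp
qed

lemma asum_Un_disjoint:
  assumes "finite I" "finite J" "I \<inter> J = {}" "\<And>i. i \<in> I \<union> J \<Longrightarrow> f i \<in> carrier A"
  shows "asum A f (I \<union> J) = asum A f I \<^bold>+ asum A f J"
  using assms
proof (induction I rule: finite_induct)
  case (insert x I)
  then have "asum A f (insert x (I \<union> J)) = f x \<^bold>+ asum A f (I \<union> J)"
    by (intro asum_insert) auto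
  then show ?case using insert by (simp add: add_assoc)
qed simp

lemma asum_reindex:
  assumes "finite I" "inj_on h I" "\<And>i. i \<in> I \<Longrightarrow> f (h i) \<in> carrier A"
  shows "asum A f (h ` I) = asum A (\<lambda>i. f (h i)) I"
  using assms
proof (induction I rule: finite_induct)
  case (insert x I)
  then have "asum A f (insert (h x) (h ` I)) = f (h x) \<^bold>+ asum A f (h ` I)"
    by (intro asum_insert) auto
  then show ?case using insert by simp
qed simp

lemma lsum_Nil [simp]: "lsum A f [] = \<^bold>0"
  and lsum_Cons [simp]: "lsum A f (x # xs) = f x \<^bold>+ lsum A f xs"
  by (simp_all add: lsum_def)

lemma lsum_closed [simp, intro]:
  "(\<And>x. x \<in> set xs \<Longrightarrow> f x \<in> carrier A) \<Longrightarrow> lsum A f xs \<in> carrier A"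
  by (induction xs) auto

lemma lsum_cong:
  "(\<And>x. x \<in> set xs \<Longrightarrow> f x = g x) \<Longrightarrow> lsum A f xs = lsum A g xs"
  by (induction xs) auto

lemma lsum_neutral: "(\<And>x. x \<in> set xs \<Longrightarrow> f x = \<^bold>0) \<Longrightarrow> lsum A f xs = \<^bold>0"
  by (induction xs) auto

lemma lsum_append:
  assumes "\<And>x. x \<in> set xs \<union> set ys \<Longrightarrow> f x \<in> carrier A"
  shows "lsum A f (xs @ ys) = lsum A f xs \<^bold>+ lsum A f ys"
  using assms by (induction xs) (auto simp: add_assoc)

lemma lsum_map: "lsum A f (map g xs) = lsum A (\<lambda>x. f (g x)) xs"
  by (induction xs) auto

lemma lsum_mult:
  assumes "\<And>x. x \<in> set xs \<Longrightarrow> f x \<in> carrier A" "a \<in> carrier A"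
  shows "lsum A f xs \<^bold>* a = lsum A (\<lambda>x. f x \<^bold>* a) xs"
  using assms by (induction xs) (auto simp: distrib_right)

lemma mult_lsum:
  assumes "\<And>x. x \<in> set xs \<Longrightarrow> f x \<in> carrier A" "a \<in> carrier A"
  shows "a \<^bold>* lsum A f xs = lsum A (\<lambda>x. a \<^bold>* f x) xs"
  using assms by (induction xs) (auto simp: distrib_left)

lemma scale_lsum:
  assumes "\<And>x. x \<in> set xs \<Longrightarrow> f x \<in> carrier A"
  shows "r \<^bold>. lsum A f xs = lsum A (\<lambda>x. r \<^bold>. f x) xs"
  using assms by (induction xs) (auto simp: scale_add_right)

lemma lsum_filter:
  assumes "\<And>x. x \<in> set xs \<Longrightarrow> f x \<in> carrier A" "\<And>x. x \<in> set xs \<Longrightarrow> \<not> p x \<Longrightarrow> f x = \<^bold>0"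
  shows "lsum A f (filter p xs) = lsum A f xs"
  using assms by (induction xs) auto

lemma lsum_partition:
  assumes "\<And>x. x \<in> set xs \<Longrightarrow> f x \<in> carrier A"
  shows "lsum A f xs = lsum A f (filter p xs) \<^bold>+ lsum A f (filter (\<lambda>x. \<not> p x) xs)"
  using assms
proof (induction xs)
  case (Cons x xs)
  then have "lsum A f (filter p xs) \<in> carrier A" "lsum A f (filter (\<lambda>x. \<not> p x) xs) \<in> carrier A"
    by (auto intro!: lsum_closed)
  then show ?case using Cons by (simp add: add_assoc add_left_comm)
qed simp

lemma asum_set:
  assumes "distinct xs" "\<And>x. x \<in> set xs \<Longrightarrow> f x \<in> carrier A"
  shows "asum A f (set xs) = lsum A f xs"
  using assms by (induction xs) auto

end


section \<open>Homomorphisms\<close>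

context
  fixes A :: "('k :: field, 'a) nu_algebra" and B :: "('k, 'b) nu_algebra"
    and \<phi> :: "'a \<Rightarrow> 'b"
  assumes hom: "\<phi> \<in> alg_hom A B"
begin

lemma hom_closed: "a \<in> carrier A \<Longrightarrow> \<phi> a \<in> carrier B"
  and hom_add: "\<lbrakk>a \<in> carrier A; b \<in> carrier A\<rbrakk> \<Longrightarrow> \<phi> (aadd A a b) = aadd B (\<phi> a) (\<phi> b)"
  and hom_mult: "\<lbrakk>a \<in> carrier A; b \<in> carrier A\<rbrakk> \<Longrightarrow> \<phi> (amult A a b) = amult B (\<phi> a) (\<phi> b)"
  and hom_scale: "a \<in> carrier A \<Longrightarrow> \<phi> (ascale A r a) = ascale B r (\<phi> a)"
  and hom_extensional: "\<phi> \<in> extensional (carrier A)"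
  using hom by (auto simp: alg_hom_def PiE_def)

lemma hom_zero:
  assumes "nu_algebra A" "nu_algebra B"
  shows "\<phi> (azero A) = azero B"
proof -
  have z: "azero A \<in> carrier A" using assms(1) by (rule nu_algebra.zero_closed)
  have "\<phi> (ascale A 0 (azero A)) = ascale B 0 (\<phi> (azero A))"
    using z by (rule hom_scale)
  then show ?thesis
    using nu_algebra.scale_zero_left[OF assms(1) z]
      nu_algebra.scale_zero_left[OF assms(2) hom_closed[OF z]] by simp
qed

lemma hom_asum:
  assumes "nu_algebra A" "nu_algebra B" "finite I" "\<And>i. i \<in> I \<Longrightarrow> f i \<in> carrier A"
  shows "\<phi> (asum A f I) = asum B (\<lambda>i. \<phi> (f i)) I"
proof -
  interpret A: nu_algebra A by fact
  interpret B: nu_algebra B by fact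
  show ?thesis
    using assms(3,4)
    by (induction I rule: finite_induct) (auto simp: hom_zero[OF assms(1,2)] hom_add hom_closed)
qed

end

lemma hom_comp:
  assumes "nu_algebra A" "\<phi> \<in> alg_hom A B" "\<psi> \<in> alg_hom B C"
  shows "restrict (\<lambda>a. \<psi> (\<phi> a)) (carrier A) \<in> alg_hom A C"
proof -
  interpret A: nu_algebra A by fact
  show ?thesis
    using assms by (auto simp: alg_hom_def PiE_def Pi_def)
qed

lemma hom_id:
  assumes "nu_algebra A"
  shows "restrict (\<lambda>a. a) (carrier A) \<in> alg_hom A A"
proof -
  interpret A: nu_algebra A by fact
  show ?thesis by (auto simp: alg_hom_def)
qed


section \<open>The universal property of an algebra given by generators and relations\<close>

primrec aeval :: "('k, 'b) nu_algebra \<Rightarrow> ('g \<Rightarrow> 'b) \<Rightarrow> ('k, 'g) aterm \<Rightarrow> 'b" where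
  "aeval B g (Gen x) = g x"
| "aeval B g Zero = azero B"
| "aeval B g (Add s t) = aadd B (aeval B g s) (aeval B g t)"
| "aeval B g (Mult s t) = amult B (aeval B g s) (aeval B g t)"
| "aeval B g (Scale r t) = ascale B r (aeval B g t)"

lemma (in nu_algebra) aeval_closed:
  assumes "\<And>x. x \<in> X \<Longrightarrow> g x \<in> carrier A" "t \<in> terms X"
  shows "aeval A g t \<in> carrier A"
  using assms(2) by (induction t) (auto simp: assms(1))

lemma (in nu_algebra) aeval_cong:
  assumes g: "\<And>x. x \<in> X \<Longrightarrow> g x \<in> carrier A"
    and R: "\<And>s t. \<lbrakk>(s, t) \<in> R; s \<in> terms X; t \<in> terms X\<rbrakk> \<Longrightarrow> aeval A g s = aeval A g t"
    and "alg_cong X R s t"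
  shows "aeval A g s = aeval A g t"
  using assms(3)
  by (induction rule: alg_cong.induct)
    (auto simp: R aeval_closed[OF g] add_assoc add_neg scale_one scale_scale
      scale_add_left scale_add_right mult_assoc distrib_left distrib_right scale_mult_left
      scale_mult_right intro: add_comm)

lemma (in nu_algebra) presented_algebra_hom_exists:
  fixes R :: "('k, 'g) aterm rel"
  assumes g: "\<And>x. x \<in> X \<Longrightarrow> g x \<in> carrier A"
    and R: "\<And>s t. \<lbrakk>(s, t) \<in> R; s \<in> terms X; t \<in> terms X\<rbrakk> \<Longrightarrow> aeval A g s = aeval A g t"
  shows "\<exists>\<phi> \<in> alg_hom (presented_algebra X R) A. \<forall>x\<in>X. \<phi> (cls X R (Gen x)) = g x"
proof -
  let ?P = "presented_algebra X R"
  interpret P: nu_algebra ?P by (rule nu_algebra_presented_algebra)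
  \<comment> \<open>Evaluation is constant on congruence classes by \<open>aeval_cong\<close>, so
    any representative may be chosen. The restriction supplies the extensionality demanded by
    \<open>alg_hom\<close>.\<close>
  define \<phi> where "\<phi> = restrict (\<lambda>S. aeval A g (SOME t. t \<in> S)) (carrier ?P)"
  have c: "carrier ?P = cls X R ` terms X" by (simp add: presented_algebra_def)
  have \<phi>: "\<phi> (cls X R t) = aeval A g t" if t: "t \<in> terms X" for t
  proof -
    have "t \<in> cls X R t" using t by (simp add: cls_def alg_cong.refl)
    then have "(SOME t'. t' \<in> cls X R t) \<in> cls X R t" by (rule someI)
    then have "alg_cong X R t (SOME t'. t' \<in> cls X R t)" by (simp add: cls_def)
    then show ?thesis
      using t aeval_cong[OF g R, of X R t] by (simp add: \<phi>_def c)
  qed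
  have "\<phi> \<in> alg_hom ?P A"
    unfolding alg_hom_def
  proof (intro CollectI conjI ballI allI)
    show "\<phi> \<in> carrier ?P \<rightarrow>\<^sub>E carrier A"
      using \<phi> aeval_closed[OF g, of X] by (auto simp: \<phi>_def c)
  qed (auto simp: c presented_algebra_ops \<phi>)
  moreover have "\<forall>x\<in>X. \<phi> (cls X R (Gen x)) = g x" by (simp add: \<phi>)
  ultimately show ?thesis by blast
qed

lemma presented_algebra_induct [consumes 1, case_names Gen Zero Add Mult Scale]:
  fixes R :: "('k :: field, 'g) aterm rel"
  assumes "a \<in> carrier (presented_algebra X R)"
    and "\<And>x. x \<in> X \<Longrightarrow> Q (cls X R (Gen x))"
    and "Q (azero (presented_algebra X R))"
    and "\<And>a b. \<lbrakk>a \<in> carrier (presented_algebra X R); b \<in> carrier (presented_algebra X R); Q a; Q b\<rbrakk>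
      \<Longrightarrow> Q (aadd (presented_algebra X R) a b)"
    and "\<And>a b. \<lbrakk>a \<in> carrier (presented_algebra X R); b \<in> carrier (presented_algebra X R); Q a; Q b\<rbrakk>
      \<Longrightarrow> Q (amult (presented_algebra X R) a b)"
    and "\<And>r a. \<lbrakk>a \<in> carrier (presented_algebra X R); Q a\<rbrakk>
      \<Longrightarrow> Q (ascale (presented_algebra X R) r a)"
  shows "Q a"
proof -
  have c: "carrier (presented_algebra X R) = cls X R ` terms X"
    and z: "azero (presented_algebra X R) = cls X R Zero"
    by (simp_all add: presented_algebra_def)
  have "Q (cls X R t)" if "t \<in> terms X" for t
    using that
  proof (induction t)
    case (Add s t) then show ?case using assms(4)[of "cls X R s" "cls X R t"]
      by (simp add: c presented_algebra_ops)
  next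
    case (Mult s t) then show ?case using assms(5)[of "cls X R s" "cls X R t"]
      by (simp add: c presented_algebra_ops)
  next
    case (Scale r t) then show ?case using assms(6)[of "cls X R t" r]
      by (simp add: c presented_algebra_ops)
  qed (use assms(2,3) z in auto)
  then show ?thesis using assms(1) c by auto
qed

lemma presented_algebra_hom_unique:
  fixes R :: "('k :: field, 'g) aterm rel"
  assumes "nu_algebra B"
    and \<phi>: "\<phi> \<in> alg_hom (presented_algebra X R) B" and \<psi>: "\<psi> \<in> alg_hom (presented_algebra X R) B"
    and "\<And>x. x \<in> X \<Longrightarrow> \<phi> (cls X R (Gen x)) = \<psi> (cls X R (Gen x))"
  shows "\<phi> = \<psi>"
proof (rule extensionalityI[OF hom_extensional[OF \<phi>] hom_extensional[OF \<psi>]])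
  fix a assume "a \<in> carrier (presented_algebra X R)"
  then show "\<phi> a = \<psi> a"
    by (induction rule: presented_algebra_induct)
      (simp_all add: assms(4) hom_zero[OF \<phi>] hom_zero[OF \<psi>] hom_add[OF \<phi>] hom_add[OF \<psi>]
        hom_mult[OF \<phi>] hom_mult[OF \<psi>] hom_scale[OF \<phi>] hom_scale[OF \<psi>]
        nu_algebra_presented_algebra assms(1))
qed


section \<open>Paths and monomials in a Leavitt path algebra\<close>

lemma (in wf_digraph) awalk_append_cancel:
  assumes "awalk u p x" "awalk u (p @ q) y"
  shows "awalk x q y"
  using assms by simp

text \<open>\<open>L\<close> is a parameter pinned by an equation: the algebra laws apply to an
  opaque name, and the presentation is opened only where generators are concerned.
  \<open>wf_digraph\<close> asks only that sources and ranges be vertices, so the graph may be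
  infinite in every respect.\<close>

locale leavitt = wf_digraph E + nu_algebra L
  for E :: "('v, 'e) pre_digraph" and L :: "('k :: field, ('k, 'v, 'e) lpa) nu_algebra" +
  assumes L_def: "L = leavitt_path_algebra E"
begin

abbreviation add_L (infixl "\<^bold>+" 65) where "a \<^bold>+ b \<equiv> aadd L a b"
abbreviation mult_L (infixl "\<^bold>*" 70) where "a \<^bold>* b \<equiv> amult L a b"
abbreviation scale_L (infixr "\<^bold>." 75) where "r \<^bold>. a \<equiv> ascale L r a"
abbreviation zero_L ("\<^bold>0") where "\<^bold>0 \<equiv> azero L"

abbreviation vt :: "'v \<Rightarrow> ('k, 'v, 'e) lpa" where "vt u \<equiv> lpa_vert E u"
abbreviation ed :: "'e \<Rightarrow> ('k, 'v, 'e) lpa" where "ed f \<equiv> lpa_edge E f"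
abbreviation gh :: "'e \<Rightarrow> ('k, 'v, 'e) lpa" where "gh f \<equiv> lpa_ghost E f"

section \<open>The defining relations as equations in L\<close>

lemma carrier_L: "carrier L = cls (lpa_gens E) (lpa_rels E) ` terms (lpa_gens E)"
  by (simp add: L_def leavitt_path_algebra_def presented_algebra_def)

lemma zero_L_cls: "\<^bold>0 = cls (lpa_gens E) (lpa_rels E) Zero"
  by (simp add: L_def leavitt_path_algebra_def presented_algebra_def)

lemma L_ops:
  assumes "s \<in> terms (lpa_gens E)" "t \<in> terms (lpa_gens E)"
  shows "cls (lpa_gens E) (lpa_rels E) s \<^bold>+ cls (lpa_gens E) (lpa_rels E) t
      = cls (lpa_gens E) (lpa_rels E) (Add s t)"
    and "cls (lpa_gens E) (lpa_rels E) s \<^bold>* cls (lpa_gens E) (lpa_rels E) t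
      = cls (lpa_gens E) (lpa_rels E) (Mult s t)"
  unfolding L_def leavitt_path_algebra_def by (rule presented_algebra_ops[OF assms])+

lemma lpa_gens_iff [simp]:
  "Vert u \<in> lpa_gens E \<longleftrightarrow> u \<in> verts E"
  "Edge f \<in> lpa_gens E \<longleftrightarrow> f \<in> arcs E"
  "Ghost f \<in> lpa_gens E \<longleftrightarrow> f \<in> arcs E"
  by (auto simp: lpa_gens_def)

lemma gens_closed [simp, intro]:
  "u \<in> verts E \<Longrightarrow> vt u \<in> carrier L"
  "f \<in> arcs E \<Longrightarrow> ed f \<in> carrier L"
  "f \<in> arcs E \<Longrightarrow> gh f \<in> carrier L"
  by (auto simp: carrier_L lpa_vert_def lpa_edge_def lpa_ghost_def)

lemma cls_rel:
  assumes "(s, t) \<in> lpa_rels E" "s \<in> terms (lpa_gens E)" "t \<in> terms (lpa_gens E)"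
  shows "cls (lpa_gens E) (lpa_rels E) s = cls (lpa_gens E) (lpa_rels E) t"
  using assms by (simp add: cls_eq_iff alg_cong.rel)

lemma vt_vt:
  assumes "u \<in> verts E" "x \<in> verts E"
  shows "vt u \<^bold>* vt x = (if u = x then vt x else \<^bold>0)"
  using cls_rel[OF lpa_rels.vertex[OF assms]] assms
  by (auto simp: L_ops lpa_vert_def zero_L_cls split: if_splits)

text \<open>Only u = s(f) is a defining relation. For any other u, insert s(f) in front of f and use
  that distinct vertices are orthogonal. The three lemmas after this one follow the same
  pattern.\<close>

lemma vt_ed:
  assumes "f \<in> arcs E" "u \<in> verts E"
  shows "vt u \<^bold>* ed f = (if u = tail E f then ed f else \<^bold>0)"
proof -
  have *: "vt (tail E f) \<^bold>* ed f = ed f"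
    using cls_rel[OF lpa_rels.source_edge[OF assms(1)]] assms
    by (simp add: L_ops lpa_vert_def lpa_edge_def)
  show ?thesis
  proof (cases "u = tail E f")
    case True
    then show ?thesis using * by simp
  next
    case False
    have "vt u \<^bold>* ed f = vt u \<^bold>* (vt (tail E f) \<^bold>* ed f)" unfolding * ..
    also have "\<dots> = \<^bold>0"
      using assms False by (simp add: mult_assoc[symmetric] vt_vt)
    finally show ?thesis unfolding if_not_P[OF False] .
  qed
qed

lemma ed_vt:
  assumes "f \<in> arcs E" "u \<in> verts E"
  shows "ed f \<^bold>* vt u = (if u = head E f then ed f else \<^bold>0)"
proof -
  have *: "ed f \<^bold>* vt (head E f) = ed f"
    using cls_rel[OF lpa_rels.edge_range[OF assms(1)]] assms
    by (simp add: L_ops lpa_vert_def lpa_edge_def)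
  show ?thesis
  proof (cases "u = head E f")
    case True
    then show ?thesis using * by simp
  next
    case False
    have "ed f \<^bold>* vt u = (ed f \<^bold>* vt (head E f)) \<^bold>* vt u" unfolding * ..
    also have "\<dots> = \<^bold>0"
      using assms False by (simp add: mult_assoc vt_vt)
    finally show ?thesis unfolding if_not_P[OF False] .
  qed
qed

lemma gh_vt:
  assumes "f \<in> arcs E" "u \<in> verts E"
  shows "gh f \<^bold>* vt u = (if u = tail E f then gh f else \<^bold>0)"
proof -
  have *: "gh f \<^bold>* vt (tail E f) = gh f"
    using cls_rel[OF lpa_rels.ghost_source[OF assms(1)]] assms
    by (simp add: L_ops lpa_vert_def lpa_ghost_def)
  show ?thesis
  proof (cases "u = tail E f")
    case True
    then show ?thesis using * by simp
  next
    case False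
    have "gh f \<^bold>* vt u = (gh f \<^bold>* vt (tail E f)) \<^bold>* vt u" unfolding * ..
    also have "\<dots> = \<^bold>0"
      using assms False by (simp add: mult_assoc vt_vt)
    finally show ?thesis unfolding if_not_P[OF False] .
  qed
qed

lemma vt_gh:
  assumes "f \<in> arcs E" "u \<in> verts E"
  shows "vt u \<^bold>* gh f = (if u = head E f then gh f else \<^bold>0)"
proof -
  have *: "vt (head E f) \<^bold>* gh f = gh f"
    using cls_rel[OF lpa_rels.range_ghost[OF assms(1)]] assms
    by (simp add: L_ops lpa_vert_def lpa_ghost_def)
  show ?thesis
  proof (cases "u = head E f")
    case True
    then show ?thesis using * by simp
  next
    case False
    have "vt u \<^bold>* gh f = vt u \<^bold>* (vt (head E f) \<^bold>* gh f)" unfolding * ..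
    also have "\<dots> = \<^bold>0"
      using assms False by (simp add: mult_assoc[symmetric] vt_vt)
    finally show ?thesis unfolding if_not_P[OF False] .
  qed
qed

lemma gh_ed:
  assumes "f \<in> arcs E" "g \<in> arcs E"
  shows "gh f \<^bold>* ed g = (if f = g then vt (head E f) else \<^bold>0)"
  using cls_rel[OF lpa_rels.ck1[OF assms]] assms
  by (auto simp: L_ops lpa_vert_def lpa_edge_def lpa_ghost_def zero_L_cls split: if_splits)

lemma ck2:
  assumes "regular_vertex E u"
  shows "vt u = asum L (\<lambda>f. ed f \<^bold>* gh f) (out_arcs E u)"
proof -
  \<comment> \<open>The relation is available for every enumeration of the emitted edges; one is
    fixed, and its nested term is evaluated as a sum along the list.\<close>
  obtain es where es: "set es = out_arcs E u" "distinct es"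
    using assms finite_distinct_list by (auto simp: regular_vertex_def)
  let ?sum = "\<lambda>es. foldr Add (map (\<lambda>e. Mult (Gen (Edge e)) (Gen (Ghost e))) es)
    (Zero :: ('k, ('v, 'e) lpa_gen) aterm)"
  have sum: "?sum fs \<in> terms (lpa_gens E) \<and>
      cls (lpa_gens E) (lpa_rels E) (?sum fs) = lsum L (\<lambda>f. ed f \<^bold>* gh f) fs"
    if "set fs \<subseteq> arcs E" for fs
    using that
  proof (induction fs)
    case (Cons f fs)
    then have "ed f \<^bold>* gh f = cls (lpa_gens E) (lpa_rels E) (Mult (Gen (Edge f)) (Gen (Ghost f)))"
      by (simp add: L_ops lpa_edge_def lpa_ghost_def)
    with Cons show ?case by (simp add: L_ops flip: conjunct2[OF Cons.IH])
  qed (simp add: zero_L_cls)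
  have sub: "set es \<subseteq> arcs E" using es by auto
  have "vt u = cls (lpa_gens E) (lpa_rels E) (?sum es)"
    unfolding lpa_vert_def
    using sum[OF sub] assms
    by (intro cls_rel lpa_rels.ck2 es) (auto simp: regular_vertex_def)
  also have "\<dots> = asum L (\<lambda>f. ed f \<^bold>* gh f) (set es)"
    using sum[OF sub] sub es(2) by (subst asum_set) auto
  finally show ?thesis using es by simp
qed

lemma leavitt_induct [consumes 1, case_names Vert Edge Ghost Zero Add Mult Scale]:
  assumes "a \<in> carrier L"
    and "\<And>u. u \<in> verts E \<Longrightarrow> Q (vt u)"
    and "\<And>f. f \<in> arcs E \<Longrightarrow> Q (ed f)"
    and "\<And>f. f \<in> arcs E \<Longrightarrow> Q (gh f)"
    and "Q \<^bold>0"
    and "\<And>a b. \<lbrakk>a \<in> carrier L; b \<in> carrier L; Q a; Q b\<rbrakk> \<Longrightarrow> Q (a \<^bold>+ b)"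
    and "\<And>a b. \<lbrakk>a \<in> carrier L; b \<in> carrier L; Q a; Q b\<rbrakk> \<Longrightarrow> Q (a \<^bold>* b)"
    and "\<And>r a. \<lbrakk>a \<in> carrier L; Q a\<rbrakk> \<Longrightarrow> Q (r \<^bold>. a)"
  shows "Q a"
  using assms(1) unfolding L_def leavitt_path_algebra_def
proof (induction rule: presented_algebra_induct)
  case (Gen x)
  then show ?case
    using assms(2-4) by (auto simp: lpa_gens_def lpa_vert_def lpa_edge_def lpa_ghost_def)
qed (use assms(5-8) in \<open>simp_all add: L_def leavitt_path_algebra_def\<close>)

text \<open>The source is an argument because an empty path does not determine its vertex. On a
  nonempty path it is ignored, so the lemmas below carry \<open>awalk\<close> hypotheses that tie
  the two together.\<close>

primrec pel :: "'v \<Rightarrow> 'e list \<Rightarrow> ('k, 'v, 'e) lpa" where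
  "pel u [] = vt u"
| "pel u (f # p) = ed f \<^bold>* pel (head E f) p"

text \<open>The ghost p* of the path p, with the edges in reverse order. Here u is still the source
  of p, so it acts as an identity on the right of p*.\<close>

primrec gel :: "'v \<Rightarrow> 'e list \<Rightarrow> ('k, 'v, 'e) lpa" where
  "gel u [] = vt u"
| "gel u (f # p) = gel (head E f) p \<^bold>* gh f"

section \<open>Products of paths and ghost paths\<close>

lemma pel_closed [simp]: "awalk u p x \<Longrightarrow> pel u p \<in> carrier L"
  by (induction p arbitrary: u) (auto simp: awalk_simps)

lemma gel_closed [simp]: "awalk u p x \<Longrightarrow> gel u p \<in> carrier L"
  by (induction p arbitrary: u) (auto simp: awalk_simps)

lemma vt_pel: "\<lbrakk>awalk u p x; y \<in> verts E\<rbrakk> \<Longrightarrow> vt y \<^bold>* pel u p = (if y = u then pel u p else \<^bold>0)"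
  by (cases p) (auto simp: awalk_simps vt_vt vt_ed mult_assoc[symmetric])

lemma pel_vt: "\<lbrakk>awalk u p x; y \<in> verts E\<rbrakk> \<Longrightarrow> pel u p \<^bold>* vt y = (if y = x then pel u p else \<^bold>0)"
  by (induction p arbitrary: u) (auto simp: awalk_simps vt_vt mult_assoc)

lemma gel_vt: "\<lbrakk>awalk u p x; y \<in> verts E\<rbrakk> \<Longrightarrow> gel u p \<^bold>* vt y = (if y = u then gel u p else \<^bold>0)"
  by (cases p) (auto simp: awalk_simps vt_vt gh_vt mult_assoc)

lemma vt_gel: "\<lbrakk>awalk u p x; y \<in> verts E\<rbrakk> \<Longrightarrow> vt y \<^bold>* gel u p = (if y = x then gel u p else \<^bold>0)"
  by (induction p arbitrary: u) (auto simp: awalk_simps vt_vt mult_assoc[symmetric])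

lemma pel_append: "\<lbrakk>awalk u p x; awalk x q y\<rbrakk> \<Longrightarrow> pel u (p @ q) = pel u p \<^bold>* pel x q"
  by (induction p arbitrary: u)
    (auto simp: awalk_simps vt_pel mult_assoc awalk_hd_in_verts)

lemma gel_append: "\<lbrakk>awalk u p x; awalk x q y\<rbrakk> \<Longrightarrow> gel u (p @ q) = gel x q \<^bold>* gel u p"
  by (induction p arbitrary: u)
    (auto simp: awalk_simps gel_vt mult_assoc awalk_hd_in_verts)

lemma gel_pel_Cons:
  assumes "awalk (head E f) p x" "f \<in> arcs E" "awalk (head E g) q y" "g \<in> arcs E"
  shows "gel u (f # p) \<^bold>* pel u (g # q) = (if f = g then gel (head E f) p \<^bold>* pel (head E f) q else \<^bold>0)"
proof -
  have "gel u (f # p) \<^bold>* pel u (g # q) = gel (head E f) p \<^bold>* ((gh f \<^bold>* ed g) \<^bold>* pel (head E g) q)"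
    using assms by (simp add: mult_assoc)
  then show ?thesis using assms by (auto simp: gh_ed vt_pel)
qed

lemma gel_pel_self: "awalk u p x \<Longrightarrow> gel u p \<^bold>* pel u p = vt x"
proof (induction p arbitrary: u)
  case Nil then show ?case by (auto simp: awalk_simps vt_vt)
next
  case (Cons f p)
  then have f: "f \<in> arcs E" "awalk (head E f) p x" by (auto simp: awalk_simps)
  show ?case using gel_pel_Cons[OF f(2,1) f(2,1), of u] Cons.IH[OF f(2)] by simp
qed

lemma gel_pel_append:
  assumes "awalk u p x" "awalk x q y"
  shows "gel u p \<^bold>* pel u (p @ q) = pel x q" "gel u (p @ q) \<^bold>* pel u p = gel x q"
  using assms
  by (simp_all add: pel_append gel_append mult_assoc gel_pel_self gel_vt awalk_hd_in_verts)
    (simp add: mult_assoc[symmetric] gel_pel_self vt_pel awalk_hd_in_verts)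

text \<open>CK1 cancels the common initial edges one at a time. Since neither path is a prefix of
  the other, two different edges f and g finally meet, and f* g = 0.\<close>

lemma gel_pel_parallel:
  assumes "awalk u p x" "awalk u q y" "\<not> prefix p q" "\<not> prefix q p"
  shows "gel u p \<^bold>* pel u q = \<^bold>0"
  using assms
proof (induction p arbitrary: u q)
  case (Cons f p)
  then obtain g q' where q: "q = g # q'" by (cases q) auto
  have fg: "f \<in> arcs E" "awalk (head E f) p x" "g \<in> arcs E" "awalk (head E g) q' y"
    using Cons.prems q by (auto simp: awalk_simps)
  show ?case
    unfolding q gel_pel_Cons[OF fg(2,1) fg(4,3)]
    using Cons.IH[of "head E f" q'] Cons.prems fg by (auto simp: q)
qed simp

lemma gel_pel_neq:
  assumes "awalk u p x" "awalk u' q y" "u \<noteq> u'"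
  shows "gel u p \<^bold>* pel u' q = \<^bold>0"
proof -
  have "gel u p \<^bold>* (vt u \<^bold>* pel u' q) = \<^bold>0"
    using assms by (simp add: vt_pel awalk_hd_in_verts)
  moreover have "gel u p \<^bold>* (vt u \<^bold>* pel u' q) = gel u p \<^bold>* pel u' q"
    using assms by (simp add: gel_vt awalk_hd_in_verts mult_assoc[symmetric])
  ultimately show ?thesis by simp
qed

text \<open>Data for r p q*: u and x are the sources of p and q, and y is their common range.
  Keeping the scalar in the tuple lets scaling and adding act on lists of tuples.\<close>

definition monomials :: "('k \<times> 'v \<times> 'e list \<times> 'v \<times> 'e list) set" where
  "monomials = {(r, u, p, x, q). \<exists>y. awalk u p y \<and> awalk x q y}"

fun mono_val :: "'k \<times> 'v \<times> 'e list \<times> 'v \<times> 'e list \<Rightarrow> ('k, 'v, 'e) lpa" where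
  "mono_val (r, u, p, x, q) = r \<^bold>. (pel u p \<^bold>* gel x q)"

declare mono_val.simps [simp del]

lemma mono_val_closed [simp]: "t \<in> monomials \<Longrightarrow> mono_val t \<in> carrier L"
  by (auto simp: monomials_def mono_val.simps)

lemma lsum_mono_val_closed [simp]: "set ts \<subseteq> monomials \<Longrightarrow> lsum L mono_val ts \<in> carrier L"
  by (intro lsum_closed mono_val_closed) (rule subsetD)

text \<open>By bilinearity it is enough to test b on monomials with coefficient 1; the scalar is
  afterwards absorbed into the coefficients of the result by \<open>sc\<close>.\<close>

lemma lsum_mult_span_aux:
  assumes b: "b \<in> carrier L"
    and mono: "\<And>u p x q y. \<lbrakk>awalk u p y; awalk x q y\<rbrakk>
      \<Longrightarrow> \<exists>ts. set ts \<subseteq> monomials \<and> b \<^bold>* (pel u p \<^bold>* gel x q) = lsum L mono_val ts"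
    and "set ts \<subseteq> monomials"
  shows "\<exists>ts'. set ts' \<subseteq> monomials \<and> b \<^bold>* lsum L mono_val ts = lsum L mono_val ts'"
  using assms(3)
proof (induction ts)
  case Nil
  then show ?case using b by (intro exI[of _ "[]"]) simp
next
  case (Cons t ts)
  obtain r u p x q y where t: "t = (r, u, p, x, q)" "awalk u p y" "awalk x q y"
    using Cons.prems by (cases t) (auto simp: monomials_def)
  obtain ts1 where ts1: "set ts1 \<subseteq> monomials" "b \<^bold>* lsum L mono_val ts = lsum L mono_val ts1"
    using Cons by auto
  obtain ts2 where ts2: "set ts2 \<subseteq> monomials" "b \<^bold>* (pel u p \<^bold>* gel x q) = lsum L mono_val ts2"
    using mono[OF t(2,3)] by blast
  define sc where "sc = (\<lambda>(r', w). (r * r', w) :: 'k \<times> 'v \<times> 'e list \<times> 'v \<times> 'e list)"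
  have sc: "sc t \<in> monomials" "mono_val (sc t) = r \<^bold>. mono_val t" if "t \<in> monomials" for t
    using that by (auto simp: sc_def monomials_def mono_val.simps scale_scale)
  have "b \<^bold>* lsum L mono_val (t # ts) = r \<^bold>. lsum L mono_val ts2 \<^bold>+ lsum L mono_val ts1"
    using b t Cons.prems
    by (simp add: distrib_left ts1(2)[symmetric] ts2(2)[symmetric] scale_mult_right mono_val.simps)
  also have "r \<^bold>. lsum L mono_val ts2 = lsum L mono_val (map sc ts2)"
    using ts2(1) sc by (subst scale_lsum) (auto simp: lsum_map intro!: lsum_cong)
  also have "\<dots> \<^bold>+ lsum L mono_val ts1 = lsum L mono_val (map sc ts2 @ ts1)"
    using ts2(1) ts1(1) sc by (intro lsum_append[symmetric]) auto
  finally show ?case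
    using ts1(1) ts2(1) sc by (intro exI[of _ "map sc ts2 @ ts1"]) auto
qed

lemma lsum_mult_span:
  assumes "b \<in> carrier L"
    and "\<And>u p x q y. \<lbrakk>awalk u p y; awalk x q y\<rbrakk>
      \<Longrightarrow> \<exists>ts. set ts \<subseteq> monomials \<and> b \<^bold>* (pel u p \<^bold>* gel x q) = lsum L mono_val ts"
    and "\<exists>ts. set ts \<subseteq> monomials \<and> c = lsum L mono_val ts"
  shows "\<exists>ts. set ts \<subseteq> monomials \<and> b \<^bold>* c = lsum L mono_val ts"
proof -
  obtain ts where ts: "set ts \<subseteq> monomials" "c = lsum L mono_val ts"
    using assms(3) by (elim exE conjE)
  show ?thesis unfolding ts(2) by (rule lsum_mult_span_aux[OF assms(1,2) ts(1)])
qed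

lemma mono_spanI:
  assumes "awalk u p y" "awalk x q y" "a = pel u p \<^bold>* gel x q"
  shows "\<exists>ts. set ts \<subseteq> monomials \<and> a = lsum L mono_val ts"
  using assms by (intro exI[of _ "[(1, u, p, x, q)]"]) (auto simp: monomials_def scale_one mono_val.simps)

lemma zero_spanI: "a = \<^bold>0 \<Longrightarrow> \<exists>ts. set ts \<subseteq> monomials \<and> a = lsum L mono_val ts"
  by (intro exI[of _ "[]"]) auto

text \<open>Left multiplication by a generator preserves the span of the monomials \<open>p q*\<close>.
  As there is no unit, membership in the span is carried through the induction as well.\<close>

lemma mono_span:
  assumes "a \<in> carrier L"
  obtains ts where "set ts \<subseteq> monomials" "a = lsum L mono_val ts"
proof -
  let ?span = "\<lambda>a. \<exists>ts. set ts \<subseteq> monomials \<and> a = lsum L mono_val ts"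
  have "?span a \<and> (\<forall>b. ?span b \<longrightarrow> ?span (a \<^bold>* b))"
    using assms
  proof (induction rule: leavitt_induct)
    case (Vert u)
    have "?span (vt u)"
      using Vert by (intro mono_spanI[of u "[]" u u "[]"]) (auto simp: awalk_simps vt_vt)
    moreover have m: "?span (vt u \<^bold>* (pel u' p \<^bold>* gel x q))" if "awalk u' p y" "awalk x q y" for u' p x q y
    proof (cases "u = u'")
      case True
      then show ?thesis using that Vert
        by (intro mono_spanI[of u' p y x q]) (simp_all add: mult_assoc[symmetric] vt_pel)
    next
      case False
      then show ?thesis using that Vert
        by (intro zero_spanI) (simp add: mult_assoc[symmetric] vt_pel)
    qed
    moreover have "?span (vt u \<^bold>* b)" if "?span b" for b
      by (rule lsum_mult_span[OF gens_closed(1)[OF Vert] m that])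
    ultimately show ?case by iprover
  next
    case (Edge f)
    have "?span (ed f)"
      using Edge by (intro mono_spanI[of "tail E f" "[f]" "head E f" "head E f" "[]"])
        (auto simp: awalk_simps ed_vt vt_vt mult_assoc)
    moreover have m: "?span (ed f \<^bold>* (pel u p \<^bold>* gel x q))" if "awalk u p y" "awalk x q y" for u p x q y
    proof (cases "head E f = u")
      case True
      then show ?thesis using that Edge
        by (intro mono_spanI[of "tail E f" "f # p" y x q]) (auto simp: mult_assoc awalk_simps)
    next
      case False
      have u: "u \<in> verts E" using that by blast
      have "ed f \<^bold>* pel u p = ed f \<^bold>* (vt u \<^bold>* pel u p)" using that u by (simp add: vt_pel)
      also have "\<dots> = \<^bold>0" using that u Edge False by (simp add: mult_assoc[symmetric] ed_vt)
      finally show ?thesis using that Edge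
        by (intro zero_spanI) (simp add: mult_assoc[symmetric])
    qed
    moreover have "?span (ed f \<^bold>* b)" if "?span b" for b
      by (rule lsum_mult_span[OF gens_closed(2)[OF Edge] m that])
    ultimately show ?case by iprover
  next
    case (Ghost f)
    have "?span (gh f)"
      using Ghost by (intro mono_spanI[of "head E f" "[]" "head E f" "tail E f" "[f]"])
        (auto simp: awalk_simps vt_gh vt_vt mult_assoc[symmetric])
    moreover have m: "?span (gh f \<^bold>* (pel u p \<^bold>* gel x q))" if pq: "awalk u p y" "awalk x q y" for u p x q y
    proof (cases "tail E f = u")
      case True
      \<comment> \<open>f* is rewritten as the ghost of a one-edge path so that the prefix rules for
        ghosts times paths apply. An empty p lengthens the ghost to (q f)* , a p beginning with f
        loses that edge, and any other first edge gives zero.\<close>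
      have eq: "gh f \<^bold>* (pel u p \<^bold>* gel x q) = (gel u [f] \<^bold>* pel u p) \<^bold>* gel x q"
        using pq Ghost by (simp add: mult_assoc vt_gh)
      have f: "awalk u [f] (head E f)" using Ghost True by (auto simp: awalk_simps)
      show ?thesis
      proof (cases p)
        case Nil
        with pq have "y = u" by (auto simp: awalk_simps)
        with pq have q: "awalk x q u" and u: "u \<in> verts E" and hd: "head E f \<in> verts E"
          using Ghost by auto
        have "pel (head E f) [] \<^bold>* gel x (q @ [f]) = vt (head E f) \<^bold>* gel x (q @ [f])"
          by simp
        also have "\<dots> = gel x (q @ [f])"
          using vt_gel[of x "q @ [f]" "head E f" "head E f"] q f hd by auto
        also have "\<dots> = gel u [f] \<^bold>* gel x q" by (rule gel_append[OF q f])
        also have "\<dots> = (gel u [f] \<^bold>* pel u p) \<^bold>* gel x q"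
          unfolding Nil using gel_vt[OF f u] by simp
        finally have "(gel u [f] \<^bold>* pel u p) \<^bold>* gel x q = pel (head E f) [] \<^bold>* gel x (q @ [f])" ..
        moreover have "awalk (head E f) [] (head E f)" "awalk x (q @ [f]) (head E f)"
          using q f hd by (auto simp: awalk_simps)
        ultimately show ?thesis unfolding eq by (intro mono_spanI)
      next
        case (Cons g p')
        then have g: "g \<in> arcs E" "awalk (head E g) p' y" using pq by (auto simp: awalk_simps)
        show ?thesis
        proof (cases "f = g")
          case True
          then have "gel u [f] \<^bold>* pel u p = pel (head E f) p'"
            using gel_pel_append(1)[OF f, of p' y] g Cons by simp
          then show ?thesis unfolding eq using pq g True by (intro mono_spanI) auto
        next
          case False
          then have "gel u [f] \<^bold>* pel u p = \<^bold>0"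
            using gel_pel_parallel[OF f pq(1)] Cons by auto
          then show ?thesis unfolding eq using pq by (intro zero_spanI) simp
        qed
      qed
    next
      case False
      have u: "u \<in> verts E" using that by blast
      have "gh f \<^bold>* pel u p = gh f \<^bold>* (vt u \<^bold>* pel u p)" using that u by (simp add: vt_pel)
      also have "\<dots> = \<^bold>0" using that u Ghost False by (simp add: mult_assoc[symmetric] gh_vt)
      finally show ?thesis using that Ghost
        by (intro zero_spanI) (simp add: mult_assoc[symmetric])
    qed
    moreover have "?span (gh f \<^bold>* b)" if "?span b" for b
      by (rule lsum_mult_span[OF gens_closed(3)[OF Ghost] m that])
    ultimately show ?case by iprover
  next
    case Zero
    have "?span (\<^bold>0 \<^bold>* b)" if "?span b" for b
      using that by (intro zero_spanI) auto
    then show ?case using zero_spanI by iprover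
  next
    case (Add a b)
    have add: "?span (c \<^bold>+ d)" if cd: "?span c" "?span d" for c d
    proof -
      obtain ts ts' where ts: "set ts \<subseteq> monomials" "c = lsum L mono_val ts"
          "set ts' \<subseteq> monomials" "d = lsum L mono_val ts'" using cd by blast
      then have "lsum L mono_val (ts @ ts') = c \<^bold>+ d" by (subst lsum_append) auto
      then show ?thesis using ts by (intro exI[of _ "ts @ ts'"]) auto
    qed
    have m: "?span ((a \<^bold>+ b) \<^bold>* c)" if c: "?span c" for c
    proof -
      have "c \<in> carrier L" using c by auto
      then have "(a \<^bold>+ b) \<^bold>* c = a \<^bold>* c \<^bold>+ b \<^bold>* c" using Add by (simp add: distrib_right)
      moreover have "?span (a \<^bold>* c)" "?span (b \<^bold>* c)" using Add.IH c by iprover+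
      ultimately show ?thesis using add by simp
    qed
    have "?span (a \<^bold>+ b)" by (rule add[OF conjunct1[OF Add.IH(1)] conjunct1[OF Add.IH(2)]])
    then show ?case using m by (intro conjI allI impI)
  next
    case (Mult a b)
    have m: "?span ((a \<^bold>* b) \<^bold>* c)" if c: "?span c" for c
    proof -
      have "c \<in> carrier L" using c by auto
      then have "(a \<^bold>* b) \<^bold>* c = a \<^bold>* (b \<^bold>* c)" using Mult by (simp add: mult_assoc)
      moreover have "?span (a \<^bold>* (b \<^bold>* c))" using Mult.IH c by iprover
      ultimately show ?thesis by simp
    qed
    have "?span (a \<^bold>* b)" using Mult.IH by iprover
    then show ?case using m by (intro conjI allI impI)
  next
    case (Scale r a)
    have scale: "?span (r \<^bold>. c)" if c: "?span c" for c
    proof -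
      obtain ts where ts: "set ts \<subseteq> monomials" "c = lsum L mono_val ts" using c by blast
      define sc where "sc = (\<lambda>(r', w). (r * r', w) :: 'k \<times> 'v \<times> 'e list \<times> 'v \<times> 'e list)"
      have sc: "sc t \<in> monomials" "mono_val (sc t) = r \<^bold>. mono_val t" if "t \<in> monomials" for t
        using that by (auto simp: sc_def monomials_def mono_val.simps scale_scale)
      have "r \<^bold>. lsum L mono_val ts = lsum L mono_val (map sc ts)"
        using ts(1) sc by (subst scale_lsum) (auto simp: lsum_map intro!: lsum_cong)
      then show ?thesis using ts sc by (intro exI[of _ "map sc ts"]) auto
    qed
    have m: "?span ((r \<^bold>. a) \<^bold>* c)" if c: "?span c" for c
    proof -
      have "c \<in> carrier L" using c by auto
      then have "(r \<^bold>. a) \<^bold>* c = r \<^bold>. (a \<^bold>* c)" using Scale by (simp add: scale_mult_left)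
      moreover have "?span (a \<^bold>* c)" using Scale.IH c by iprover
      ultimately show ?thesis using scale by simp
    qed
    have "?span (r \<^bold>. a)" by (rule scale[OF conjunct1[OF Scale.IH]])
    then show ?case using m by (intro conjI allI impI)
  qed
  then show ?thesis using that by blast
qed

text \<open>A right local unit replaces the missing identity: if a is a sum of monomials p q*, the
  sum of the finitely many sources of the paths q fixes a from the right.\<close>

lemma eq_zero_if_mult_vt_eq_zero:
  assumes "a \<in> carrier L" "\<And>u. u \<in> verts E \<Longrightarrow> a \<^bold>* vt u = \<^bold>0"
  shows "a = \<^bold>0"
proof -
  obtain ts where ts: "set ts \<subseteq> monomials" "a = lsum L mono_val ts"
    using mono_span[OF assms(1)] .
  define F where "F = (\<lambda>(r, u, p, x, q). x) ` set ts"
  have F: "finite F" "F \<subseteq> verts E" using ts(1) by (auto simp: F_def monomials_def)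
  have e: "asum L vt F \<in> carrier L" using F by auto
  have "mono_val t \<^bold>* asum L vt F = mono_val t" if t: "t \<in> set ts" for t
  proof -
    obtain r u p x q y where t': "t = (r, u, p, x, q)" "awalk u p y" "awalk x q y"
      using t ts(1) by (cases t) (auto simp: monomials_def)
    have x: "x \<in> F" using t t'(1) by (force simp: F_def)
    have "gel x q \<^bold>* asum L vt F = asum L (\<lambda>u. gel x q \<^bold>* vt u) F"
      using t' F by (intro mult_asum) auto
    also have "\<dots> = asum L (\<lambda>u. if u = x then gel x q else \<^bold>0) F"
      using t' F by (intro asum_cong) (auto simp: gel_vt)
    also have "\<dots> = gel x q" using x F t' by (subst asum_delta) auto
    finally show ?thesis using t' e by (simp add: scale_mult_left mult_assoc mono_val.simps)
  qed
  then have "a = a \<^bold>* asum L vt F"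
    unfolding ts(2) using ts(1) e by (subst lsum_mult) (auto intro!: lsum_cong)
  also have "\<dots> = asum L (\<lambda>u. a \<^bold>* vt u) F" using F assms(1) by (intro mult_asum) auto
  also have "\<dots> = \<^bold>0" using F assms(2) by (intro asum_neutral) auto
  finally show ?thesis .
qed

end

lemma leavittI:
  assumes "wf_digraph E"
  shows "leavitt E (leavitt_path_algebra E)"
  using assms nu_algebra_presented_algebra
  by (simp add: leavitt_def leavitt_axioms_def leavitt_path_algebra_def)


section \<open>Linear independence via a graded representation\<close>

text \<open>Linear operators on all functions, with no condition on supports: the test function used
  below is nonzero at every point of degree 0.\<close>

definition endo_algebra :: "('k :: field, ('x \<Rightarrow> 'k) \<Rightarrow> 'x \<Rightarrow> 'k) nu_algebra" where
  "endo_algebra = \<lparr>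
     carrier = {T. (\<forall>g h. T (\<lambda>x. g x + h x) = (\<lambda>x. T g x + T h x)) \<and>
                   (\<forall>r g. T (\<lambda>x. r * g x) = (\<lambda>x. r * T g x))},
     azero = (\<lambda>g x. 0),
     aadd = (\<lambda>S T g x. S g x + T g x),
     amult = (\<lambda>S T g. S (T g)),
     ascale = (\<lambda>r T g x. r * T g x)\<rparr>"

lemma nu_algebra_endo_algebra: "nu_algebra endo_algebra"
  by unfold_locales (auto simp: endo_algebra_def algebra_simps)

text \<open>Absorption in cardinal arithmetic: an infinite set is equipotent with its product by any
  nonempty set that embeds into it. This permits vertices that emit edges of any
  cardinality.\<close>

lemma infinite_times_absorb:
  fixes Y :: "'y set" and F :: "'e set"
  assumes "infinite Y" "F \<noteq> {}" "h ` F \<subseteq> Y" "inj_on h F"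
  obtains j where "bij_betw j (Y \<times> F) Y"
proof -
  have "\<exists>h. inj_on h F \<and> h ` F \<subseteq> Y" using assms(3,4) by (intro exI[of _ h] conjI)
  then have le: "(card_of F, card_of Y) \<in> ordLeq" by (rule iffD1[OF card_of_ordLeq])
  have "\<exists>j. bij_betw j (Y \<times> F) Y"
    by (rule iffD2[OF card_of_ordIso conjunct1[OF card_of_Times_infinite[OF assms(1,2) le]]])
  then show ?thesis using that by (elim exE)
qed

context leavitt
begin

text \<open>A copy of the infinite type of \<open>J\<close>-arguments sits over each vertex, and the copy over a vertex emitting
  edges is identified with the disjoint union of the copies over the ranges of these edges. The
  edges then act on functions by shifting along these identifications; the integer coordinate
  records the degree.\<close>

lemma graded_shift_system:
  obtains J :: "'e \<Rightarrow> ('e + nat) \<Rightarrow> ('e + nat)" where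
    "\<And>f g y z. \<lbrakk>f \<in> arcs E; g \<in> arcs E; tail E f = tail E g\<rbrakk>
       \<Longrightarrow> J f y = J g z \<longleftrightarrow> f = g \<and> y = z"
    "\<And>f y. f \<in> arcs E \<Longrightarrow> \<exists>g z. g \<in> arcs E \<and> tail E g = tail E f \<and> y = J g z"
proof -
  have "\<exists>j. bij_betw j ((UNIV :: ('e + nat) set) \<times> out_arcs E u) (UNIV :: ('e + nat) set)" if "out_arcs E u \<noteq> {}" for u
  proof (rule infinite_times_absorb)
    \<comment> \<open>The summand \<open>nat\<close> makes the fibre infinite even when there are
      few edges; the summand \<open>'e\<close> provides the embedding of the emitted edges.\<close>
    show "infinite (UNIV :: ('e + nat) set)" by (simp add: infinite_UNIV_nat finite_Plus_UNIV_iff)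
    show "(Inl :: 'e \<Rightarrow> 'e + nat) ` out_arcs E u \<subseteq> UNIV" by simp
    show "inj_on (Inl :: 'e \<Rightarrow> 'e + nat) (out_arcs E u)" by simp
  qed (use that in auto)
  then obtain j where j: "\<And>u. out_arcs E u \<noteq> {} \<Longrightarrow>
      bij_betw (j u) ((UNIV :: ('e + nat) set) \<times> out_arcs E u) (UNIV :: ('e + nat) set)"
    by metis
  \<comment> \<open>\<open>J f\<close> embeds the copy over r(f) into the copy over s(f). By
    bijectivity of \<open>j\<close>, the images belonging to the edges of one source partition the
    copy over it.\<close>
  define J where "J = (\<lambda>f y. j (tail E f) (y, f))"
  show ?thesis
  proof (rule that[of J])
    fix f g y z assume fg: "f \<in> arcs E" "g \<in> arcs E" "tail E f = tail E g"
    then have "f \<in> out_arcs E (tail E f)" by simp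
    then have "out_arcs E (tail E f) \<noteq> {}" by (metis equals0D)
    note j = j[OF this]
    then have "inj_on (j (tail E f)) (UNIV \<times> out_arcs E (tail E f))"
      using j by (auto simp: bij_betw_def)
    then show "J f y = J g z \<longleftrightarrow> f = g \<and> y = z"
      using fg unfolding J_def inj_on_def by (metis SigmaI UNIV_I in_out_arcs_conv prod.inject)
  next
    fix f y assume f: "f \<in> arcs E"
    then have "f \<in> out_arcs E (tail E f)" by simp
    then have "out_arcs E (tail E f) \<noteq> {}" by (metis equals0D)
    note j = j[OF this]
    then have "y \<in> j (tail E f) ` (UNIV \<times> out_arcs E (tail E f))"
      using j by (auto simp: bij_betw_def)
    then show "\<exists>g z. g \<in> arcs E \<and> tail E g = tail E f \<and> y = J g z"
      unfolding J_def by (elim imageE SigmaE) (metis in_out_arcs_conv)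
  qed
qed

text \<open>In the representation an edge raises the degree by one, so a path of length l carries a
  function supported in degree 0 to one supported in degree l. Reading the result in degree 0 over u
  therefore sees only the term r u, on which u acts as a projection.\<close>

lemma constant_term_nonzero:
  assumes u: "u \<in> verts E" and r: "r \<noteq> 0"
    and ts: "\<And>c p. (c, p) \<in> set ts \<Longrightarrow> p \<noteq> [] \<and> awalk u p u"
  shows "r \<^bold>. vt u \<^bold>+ lsum L (\<lambda>(c, p). c \<^bold>. pel u p) ts \<noteq> \<^bold>0"
proof
  assume zero: "r \<^bold>. vt u \<^bold>+ lsum L (\<lambda>(c, p). c \<^bold>. pel u p) ts = \<^bold>0"
  obtain J :: "'e \<Rightarrow> ('e + nat) \<Rightarrow> ('e + nat)" where
    J: "\<And>f g y z. \<lbrakk>f \<in> arcs E; g \<in> arcs E; tail E f = tail E g\<rbrakk>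
       \<Longrightarrow> J f y = J g z \<longleftrightarrow> f = g \<and> y = z"
    and J_surj: "\<And>f y. f \<in> arcs E \<Longrightarrow> \<exists>g z. g \<in> arcs E \<and> tail E g = tail E f \<and> y = J g z"
    by (rule graded_shift_system) blast
  define B :: "('k, ('v \<times> ('e + nat) \<times> int \<Rightarrow> 'k) \<Rightarrow> 'v \<times> ('e + nat) \<times> int \<Rightarrow> 'k) nu_algebra"
    where "B = endo_algebra"
  interpret B: nu_algebra B unfolding B_def by (rule nu_algebra_endo_algebra)
  \<comment> \<open>A left inverse of \<open>J f\<close>. Its arbitrary values off the range do no
    harm, because \<open>D\<close> tests membership in the range before using them.\<close>
  define pre where "pre = (\<lambda>f y. SOME z. y = J f z)"
  have pre: "pre f (J f z) = z" if "f \<in> arcs E" for f z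
    using J[OF that that] by (auto simp: pre_def)
  define V :: "'v \<Rightarrow> ('v \<times> ('e + nat) \<times> int \<Rightarrow> 'k) \<Rightarrow> 'v \<times> ('e + nat) \<times> int \<Rightarrow> 'k" where
    "V = (\<lambda>x g (x', y, i). if x' = x then g (x', y, i) else 0)"
  define D :: "'e \<Rightarrow> ('v \<times> ('e + nat) \<times> int \<Rightarrow> 'k) \<Rightarrow> 'v \<times> ('e + nat) \<times> int \<Rightarrow> 'k" where
    "D = (\<lambda>f g (x, y, i). if x = tail E f \<and> y \<in> range (J f) then g (head E f, pre f y, i - 1) else 0)"
  define H :: "'e \<Rightarrow> ('v \<times> ('e + nat) \<times> int \<Rightarrow> 'k) \<Rightarrow> 'v \<times> ('e + nat) \<times> int \<Rightarrow> 'k" where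
    "H = (\<lambda>f g (x, y, i). if x = head E f then g (tail E f, J f y, i + 1) else 0)"
  define G where "G = case_lpa_gen V D H"
  have GV: "G (Vert x) = V x" for x by (simp add: G_def)
  have G: "G x \<in> carrier B" if "x \<in> lpa_gens E" for x
    by (cases x) (auto simp: G_def B_def endo_algebra_def V_def D_def H_def fun_eq_iff)
  have Bops: "aadd B S T = (\<lambda>g x. S g x + T g x)" "amult B S T = (\<lambda>g. S (T g))"
    "ascale B s T = (\<lambda>g x. s * T g x)" "azero B = (\<lambda>g x. 0)" for S T s
    by (simp_all add: B_def endo_algebra_def)
  have sum: "aeval B G (foldr Add (map (\<lambda>e. Mult (Gen (Edge e)) (Gen (Ghost e))) es) Zero) g (x, y, i)
      = (\<Sum>f\<leftarrow>es. D f (H f g) (x, y, i))" for es g x y i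
    by (induction es) (auto simp: Bops G_def)
  have rel: "aeval B G s = aeval B G t" if "(s, t) \<in> lpa_rels E" for s t
    using that
  proof cases
    case (ck2 x es)
    obtain f0 where f0: "f0 \<in> arcs E" "tail E f0 = x"
      using ck2(3) unfolding regular_vertex_def by fastforce
    have "V x g (x', y, i) = (\<Sum>f\<leftarrow>es. D f (H f g) (x', y, i))" for g x' y i
    proof (cases "x' = x")
      case True
      \<comment> \<open>CK2 comes down to the partition: y lies in the image of exactly one emitted
        edge f, so only the summand f f* contributes at this point.\<close>
      obtain f z where f: "f \<in> arcs E" "tail E f = x" "y = J f z"
        using J_surj[OF f0(1), of y] f0(2) by auto
      have f_es: "f \<in> set es" using f ck2(4) by simp
      have "(\<Sum>f\<leftarrow>es. D f (H f g) (x', y, i)) = (\<Sum>f\<in>set es. D f (H f g) (x', y, i))"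
        using ck2 by (simp add: sum_list_distinct_conv_sum_set)
      also have "\<dots> = (\<Sum>h\<in>{f}. D h (H h g) (x', y, i))"
      proof (rule sum.mono_neutral_right)
        show "\<forall>h\<in>set es - {f}. D h (H h g) (x', y, i) = 0"
        proof
          fix h assume "h \<in> set es - {f}"
          then have "h \<in> arcs E" "tail E h = tail E f" "h \<noteq> f" using ck2 f by auto
          then have "J h z' \<noteq> y" for z' using J[of h f z' z] f by simp
          then have "y \<notin> range (J h)" by blast
          then show "D h (H h g) (x', y, i) = 0" by (simp add: D_def)
        qed
      qed (use f_es in simp_all)
      also have "\<dots> = V x g (x', y, i)"
        using True f by (auto simp: D_def H_def V_def pre)
      finally show ?thesis ..
    next
      case False
      have "(\<Sum>f\<leftarrow>es. D f (H f g) (x', y, i)) = (\<Sum>f\<leftarrow>es. 0)"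
        using ck2 False by (intro arg_cong[where f = sum_list] map_cong) (auto simp: D_def)
      then show ?thesis using False by (simp add: V_def)
    qed
    then show ?thesis
      unfolding ck2(1,2) by (intro ext) (auto simp: sum GV)
  qed (auto simp: Bops G_def V_def D_def H_def fun_eq_iff pre J)
  obtain \<rho> where \<rho>: "\<rho> \<in> alg_hom L B"
    and \<rho>_gen: "\<And>x. x \<in> lpa_gens E \<Longrightarrow> \<rho> (cls (lpa_gens E) (lpa_rels E) (Gen x)) = G x"
    using B.presented_algebra_hom_exists[of "lpa_gens E" G "lpa_rels E", OF G rel]
    unfolding L_def leavitt_path_algebra_def by blast
  note nu = nu_algebra_axioms B.nu_algebra_axioms
  define g :: "'v \<times> ('e + nat) \<times> int \<Rightarrow> 'k" where "g = (\<lambda>(x, y, i). if i = 0 then 1 else 0)"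
  have g: "g (x, y, i) = (if i = 0 then 1 else 0)" for x y i by (simp add: g_def)
  have degree: "\<rho> (pel x p) g (x', y, i) = 0" if "awalk x p z" "i \<noteq> int (length p)" for x p z x' y i
    using that
  proof (induction p arbitrary: x x' y i)
    case Nil
    then show ?case using \<rho>_gen[of "Vert x"] by (auto simp: awalk_simps lpa_vert_def G_def V_def g)
  next
    case (Cons f p)
    then have f: "f \<in> arcs E" "awalk (head E f) p z" by (auto simp: awalk_simps)
    then have "\<rho> (ed f) = D f" using \<rho>_gen[of "Edge f"] by (simp add: lpa_edge_def G_def)
    then have "\<rho> (pel x (f # p)) g = D f (\<rho> (pel (head E f) p) g)"
      using f by (simp add: hom_mult[OF \<rho>] Bops)
    then show ?case using Cons.IH[OF f(2)] Cons.prems(2) by (auto simp: D_def)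
  qed
  have \<rho>_vt: "\<rho> (vt u) = V u" using u \<rho>_gen[of "Vert u"] by (simp add: lpa_vert_def GV)
  \<comment> \<open>Any point over u in degree 0 serves; \<open>Inr 0\<close> is one that exists
    whatever the edge type.\<close>
  let ?pt = "(u, Inr 0, 0) :: 'v \<times> ('e + nat) \<times> int"
  have pos: "\<rho> (lsum L (\<lambda>(c, p). c \<^bold>. pel u p) ts) g ?pt = 0"
    using ts
  proof (induction ts)
    case Nil
    then show ?case by (simp add: hom_zero[OF \<rho> nu] Bops)
  next
    case (Cons t ts)
    obtain c p where t: "t = (c, p)" by (cases t)
    have p: "p \<noteq> []" "awalk u p u" using Cons.prems[of c p] t by auto
    have cl: "lsum L (\<lambda>(c, p). c \<^bold>. pel u p) ts \<in> carrier L"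
      using Cons.prems by (fastforce intro!: lsum_closed)
    have IH: "\<rho> (lsum L (\<lambda>(c, p). c \<^bold>. pel u p) ts) g ?pt = 0"
      by (rule Cons.IH) (meson Cons.prems list.set_intros(2))
    show ?case
      using IH p cl degree[OF p(2), of 0] unfolding t
      by (simp add: hom_add[OF \<rho>] hom_scale[OF \<rho>] Bops)
  qed
  have cl: "lsum L (\<lambda>(c, p). c \<^bold>. pel u p) ts \<in> carrier L"
    using ts by (fastforce intro!: lsum_closed)
  have "\<rho> (r \<^bold>. vt u \<^bold>+ lsum L (\<lambda>(c, p). c \<^bold>. pel u p) ts) g ?pt = r"
    using u cl pos \<rho>_vt by (simp add: hom_add[OF \<rho>] hom_scale[OF \<rho>] Bops V_def g)
  then show False using r by (simp add: zero hom_zero[OF \<rho> nu] Bops)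
qed

end


section \<open>Surjective endomorphisms on commutative corners\<close>

context nu_algebra
begin

text \<open>Without an identity the power with exponent 0 has no value, so a power is represented by
  its action on an element x.\<close>

definition lpow :: "'a \<Rightarrow> nat \<Rightarrow> 'a \<Rightarrow> 'a" where
  "lpow c n = (\<lambda>x. c \<^bold>* x) ^^ n"

lemma lpow_0 [simp]: "lpow c 0 x = x"
  and lpow_Suc [simp]: "lpow c (Suc n) x = c \<^bold>* lpow c n x"
  by (simp_all add: lpow_def)

lemma lpow_add_exp: "lpow c (m + n) x = lpow c m (lpow c n x)"
  by (simp add: lpow_def funpow_add)

context
  fixes c assumes c: "c \<in> carrier A"
begin

lemma lpow_closed [simp, intro]: "x \<in> carrier A \<Longrightarrow> lpow c n x \<in> carrier A"
  using c by (induction n) auto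

lemma lpow_add: "\<lbrakk>x \<in> carrier A; y \<in> carrier A\<rbrakk> \<Longrightarrow> lpow c n (x \<^bold>+ y) = lpow c n x \<^bold>+ lpow c n y"
  using c by (induction n) (auto simp: distrib_left)

lemma lpow_scale: "x \<in> carrier A \<Longrightarrow> lpow c n (r \<^bold>. x) = r \<^bold>. lpow c n x"
  using c by (induction n) (auto simp: scale_mult_right)

lemma lpow_mult: "\<lbrakk>x \<in> carrier A; y \<in> carrier A\<rbrakk> \<Longrightarrow> lpow c n x \<^bold>* y = lpow c n (x \<^bold>* y)"
  using c by (induction n) (auto simp: mult_assoc)

lemma lpow_zero [simp]: "lpow c n \<^bold>0 = \<^bold>0"
  using c by (induction n) auto

end

text \<open>Each multiplication by c' strips one factor c. All intermediate powers stay in e A,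
  where the product c' c = e acts as the identity.\<close>

lemma lpow_left_inverse:
  assumes "c \<in> carrier A" "c' \<in> carrier A" "x \<in> carrier A" "c' \<^bold>* c = e"
    and "e \<^bold>* c = c" "e \<^bold>* x = x" "lpow c n x = \<^bold>0"
  shows "x = \<^bold>0"
  using assms(7)
proof (induction n)
  case (Suc n)
  have e: "e \<^bold>* lpow c n x = lpow c n x"
    using assms by (cases n) (auto simp: mult_assoc[symmetric])
  have "c' \<^bold>* (c \<^bold>* lpow c n x) = \<^bold>0" using Suc.prems assms(2) by simp
  then have "lpow c n x = \<^bold>0"
    using e assms by (simp add: mult_assoc[symmetric])
  then show ?case by (rule Suc.IH)
qed simp

text \<open>Horner's scheme for the value of p at y, with the idempotent e in place of 1: the
  constant term becomes a multiple of e.\<close>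

definition peval :: "'a \<Rightarrow> 'a \<Rightarrow> 'k poly \<Rightarrow> 'a" where
  "peval e y p = fold_coeffs (\<lambda>r x. r \<^bold>. e \<^bold>+ y \<^bold>* x) p \<^bold>0"

lemma peval_0 [simp]: "peval e y 0 = \<^bold>0"
  by (simp add: peval_def)

context
  fixes e y
  assumes e: "e \<in> carrier A" "e \<^bold>* e = e" and y: "y \<in> carrier A" "e \<^bold>* y = y" "y \<^bold>* e = y"
begin

lemma peval_pCons: "peval e y (pCons r p) = r \<^bold>. e \<^bold>+ y \<^bold>* peval e y p"
  using e y by (cases "r = 0 \<and> p = 0") (auto simp: peval_def)

lemma peval_closed [simp, intro]: "peval e y p \<in> carrier A"
  using e y by (induction p) (auto simp: peval_pCons)

lemma peval_add: "peval e y (p + q) = peval e y p \<^bold>+ peval e y q"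
proof (induction p q rule: poly_induct2)
  case (pCons a p b q)
  then show ?case
    using e(1) y(1) by (simp add: peval_pCons scale_add_left distrib_left add_assoc add_left_comm)
qed simp

lemma peval_smult: "peval e y (smult r p) = r \<^bold>. peval e y p"
  using e y by (induction p) (auto simp: peval_pCons scale_add_right scale_scale scale_mult_right)

lemma peval_corner: "e \<^bold>* peval e y p = peval e y p"
  using e y by (induction p) (auto simp: peval_pCons distrib_left scale_mult_right mult_assoc[symmetric])

lemma peval_mult: "peval e y (p * q) = peval e y p \<^bold>* peval e y q"
proof (induction p)
  case (pCons a p)
  have "peval e y (pCons a p * q) = a \<^bold>. peval e y q \<^bold>+ y \<^bold>* peval e y (p * q)"
    using e y by (simp add: peval_add peval_smult peval_pCons)
  also have "\<dots> = peval e y (pCons a p) \<^bold>* peval e y q"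
    using e y pCons by (simp add: peval_pCons distrib_right scale_mult_left mult_assoc peval_corner)
  finally show ?case .
qed simp

lemma lpow_peval: "\<exists>q. lpow y n (peval e y p) = peval e y q"
proof (induction n)
  case 0 then show ?case by auto
next
  case (Suc n)
  then obtain q where q: "lpow y n (peval e y p) = peval e y q" by blast
  have "lpow y (Suc n) (peval e y p) = peval e y (pCons 0 q)"
    using e y by (simp add: q peval_pCons)
  then show ?case by blast
qed

end

end

lemma hom_peval:
  assumes "nu_algebra A" and \<phi>: "\<phi> \<in> alg_hom A A"
    and e: "e \<in> carrier A" "amult A e e = e" "\<phi> e = e"
    and y: "y \<in> carrier A" "amult A e y = y" "amult A y e = y"
  shows "\<phi> (nu_algebra.peval A e y p) = nu_algebra.peval A e (\<phi> y) p"
proof -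
  interpret nu_algebra A by fact
  have y': "\<phi> y \<in> carrier A" "e \<^bold>* \<phi> y = \<phi> y" "\<phi> y \<^bold>* e = \<phi> y"
    using hom_closed[OF \<phi> y(1)] hom_mult[OF \<phi> e(1) y(1)] hom_mult[OF \<phi> y(1) e(1)] y e(3) by simp_all
  show ?thesis
  proof (induction p)
    case 0
    then show ?case by (simp add: hom_zero[OF \<phi> assms(1) assms(1)])
  next
    case (pCons a p)
    then show ?case
      using e y by (simp add: peval_pCons[OF e(1,2) y] peval_pCons[OF e(1,2) y'] hom_add[OF \<phi>]
          hom_mult[OF \<phi>] hom_scale[OF \<phi>] peval_closed[OF e(1,2) y])
  qed
qed

lemma hom_lpow:
  assumes "nu_algebra A" and \<phi>: "\<phi> \<in> alg_hom A A" and "c \<in> carrier A" "x \<in> carrier A"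
  shows "\<phi> (nu_algebra.lpow A c n x) = nu_algebra.lpow A (\<phi> c) n (\<phi> x)"
proof -
  interpret nu_algebra A by fact
  show ?thesis
    using assms(3,4) by (induction n) (auto simp: hom_mult[OF \<phi>])
qed

text \<open>With \<open>c\<close> invertible in the corner \<open>e A e\<close>, the hypothesis \<open>laurent\<close> makes the corner a quotient
  of the ring of Laurent polynomials in \<open>c\<close>, hence Noetherian. The annihilating polynomials of
  \<open>c, \<phi> c, \<phi>\<^sup>2 c, \<dots>\<close> form an ascending chain of ideals of \<open>K[x]\<close>, and once the chain is
  stationary, surjectivity of \<open>\<phi>\<close> forces its kernel on the corner to vanish.\<close>

lemma hom_injective_on_laurent_corner:
  assumes "nu_algebra A" and \<phi>: "\<phi> \<in> alg_hom A A" and surj: "\<phi> ` carrier A = carrier A"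
    and e: "e \<in> carrier A" "amult A e e = e" "\<phi> e = e"
    and c: "c \<in> carrier A" "amult A e c = c" "amult A c e = c"
    and c': "c' \<in> carrier A" "amult A c' c = e"
    and laurent: "\<And>b. b \<in> carrier A \<Longrightarrow>
      \<exists>n h. nu_algebra.lpow A c n (amult A e (amult A b e)) = nu_algebra.peval A e c h"
    and z: "z \<in> carrier A" "amult A e (amult A z e) = z" "\<phi> z = azero A"
  shows "z = azero A"
proof -
  interpret nu_algebra A by fact
  \<comment> \<open>A bare iterate is not extensional, hence not in \<open>alg_hom\<close>;
    restricting it to the carrier repairs this.\<close>
  define \<Phi> where "\<Phi> = (\<lambda>m. restrict (\<phi> ^^ m) (carrier A))"
  have \<phi>_closed: "(\<phi> ^^ m) a \<in> carrier A" if "a \<in> carrier A" for m a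
    using that hom_closed[OF \<phi>] by (induction m) auto
  have \<Phi>_app: "\<Phi> m a = (\<phi> ^^ m) a" if "a \<in> carrier A" for m a
    using that by (simp add: \<Phi>_def)
  have \<Phi>: "\<Phi> m \<in> alg_hom A A" for m
  proof (induction m)
    case 0
    have "\<Phi> 0 = restrict (\<lambda>a. a) (carrier A)" by (auto simp: \<Phi>_def)
    then show ?case using hom_id[OF assms(1)] by (simp only:)
  next
    case (Suc m)
    have "\<Phi> (Suc m) = restrict (\<lambda>a. \<phi> (\<Phi> m a)) (carrier A)"
      by (auto simp: \<Phi>_def fun_eq_iff)
    then show ?case using hom_comp[OF assms(1) Suc \<phi>] by (simp only:)
  qed
  have \<Phi>_Suc: "\<phi> (\<Phi> m a) = \<Phi> (Suc m) a" if "a \<in> carrier A" for m a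
    using that by (simp add: \<Phi>_def)
  have \<Phi>_e: "\<Phi> m e = e" for m
    using e by (induction m) (auto simp: \<Phi>_def)
  have \<Phi>_surj: "\<exists>b \<in> carrier A. \<Phi> m b = a" if "a \<in> carrier A" for m a
    using that
  proof (induction m arbitrary: a)
    case 0
    then show ?case by (auto simp: \<Phi>_def)
  next
    case (Suc m)
    then obtain a' where a': "a' \<in> carrier A" "\<phi> a' = a" using surj by (metis imageE)
    then obtain b where "b \<in> carrier A" "\<Phi> m b = a'" using Suc.IH by blast
    then show ?case using a' \<Phi>_Suc[of b m] by auto
  qed
  define y where "y m = \<Phi> m c" for m
  have y: "y m \<in> carrier A" "e \<^bold>* y m = y m" "y m \<^bold>* e = y m" for m
    using hom_closed[OF \<Phi> c(1)] hom_mult[OF \<Phi> e(1) c(1), of m] hom_mult[OF \<Phi> c(1) e(1), of m]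
      c \<Phi>_e by (auto simp: y_def)
  note pe = e(1,2) y
  have \<Phi>_peval: "\<Phi> m (peval e c h) = peval e (y m) h" for m h
    using hom_peval[OF assms(1) \<Phi> e(1,2) \<Phi>_e c] by (simp add: y_def)
  have step: "peval e (y (Suc m)) h = \<^bold>0" if "peval e (y m) h = \<^bold>0" for m h
    using hom_peval[OF assms(1) \<phi> e y, of m h] that
    by (simp add: y_def \<Phi>_Suc c(1) hom_zero[OF \<phi> assms(1,1)])
  obtain m where m: "\<And>h. peval e (y (Suc m)) h = \<^bold>0 \<Longrightarrow> peval e (y m) h = \<^bold>0"
  proof (cases "\<exists>g m. g \<noteq> 0 \<and> peval e (y m) g = \<^bold>0")
    case True
    \<comment> \<open>The chain becomes stationary at a stage m where some nonzero g of the least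
      degree occurring at any stage annihilates. If h annihilates at stage m + 1, then so does its
      remainder modulo g, which must vanish by minimality; thus h is a multiple of g and annihilates
      at stage m already. If no nonzero polynomial occurs, every stage has the zero ideal.\<close>
    define D where "D = (\<lambda>d. \<exists>g m. g \<noteq> 0 \<and> peval e (y m) g = \<^bold>0 \<and> degree g = d)"
    have "\<exists>d. D d" using True unfolding D_def by blast
    then have "D (LEAST d. D d)" by (rule LeastI_ex)
    then obtain g m where g: "g \<noteq> 0" "peval e (y m) g = \<^bold>0" "degree g = (LEAST d. D d)"
      by (auto simp: D_def)
    have "peval e (y m) h = \<^bold>0" if h: "peval e (y (Suc m)) h = \<^bold>0" for h
    proof -
      have hg: "h = h div g * g + h mod g" by simp
      have "\<^bold>0 = peval e (y (Suc m)) (h div g) \<^bold>* peval e (y (Suc m)) g \<^bold>+ peval e (y (Suc m)) (h mod g)"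
        unfolding h[symmetric] peval_mult[OF pe, symmetric] peval_add[OF pe, symmetric] by simp
      then have "peval e (y (Suc m)) (h mod g) = \<^bold>0"
        using step[OF g(2)] peval_closed[OF pe] by simp
      then have "h mod g = 0 \<or> D (degree (h mod g))" by (auto simp: D_def)
      then have "h mod g = 0"
        using degree_mod_less[OF g(1), of h] g(3) not_less_Least[of "degree (h mod g)" D] by auto
      then have "h = h div g * g" using hg by simp
      then have "peval e (y m) h = peval e (y m) (h div g) \<^bold>* peval e (y m) g"
        using peval_mult[OF pe, of m "h div g" g] by simp
      then show ?thesis using g(2) peval_closed[OF pe] by simp
    qed
    then show ?thesis by (rule that)
  next
    case False
    show ?thesis
    proof (rule that[of 0])
      fix h assume "peval e (y (Suc 0)) h = \<^bold>0"
      then have "h = 0" using False by blast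
      then show "peval e (y 0) h = \<^bold>0" by simp
    qed
  qed
  \<comment> \<open>With y = \<open>\<phi>\<close>^m c, pull z back along \<open>\<phi>\<close>^m to
    b and write c^n e b e = h(c). Applying \<open>\<phi>\<close>^m gives y^n z = h(y), and one more
    \<open>\<phi>\<close> gives h(\<open>\<phi>\<close> y) = 0 because z is in the kernel.
    Stationarity at m yields h(y) = 0, so y^n z = 0, and y has a left inverse.\<close>
  obtain b where b: "b \<in> carrier A" "\<Phi> m b = z" using \<Phi>_surj[OF z(1)] by blast
  obtain n h where h: "lpow c n (e \<^bold>* (b \<^bold>* e)) = peval e c h" using laurent[OF b(1)] by blast
  have eb: "\<Phi> m (e \<^bold>* (b \<^bold>* e)) = z"
    using b e(1) z(2) by (simp add: hom_mult[OF \<Phi>] \<Phi>_e)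
  have m_eq: "lpow (y m) n z = peval e (y m) h"
    using hom_lpow[OF assms(1) \<Phi> c(1), of "e \<^bold>* (b \<^bold>* e)" m n] b(1) e(1) eb h
    by (simp add: \<Phi>_peval y_def[symmetric])
  have "peval e (y (Suc m)) h = \<phi> (lpow (y m) n z)"
    unfolding m_eq using hom_peval[OF assms(1) \<phi> e y, of m h] by (simp add: y_def \<Phi>_Suc c(1))
  also have "\<dots> = lpow (\<phi> (y m)) n \<^bold>0"
    using hom_lpow[OF assms(1) \<phi> y(1) z(1)] z(3) by simp
  also have "\<dots> = \<^bold>0" using hom_closed[OF \<phi> y(1)] by simp
  finally have "lpow (y m) n z = \<^bold>0" using m[of h] m_eq by simp
  moreover have "\<Phi> m c' \<^bold>* y m = e"
    using hom_mult[OF \<Phi> c'(1) c(1), of m] c'(2) \<Phi>_e by (simp add: y_def)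
  moreover have "e \<^bold>* z = z"
    using z(1,2) e(1,2) by (metis mult_assoc mult_closed)
  ultimately show ?thesis
    using lpow_left_inverse[OF y(1) hom_closed[OF \<Phi> c'(1)] z(1)] y(2) by blast
qed


section \<open>Closed paths without exits\<close>

lemma length_concat_replicate: "length (concat (replicate n xs)) = n * length xs"
  by (induction n) auto

text \<open>Prepending \<open>\<gamma>\<close> to a walk from u merely extends it, so every walk
  from u is an initial piece of \<open>\<gamma>\<close> repeated. This form of having no exit is
  exactly what remains when no conjugation can remove a term.\<close>

locale no_exit = leavitt E L
  for E :: "('v, 'e) pre_digraph" and L :: "('k :: field, ('k, 'v, 'e) lpa) nu_algebra" +
  fixes u :: 'v and \<gamma> :: "'e list"
  assumes \<gamma>: "awalk u \<gamma> u" "\<gamma> \<noteq> []"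
    and no_exit: "\<And>p x. awalk u p x \<Longrightarrow> prefix p (\<gamma> @ p)"
begin

section \<open>All walks from u run around one cycle\<close>

lemma u_vert [simp]: "u \<in> verts E"
  using \<gamma>(1) by auto

lemma awalk_pow: "awalk u (concat (replicate n \<gamma>)) u"
  using \<gamma>(1) by (induction n) (auto simp: awalk_simps)

lemma prefix_pow:
  assumes "awalk u p x" "length p \<le> n"
  shows "prefix p (concat (replicate n \<gamma>))"
proof -
  have "prefix p (concat (replicate n \<gamma>) @ p)"
  proof (induction n)
    case (Suc n)
    then have "prefix (\<gamma> @ p) (\<gamma> @ concat (replicate n \<gamma>) @ p)" by simp
    then show ?case using no_exit[OF assms(1)] prefix_order.trans by fastforce
  qed simp
  moreover have "n * 1 \<le> n * length \<gamma>"
    using \<gamma>(2) by (intro mult_le_mono) (auto simp: Suc_le_eq)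
  then have "length p \<le> length (concat (replicate n \<gamma>))"
    using assms(2) unfolding length_concat_replicate by linarith
  ultimately show ?thesis
    by (metis prefix_length_prefix prefixI)
qed

lemma prefix_of_longer:
  assumes "awalk u p x" "awalk u q y" "length p \<le> length q"
  shows "prefix p q"
  using prefix_length_prefix[OF prefix_pow[OF assms(1), of "length q"] prefix_pow[OF assms(2), of "length q"]]
    assms(3) by simp

lemma extend_to_closed:
  assumes "awalk u p x"
  obtains q where "awalk x q u" "q \<noteq> []"
proof -
  \<comment> \<open>The extra copy of \<open>\<gamma>\<close> guarantees that the way back q is
    nonempty.\<close>
  obtain q where q: "concat (replicate (Suc (length p)) \<gamma>) = p @ q"
    using prefix_pow[OF assms, of "Suc (length p)"] by (auto simp del: replicate_Suc elim: prefixE)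
  have "length p < length (p @ q)"
    using \<gamma>(2) unfolding q[symmetric] length_concat_replicate
    by (cases \<gamma>) auto
  then have "q \<noteq> []" by auto
  moreover have "awalk x q u"
    using awalk_pow[of "Suc (length p)"] assms awalk_ends unfolding q
    by (metis awalk_append_iff awalk_ends_eqD)
  ultimately show ?thesis by (rule that[rotated])
qed

text \<open>An edge exists because the walk can be continued back to u. Two different ones would
  extend p to two walks of equal length, contrary to the prefix ordering of walks from u.\<close>

lemma out_arcs_singleton:
  assumes "awalk u p x"
  obtains f where "out_arcs E x = {f}"
proof -
  obtain q where q: "awalk x q u" "q \<noteq> []" using extend_to_closed[OF assms] .
  then have hd: "hd q \<in> out_arcs E x" by (cases q) (auto simp: awalk_simps)
  moreover have "f = g" if "f \<in> out_arcs E x" "g \<in> out_arcs E x" for f g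
  proof -
    have "awalk u (p @ [f]) (head E f)" "awalk u (p @ [g]) (head E g)"
      using assms that by (auto simp: awalk_simps)
    then have "prefix (p @ [f]) (p @ [g])" by (rule prefix_of_longer) simp
    then show ?thesis by simp
  qed
  ultimately show ?thesis using that by blast
qed

text \<open>Every vertex met by q emits a single edge, so CK2 there has one summand and q q*
  collapses from the inside. The walk p records that x can be reached from u.\<close>

lemma pel_gel:
  assumes "awalk u p x" "awalk x q y"
  shows "pel x q \<^bold>* gel x q = vt x"
  using assms
proof (induction q arbitrary: p x)
  case Nil
  then show ?case by (auto simp: awalk_simps vt_vt)
next
  case (Cons f q)
  then have f: "f \<in> arcs E" "tail E f = x" "awalk (head E f) q y" by (auto simp: awalk_simps)
  obtain g where g: "out_arcs E x = {g}" using out_arcs_singleton[OF Cons.prems(1)] .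
  have "f \<in> out_arcs E x" using f by simp
  then have out: "out_arcs E x = {f}" using g by simp
  have "x \<in> verts E" using f by auto
  then have vx: "vt x = ed f \<^bold>* gh f"
    using ck2[of x] f(1) asum_insert[of "{}" f "\<lambda>f. ed f \<^bold>* gh f"]
    by (simp add: regular_vertex_def out)
  have "awalk u (p @ [f]) (head E f)" using Cons.prems(1) f by (auto simp: awalk_simps)
  from Cons.IH[OF this f(3)]
  have "pel x (f # q) \<^bold>* gel x (f # q) = ed f \<^bold>* (vt (head E f) \<^bold>* gh f)"
    using f by (simp add: mult_assoc) (simp add: mult_assoc[symmetric])
  then show ?case using f(1) vx by (simp add: vt_gh)
qed

text \<open>\<open>\<gamma>\<close> may run around the cycle several times; the shortest closed walk
  is needed to generate all the others.\<close>

definition cyc :: "'e list" where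
  "cyc = (ARG_MIN length p. p \<noteq> [] \<and> awalk u p u)"

lemma cyc: "cyc \<noteq> []" "awalk u cyc u"
  and cyc_minimal: "\<lbrakk>p \<noteq> []; awalk u p u\<rbrakk> \<Longrightarrow> length cyc \<le> length p"
proof -
  have ex: "\<gamma> \<noteq> [] \<and> awalk u \<gamma> u" using \<gamma> by simp
  show "cyc \<noteq> []" "awalk u cyc u"
    using arg_min_natI[of "\<lambda>p. p \<noteq> [] \<and> awalk u p u" \<gamma> length, OF ex] by (auto simp: cyc_def)
  show "\<lbrakk>p \<noteq> []; awalk u p u\<rbrakk> \<Longrightarrow> length cyc \<le> length p"
    unfolding cyc_def by (rule arg_min_nat_le) simp
qed

text \<open>A nonempty closed walk is at least as long as \<open>cyc\<close>, hence begins with it;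
  what is left is again closed and shorter.\<close>

lemma pel_closed_walk:
  assumes "awalk u p u"
  shows "\<exists>n. pel u p = lpow (pel u cyc) n (vt u)"
  using assms
proof (induction "length p" arbitrary: p rule: less_induct)
  case less
  show ?case
  proof (cases "p = []")
    case True
    then have "pel u p = lpow (pel u cyc) 0 (vt u)" by simp
    then show ?thesis by blast
  next
    case False
    have "prefix cyc p"
      using prefix_of_longer[OF cyc(2) less.prems cyc_minimal[OF False less.prems]] .
    then obtain q where q: "p = cyc @ q" by (elim prefixE)
    then have "awalk u q u" using less.prems cyc(2) by (metis awalk_append_iff awalk_ends_eqD)
    moreover have "length q < length p" using q cyc(1) by simp
    ultimately obtain n where "pel u q = lpow (pel u cyc) n (vt u)" using less.hyps by blast
    then have "pel u p = lpow (pel u cyc) (Suc n) (vt u)"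
      using pel_append[OF cyc(2) \<open>awalk u q u\<close>] q by simp
    then show ?thesis by blast
  qed
qed

text \<open>Let C be the shortest cycle and p q* a monomial in u L u. With s a way back to u, p q* =
  (p s)(q s)* because s s* is a vertex. Here p s = C^i and q s = C^j, and powers of C commute, so
  multiplying by C^j leaves C^i.\<close>

lemma corner_laurent:
  assumes "b \<in> carrier L"
  shows "\<exists>n h. lpow (pel u cyc) n (vt u \<^bold>* (b \<^bold>* vt u)) = peval (vt u) (pel u cyc) h"
proof -
  let ?C = "pel u cyc"
  have C: "?C \<in> carrier L" "vt u \<^bold>* ?C = ?C" "?C \<^bold>* vt u = ?C"
    using cyc(2) by (auto simp: vt_pel pel_vt)
  have vu: "vt u \<in> carrier L" "vt u \<^bold>* vt u = vt u" by (auto simp: vt_vt)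
  note pe = vu C
  have pow: "\<exists>h. lpow ?C n (vt u) = peval (vt u) ?C h" for n
  proof -
    have "vt u = peval (vt u) ?C [:1:]"
      using pe by (simp add: peval_pCons[OF pe] scale_one)
    then show ?thesis using lpow_peval[OF pe, of n "[:1:]"] by simp
  qed
  have mono: "\<exists>n h. lpow ?C n (vt u \<^bold>* (mono_val t \<^bold>* vt u)) = peval (vt u) ?C h" if "t \<in> monomials" for t
  proof -
    obtain r v p x q where t1: "t = (r, v, p, x, q)" by (cases t)
    with that obtain y where t: "t = (r, v, p, x, q)" "awalk v p y" "awalk x q y"
      by (auto simp: monomials_def)
    have eq: "vt u \<^bold>* (mono_val t \<^bold>* vt u) = r \<^bold>. ((vt u \<^bold>* pel v p) \<^bold>* (gel x q \<^bold>* vt u))"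
      using t by (simp add: mono_val.simps scale_mult_left scale_mult_right mult_assoc)
    show ?thesis
    proof (cases "v = u \<and> x = u")
      case False
      then have "vt u \<^bold>* (mono_val t \<^bold>* vt u) = \<^bold>0"
        unfolding eq using t by (auto simp: vt_pel gel_vt)
      then have "lpow ?C 0 (vt u \<^bold>* (mono_val t \<^bold>* vt u)) = peval (vt u) ?C 0" by simp
      then show ?thesis by blast
    next
      case True
      then have pq: "awalk u p y" "awalk u q y" using t by auto
      obtain s where s: "awalk y s u" using extend_to_closed[OF pq(1)] .
      have ps: "awalk u (p @ s) u" "awalk u (q @ s) u" using pq s by (auto intro: awalk_appendI)
      obtain i where i: "pel u (p @ s) = lpow ?C i (vt u)" using pel_closed_walk[OF ps(1)] by blast
      obtain j where j: "pel u (q @ s) = lpow ?C j (vt u)" using pel_closed_walk[OF ps(2)] by blast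
      have "pel u p \<^bold>* gel u q = pel u p \<^bold>* (pel y s \<^bold>* gel y s) \<^bold>* gel u q"
        using pq s by (simp add: pel_gel[OF pq(1) s] pel_vt awalk_last_in_verts)
      also have "\<dots> = pel u (p @ s) \<^bold>* gel u (q @ s)"
        using pq s by (simp add: pel_append gel_append mult_assoc)
      also have "\<dots> = lpow ?C i (gel u (q @ s))"
        unfolding i using lpow_mult[OF C(1) vu(1) gel_closed[OF ps(2)]] vt_gel[OF ps(2) u_vert] by simp
      finally have "lpow ?C j (pel u p \<^bold>* gel u q) = lpow ?C (j + i) (gel u (q @ s))"
        by (simp add: lpow_add_exp)
      also have "\<dots> = lpow ?C i (lpow ?C j (vt u \<^bold>* gel u (q @ s)))"
        using vt_gel[OF ps(2) u_vert] by (simp add: lpow_add_exp[symmetric] add.commute)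
      also have "\<dots> = lpow ?C i (pel u (q @ s) \<^bold>* gel u (q @ s))"
        unfolding j using lpow_mult[OF C(1) vu(1) gel_closed[OF ps(2)]] by simp
      also have "\<dots> = lpow ?C i (vt u)"
        using pel_gel[of "[]" u "q @ s" u] ps(2) by (simp add: awalk_simps)
      finally obtain h where "lpow ?C j (pel u p \<^bold>* gel u q) = peval (vt u) ?C h" using pow by metis
      then have "lpow ?C j (vt u \<^bold>* (mono_val t \<^bold>* vt u)) = peval (vt u) ?C (smult r h)"
        unfolding eq using True pq C
        by (simp add: vt_pel gel_vt lpow_scale peval_smult[OF pe])
      then show ?thesis by blast
    qed
  qed
  obtain ts where ts: "set ts \<subseteq> monomials" "b = lsum L mono_val ts" using mono_span[OF assms] .
  have "\<exists>n h. lpow ?C n (vt u \<^bold>* (lsum L mono_val ts \<^bold>* vt u)) = peval (vt u) ?C h"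
    using ts(1)
  proof (induction ts)
    case Nil
    have "lpow ?C 0 (vt u \<^bold>* (lsum L mono_val [] \<^bold>* vt u)) = peval (vt u) ?C 0" using vu by simp
    then show ?case by blast
  next
    case (Cons t ts)
    let ?c = "\<lambda>b. vt u \<^bold>* (b \<^bold>* vt u)"
    have t: "t \<in> monomials" "set ts \<subseteq> monomials" using Cons.prems by auto
    obtain n h where h: "lpow ?C n (?c (mono_val t)) = peval (vt u) ?C h" using mono t by blast
    obtain n' h' where h': "lpow ?C n' (?c (lsum L mono_val ts)) = peval (vt u) ?C h'"
      using Cons.IH t by blast
    have "?c (lsum L mono_val (t # ts)) = ?c (mono_val t) \<^bold>+ ?c (lsum L mono_val ts)"
      using t vu by (simp add: distrib_left distrib_right)
    \<comment> \<open>The two summands need different exponents; the sum of these clears both, and a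
      surplus power of C only multiplies a polynomial in C by a power of the variable.\<close>
    then have "lpow ?C (n + n') (?c (lsum L mono_val (t # ts)))
        = lpow ?C (n' + n) (?c (mono_val t)) \<^bold>+ lpow ?C (n + n') (?c (lsum L mono_val ts))"
      using t vu C by (simp add: lpow_add add.commute)
    also have "\<dots> = lpow ?C n' (peval (vt u) ?C h) \<^bold>+ lpow ?C n (peval (vt u) ?C h')"
      by (simp add: lpow_add_exp h h')
    finally show ?case using lpow_peval[OF pe] peval_add[OF pe] by metis
  qed
  then show ?thesis using ts(2) by simp
qed

lemma hom_injective_on_corner:
  assumes \<phi>: "\<phi> \<in> alg_hom L L" and "\<phi> ` carrier L = carrier L" and "\<phi> (vt u) = vt u"
    and "z \<in> carrier L" "vt u \<^bold>* (z \<^bold>* vt u) = z" "\<phi> z = \<^bold>0"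
  shows "z = \<^bold>0"
proof (rule hom_injective_on_laurent_corner[OF nu_algebra_axioms \<phi>])
  show "gel u cyc \<^bold>* pel u cyc = vt u" by (rule gel_pel_self[OF cyc(2)])
qed (use assms cyc(2) corner_laurent in \<open>auto simp: vt_vt vt_pel pel_vt\<close>)

end


section \<open>Surjective endomorphisms fixing the vertices are injective\<close>

context leavitt
begin

definition closed_terms :: "'v \<Rightarrow> ('k \<times> 'e list) list \<Rightarrow> bool" where
  "closed_terms u ts \<longleftrightarrow> (\<forall>(c, p) \<in> set ts. p \<noteq> [] \<and> awalk u p u)"

definition path_val :: "'v \<Rightarrow> 'k \<times> 'e list \<Rightarrow> ('k, 'v, 'e) lpa" where
  "path_val u = (\<lambda>(c, p). c \<^bold>. pel u p)"

lemma path_val_closed: "\<lbrakk>closed_terms u ts; t \<in> set ts\<rbrakk> \<Longrightarrow> path_val u t \<in> carrier L"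
  by (auto simp: closed_terms_def path_val_def)

lemma lsum_path_val_closed: "closed_terms u ts \<Longrightarrow> lsum L (path_val u) ts \<in> carrier L"
  using path_val_closed by (intro lsum_closed)

text \<open>The constant term survives since q* u q = x. For a nonempty closed p, the walk p q is
  longer than q, so q* p q is either zero or, when q is a prefix of p q, a closed path at x of the
  same length as p.\<close>

lemma conjugate_closed_terms:
  assumes u: "u \<in> verts E" and ts: "closed_terms u ts" and q: "awalk u q x"
  obtains ts' where "closed_terms x ts'" "length ts' = length (filter (\<lambda>(c, p). prefix q (p @ q)) ts)"
    "gel u q \<^bold>* ((r \<^bold>. vt u \<^bold>+ lsum L (path_val u) ts) \<^bold>* pel u q)
      = r \<^bold>. vt x \<^bold>+ lsum L (path_val x) ts'"
proof -
  define good where "good = (\<lambda>(c :: 'k, p). prefix q (p @ q))"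
  define g where "g = (\<lambda>(c :: 'k, p). (c, drop (length q) (p @ q)))"
  define ts' where "ts' = map g (filter good ts)"
  have conj: "gel u q \<^bold>* (path_val u t \<^bold>* pel u q) = path_val x (g t) \<and> closed_terms x [g t]"
    if tg: "t \<in> set ts" "good t" for t
  proof -
    obtain c p where t0: "t = (c, p)" by (cases t)
    then have t: "t = (c, p)" "p \<noteq> []" "awalk u p u"
      using tg ts by (auto simp: closed_terms_def)
    have "prefix q (p @ q)" using tg(2) by (simp add: t0 good_def)
    then obtain p' where p': "p @ q = q @ p'" by (rule prefixE)
    have "awalk u (p @ q) x" using t q by (auto intro: awalk_appendI)
    then have w: "awalk x p' x" unfolding p' by (rule awalk_append_cancel[OF q])
    have "length p' = length p" using arg_cong[OF p', of length] by simp
    then have ne: "p' \<noteq> []" using t by auto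
    have gt: "g t = (c, p')" unfolding g_def t prod.case p' by simp
    have "gel u q \<^bold>* (path_val u t \<^bold>* pel u q) = c \<^bold>. (gel u q \<^bold>* pel u (p @ q))"
      using t q by (simp add: path_val_def scale_mult_left scale_mult_right pel_append[of u p u])
    also have "\<dots> = c \<^bold>. pel x p'" unfolding p' gel_pel_append(1)[OF q w] ..
    finally show ?thesis using ne w by (simp add: gt path_val_def closed_terms_def)
  qed
  have bad: "gel u q \<^bold>* (path_val u t \<^bold>* pel u q) = \<^bold>0" if "t \<in> set ts" "\<not> good t" for t
  proof -
    obtain c p where t0: "t = (c, p)" by (cases t)
    then have t: "t = (c, p)" "p \<noteq> []" "awalk u p u"
      using that ts by (auto simp: closed_terms_def)
    have w: "awalk u (p @ q) x" using t q by (auto intro: awalk_appendI)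
    have "\<not> prefix (p @ q) q" using t(2) by (auto dest: prefix_length_le)
    moreover have "\<not> prefix q (p @ q)" using that t by (simp add: good_def)
    ultimately have "gel u q \<^bold>* pel u (p @ q) = \<^bold>0" using gel_pel_parallel[OF q w] by blast
    then show ?thesis
      using t q by (simp add: path_val_def scale_mult_left scale_mult_right pel_append[of u p u])
  qed
  have cl: "path_val u t \<in> carrier L" if "t \<in> set ts" for t using path_val_closed[OF ts that] .
  have "gel u q \<^bold>* (lsum L (path_val u) ts \<^bold>* pel u q)
      = lsum L (\<lambda>t. gel u q \<^bold>* (path_val u t \<^bold>* pel u q)) ts"
    using cl pel_closed[OF q] gel_closed[OF q] by (simp add: lsum_mult mult_lsum)
  also have "\<dots> = lsum L (\<lambda>t. gel u q \<^bold>* (path_val u t \<^bold>* pel u q)) (filter good ts)"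
    using cl bad pel_closed[OF q] gel_closed[OF q] by (intro lsum_filter[symmetric]) auto
  also have "\<dots> = lsum L (path_val x) ts'"
    unfolding ts'_def lsum_map using conj by (intro lsum_cong) auto
  finally have sum: "gel u q \<^bold>* (lsum L (path_val u) ts \<^bold>* pel u q) = lsum L (path_val x) ts'" .
  have "gel u q \<^bold>* ((r \<^bold>. vt u) \<^bold>* pel u q) = r \<^bold>. vt x"
    using q u by (simp add: scale_mult_left scale_mult_right vt_pel gel_pel_self)
  then have "gel u q \<^bold>* ((r \<^bold>. vt u \<^bold>+ lsum L (path_val u) ts) \<^bold>* pel u q)
      = r \<^bold>. vt x \<^bold>+ lsum L (path_val x) ts'"
    using q u lsum_path_val_closed[OF ts] sum by (simp add: distrib_left distrib_right)
  moreover have "closed_terms x ts'" using conj by (fastforce simp: closed_terms_def ts'_def)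
  ultimately show ?thesis by (intro that[of ts']) (simp_all add: ts'_def good_def)
qed

end

locale vertex_fixing_surjection = leavitt E L
  for E :: "('v, 'e) pre_digraph" and L :: "('k :: field, ('k, 'v, 'e) lpa) nu_algebra" +
  fixes \<phi>
  assumes hom: "\<phi> \<in> alg_hom L L" and surj: "\<phi> ` carrier L = carrier L"
    and fix_vt: "\<And>u. u \<in> verts E \<Longrightarrow> \<phi> (vt u) = vt u"
begin

lemmas \<phi>_hom = hom_closed[OF hom] hom_add[OF hom] hom_mult[OF hom] hom_scale[OF hom]
  hom_zero[OF hom nu_algebra_axioms nu_algebra_axioms]

lemma constant_term_not_in_kernel:
  assumes "u \<in> verts E" "r \<noteq> 0" "closed_terms u ts"
  shows "\<phi> (r \<^bold>. vt u \<^bold>+ lsum L (path_val u) ts) \<noteq> \<^bold>0"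
  using assms
proof (induction "length ts" arbitrary: u ts rule: less_induct)
  case less
  let ?z = "r \<^bold>. vt u \<^bold>+ lsum L (path_val u) ts"
  have z: "?z \<in> carrier L" using less.prems lsum_path_val_closed by auto
  have nz: "?z \<noteq> \<^bold>0"
    unfolding path_val_def using less.prems by (intro constant_term_nonzero) (auto simp: closed_terms_def)
  show ?case
  proof (cases "\<exists>(c, p) \<in> set ts. \<exists>q x. awalk u q x \<and> \<not> prefix q (p @ q)")
    \<comment> \<open>Such a walk q departs from the periodic path p p p ... , so conjugation by it
      kills the term of p but not the constant term, and the number of terms drops.\<close>
    case True
    then obtain c p q x where cp: "(c, p) \<in> set ts" "awalk u q x" "\<not> prefix q (p @ q)" by blast
    obtain ts' where ts': "closed_terms x ts'"
        "length ts' = length (filter (\<lambda>(c, p). prefix q (p @ q)) ts)"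
        "gel u q \<^bold>* (?z \<^bold>* pel u q) = r \<^bold>. vt x \<^bold>+ lsum L (path_val x) ts'"
      using conjugate_closed_terms[OF less.prems(1,3) cp(2)] by blast
    have "length ts' < length ts"
      unfolding ts'(2) using cp by (intro length_filter_less[of "(c, p)"]) auto
    moreover have "x \<in> verts E" using cp(2) by blast
    ultimately have "\<phi> (gel u q \<^bold>* (?z \<^bold>* pel u q)) \<noteq> \<^bold>0"
      unfolding ts'(3) using less.hyps less.prems(2) ts'(1) by blast
    moreover have "\<phi> (gel u q \<^bold>* (?z \<^bold>* pel u q)) = \<phi> (gel u q) \<^bold>* (\<phi> ?z \<^bold>* \<phi> (pel u q))"
      using z cp(2) by (simp only: \<phi>_hom gel_closed pel_closed mult_closed)
    ultimately show ?thesis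
      using cp(2) \<phi>_hom(1) by (metis gel_closed mult_zero_left mult_zero_right pel_closed)
  next
    case False
    show ?thesis
    proof (cases ts)
      case Nil
      have "\<phi> ?z = ?z" using less.prems by (simp add: Nil \<phi>_hom fix_vt)
      then show ?thesis using nz by simp
    next
      case (Cons t ts')
      obtain c \<gamma> where t: "t = (c, \<gamma>)" by (cases t)
      \<comment> \<open>Nothing can be removed any more, so each closed path of the combination is
        without exit and the first one may serve as \<open>\<gamma>\<close>. The whole combination
        lies in u L u.\<close>
      interpret no_exit E L u \<gamma>
        using False less.prems(3) by unfold_locales (auto simp: Cons t closed_terms_def)
      have uz: "vt u \<^bold>* (path_val u t \<^bold>* vt u) = path_val u t" if "t \<in> set ts" for t
        using that less.prems
        by (auto simp: closed_terms_def path_val_def scale_mult_left scale_mult_right vt_pel pel_vt)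
      have cl: "path_val u t \<in> carrier L" if "t \<in> set ts" for t
        using path_val_closed[OF less.prems(3) that] .
      have "vt u \<^bold>* (lsum L (path_val u) ts \<^bold>* vt u) = lsum L (path_val u) ts"
        using cl uz less.prems(1) by (simp add: lsum_mult mult_lsum cong: lsum_cong)
      then have "vt u \<^bold>* (?z \<^bold>* vt u) = ?z"
        using less.prems lsum_path_val_closed[OF less.prems(3)]
        by (simp add: distrib_left distrib_right scale_mult_left scale_mult_right vt_vt)
      then show ?thesis
        using hom_injective_on_corner[OF hom surj fix_vt[OF less.prems(1)] z] nz by blast
    qed
  qed
qed

text \<open>Unlike in \<open>path_val\<close>, the source varies from term to term; in use, only the
  range is common.\<close>

definition upath_val :: "'k \<times> 'v \<times> 'e list \<Rightarrow> ('k, 'v, 'e) lpa" where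
  "upath_val = (\<lambda>(c, v, p). c \<^bold>. pel v p)"

text \<open>The factor \<open>q\<close> allows an element to be moved along an edge that kills its terms with ghosts.\<close>

lemma path_span_kernel:
  assumes q: "awalk u q x"
    and "\<And>c v p. (c, v, p) \<in> set ts \<Longrightarrow> awalk v p u"
    and "\<phi> (lsum L upath_val ts \<^bold>* pel u q) = \<^bold>0"
  shows "lsum L upath_val ts = \<^bold>0"
  using assms(2,3)
proof (induction "length ts" arbitrary: ts rule: less_induct)
  case less
  show ?case
  proof (cases "ts = []")
    case True
    then show ?thesis by simp
  next
    case False
    \<comment> \<open>With p1 of least length, p1* sends every term with a different path either to
      zero or to a closed path of positive length, while p1 itself becomes the vertex u.\<close>
    define t1 where "t1 = (ARG_MIN (\<lambda>(c, v, p). length p) t. t \<in> set ts)"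
    obtain t0 where t0: "t0 \<in> set ts" using False by (cases ts) auto
    obtain c1 v1 p1 where t1: "t1 = (c1, v1, p1)" by (cases t1)
    have t1_in: "(c1, v1, p1) \<in> set ts"
      using arg_min_natI[of "\<lambda>t. t \<in> set ts", OF t0] unfolding t1[symmetric] t1_def by blast
    have minimal: "length p1 \<le> length p" if "(c, v, p) \<in> set ts" for c v p
      using arg_min_nat_le[of "\<lambda>t. t \<in> set ts", OF that, of "\<lambda>(c, v, p). length p"]
      unfolding t1_def[symmetric] t1 by simp
    have w1: "awalk v1 p1 u" using less.prems(1)[OF t1_in] .
    define same where "same = (\<lambda>(c :: 'k, v, p). v = v1 \<and> p = p1)"
    define rest where "rest = filter (\<lambda>t. \<not> same t) ts"
    \<comment> \<open>The list may contain p1 repeatedly, so its coefficients are collected first.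
      If they cancel, dropping these entries shortens the list without changing its value.\<close>
    define k where "k = sum_list (map fst (filter same ts))"
    have cl: "upath_val t \<in> carrier L" if "t \<in> set ts" for t
    proof -
      obtain c v p where t: "t = (c, v, p)" by (cases t)
      have "awalk v p u" by (rule less.prems(1)) (use that t in blast)
      then show ?thesis by (simp add: t upath_val_def)
    qed
    have "lsum L upath_val (filter same ss) = sum_list (map fst (filter same ss)) \<^bold>. pel v1 p1" for ss
      using w1 by (induction ss) (auto simp: upath_val_def same_def scale_add_left)
    then have split: "lsum L upath_val ts = k \<^bold>. pel v1 p1 \<^bold>+ lsum L upath_val rest"
      using lsum_partition[of ts upath_val same] cl by (simp add: k_def rest_def)
    have rest_cl: "lsum L upath_val rest \<in> carrier L" using cl by (auto simp: rest_def intro!: lsum_closed)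
    show ?thesis
    proof (cases "k = 0")
      case True
      then have eq: "lsum L upath_val ts = lsum L upath_val rest"
        using split w1 rest_cl by simp
      have "length rest < length ts"
        unfolding rest_def using t1_in by (intro length_filter_less[of "(c1, v1, p1)"]) (auto simp: same_def)
      moreover have "awalk v p u" if "(c, v, p) \<in> set rest" for c v p
        using that less.prems(1) by (auto simp: rest_def)
      ultimately show ?thesis
        using less.hyps[of rest] less.prems(2) unfolding eq by blast
    next
      case False
      define good where "good = (\<lambda>(c :: 'k, v, p). v = v1 \<and> prefix p1 p)"
      define g where "g = (\<lambda>(c :: 'k, v :: 'v, p :: 'e list). (c, drop (length p1) p))"
      have conj: "gel v1 p1 \<^bold>* upath_val t = path_val u (g t) \<and> closed_terms u [g t]"
        if tg: "t \<in> set rest" "good t" for t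
      proof -
        obtain c v p where t0: "t = (c, v, p)" by (cases t)
        have "awalk v p u" by (rule less.prems(1)) (use tg t0 in \<open>auto simp: rest_def\<close>)
        then have t: "t = (c, v1, p)" "prefix p1 p" "p \<noteq> p1" "awalk v1 p u"
          using tg by (auto simp: t0 good_def same_def rest_def)
        then obtain p' where p': "p = p1 @ p'" "p' \<noteq> []" by (auto elim: prefixE)
        then have w: "awalk u p' u" using t(4) awalk_append_cancel[OF w1] by blast
        then show ?thesis
          using t p' w1 gel_pel_append(1)[OF w1 w]
          by (simp add: g_def upath_val_def path_val_def closed_terms_def scale_mult_right)
      qed
      have bad: "gel v1 p1 \<^bold>* upath_val t = \<^bold>0" if "t \<in> set rest" "\<not> good t" for t
      proof -
        obtain c v p where t: "t = (c, v, p)" by (cases t)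
        have t': "awalk v p u" "length p1 \<le> length p" "\<not> (v = v1 \<and> p = p1)" "\<not> (v = v1 \<and> prefix p1 p)"
          using that less.prems(1) minimal t by (auto simp: good_def same_def rest_def)
        have "gel v1 p1 \<^bold>* pel v p = \<^bold>0"
        proof (cases "v = v1")
          case True
          then have "\<not> prefix p p1" using t'(2,3) by (auto elim!: prefixE)
          then show ?thesis using gel_pel_parallel[OF w1, of p u] t' True by blast
        next
          case False
          then show ?thesis using gel_pel_neq[OF w1 t'(1)] by simp
        qed
        then show ?thesis using w1 t' by (simp add: t upath_val_def scale_mult_right)
      qed
      have rcl: "upath_val t \<in> carrier L" if "t \<in> set rest" for t using cl that by (simp add: rest_def)
      define ts' where "ts' = map g (filter good rest)"
      have "gel v1 p1 \<^bold>* lsum L upath_val rest = lsum L (\<lambda>t. gel v1 p1 \<^bold>* upath_val t) rest"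
        using rcl w1 by (intro mult_lsum) auto
      also have "\<dots> = lsum L (\<lambda>t. gel v1 p1 \<^bold>* upath_val t) (filter good rest)"
        using rcl bad w1 by (intro lsum_filter[symmetric]) auto
      also have "\<dots> = lsum L (path_val u) ts'"
        unfolding ts'_def lsum_map using conj by (intro lsum_cong) auto
      finally have sum: "gel v1 p1 \<^bold>* lsum L upath_val rest = lsum L (path_val u) ts'" .
      have ts': "closed_terms u ts'" using conj by (fastforce simp: closed_terms_def ts'_def)
      have u: "u \<in> verts E" "x \<in> verts E" using q by auto
      let ?z = "k \<^bold>. vt u \<^bold>+ lsum L (path_val u) ts'"
      have z: "gel v1 p1 \<^bold>* lsum L upath_val ts = ?z"
        unfolding split using w1 rest_cl sum by (simp add: distrib_left scale_mult_right gel_pel_self)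
      \<comment> \<open>The hypothesis speaks of a q, not of a. Hence the forbidden kernel element
        is q* p1* a q, which conjugation by q brings to the form k x plus closed paths.\<close>
      obtain ts'' where ts'': "closed_terms x ts''"
          "gel u q \<^bold>* (?z \<^bold>* pel u q) = k \<^bold>. vt x \<^bold>+ lsum L (path_val x) ts''"
        using conjugate_closed_terms[OF u(1) ts' q] by blast
      have tot: "lsum L upath_val ts \<in> carrier L" using cl by auto
      have "gel u q \<^bold>* (?z \<^bold>* pel u q) = gel u q \<^bold>* (gel v1 p1 \<^bold>* (lsum L upath_val ts \<^bold>* pel u q))"
        unfolding z[symmetric] using q w1 tot by (simp add: mult_assoc)
      then have "\<phi> (gel u q \<^bold>* (?z \<^bold>* pel u q))
          = \<phi> (gel u q) \<^bold>* (\<phi> (gel v1 p1) \<^bold>* \<phi> (lsum L upath_val ts \<^bold>* pel u q))"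
        using q w1 tot by (simp only: \<phi>_hom gel_closed pel_closed mult_closed)
      also have "\<dots> = \<^bold>0"
        unfolding less.prems(2) using q w1 \<phi>_hom(1) by simp
      finally show ?thesis
        unfolding ts''(2) using constant_term_not_in_kernel[OF u(2) False ts''(1)] by simp
    qed
  qed
qed

text \<open>By induction, \<open>a\<close> in the kernel is annihilated by every edge leaving \<open>u\<close>. At a regular vertex
  (CK2) yields \<open>a = 0\<close>; at an infinite emitter some edge kills the terms of \<open>a\<close> with ghosts, so the
  terms without ghosts add up to zero, and the remaining ones involve finitely many edges only.\<close>

lemma ghost_bounded_kernel:
  assumes "u \<in> verts E"
    and "\<And>c v p x q. (c, v, p, x, q) \<in> set ts \<Longrightarrow> x = u \<and> length q \<le> n"
    and "set ts \<subseteq> monomials"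
    and "\<phi> (lsum L mono_val ts) = \<^bold>0"
  shows "lsum L mono_val ts = \<^bold>0"
  using assms
proof (induction n arbitrary: u ts)
  case 0
  define h where "h = (\<lambda>(c :: 'k, v :: 'v, p :: 'e list, x :: 'v, q :: 'e list). (c, v, p))"
  have h: "mono_val t = upath_val (h t) \<and> (\<forall>c v p. h t = (c, v, p) \<longrightarrow> awalk v p u)" if "t \<in> set ts" for t
  proof -
    obtain c v p x q where t: "t = (c, v, p, x, q)" by (cases t)
    have "x = u" "q = []" "t \<in> monomials" using that 0(2,3) t by auto
    then show ?thesis
      by (auto simp: t h_def monomials_def awalk_simps mono_val.simps upath_val_def pel_vt)
  qed
  have eq: "lsum L mono_val ts = lsum L upath_val (map h ts)"
    unfolding lsum_map using h by (intro lsum_cong) auto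
  have w: "awalk v p u" if "(c, v, p) \<in> set (map h ts)" for c v p
  proof -
    from that have "(c, v, p) \<in> h ` set ts" by simp
    then obtain t where t: "(c, v, p) = h t" "t \<in> set ts" by (rule imageE)
    show ?thesis using conjunct2[OF h[OF t(2)]] t(1)[symmetric] by blast
  qed
  have "mono_val t \<^bold>* vt u = mono_val t" if "t \<in> set ts" for t
  proof -
    obtain c v p x q where t: "t = (c, v, p, x, q)" by (cases t)
    have "x = u" "t \<in> monomials" using that 0(2,3) t by auto
    then show ?thesis using 0(1)
      by (auto simp: t monomials_def mono_val.simps scale_mult_left mult_assoc gel_vt)
  qed
  then have "lsum L mono_val ts \<^bold>* vt u = lsum L mono_val ts"
    using 0(1,3) by (subst lsum_mult) (auto intro!: lsum_cong)
  then have "\<phi> (lsum L upath_val (map h ts) \<^bold>* pel u []) = \<^bold>0" using 0(4) eq by simp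
  then show ?case
    unfolding eq using path_span_kernel[of u "[]" u "map h ts"] w 0(1) by (auto simp: awalk_simps)
next
  case (Suc n)
  let ?a = "lsum L mono_val ts"
  have a: "?a \<in> carrier L" using Suc.prems(3) by simp
  have mono: "\<exists>v p q y c. t = (c, v, p, u, q) \<and> awalk v p y \<and> awalk u q y \<and> length q \<le> Suc n"
    if "t \<in> set ts" for t
  proof -
    obtain c v p x q where t: "t = (c, v, p, x, q)" by (cases t)
    then show ?thesis using Suc.prems(2)[of c v p x q] Suc.prems(3) that by (auto simp: monomials_def)
  qed
  have cl: "mono_val t \<in> carrier L" if "t \<in> set ts" for t using Suc.prems(3) that by auto
  have "mono_val t \<^bold>* vt u = mono_val t" if "t \<in> set ts" for t
    using mono[OF that] Suc.prems(1) by (auto simp: mono_val.simps scale_mult_left mult_assoc gel_vt)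
  then have a_vt: "?a \<^bold>* vt u = ?a"
    using Suc.prems(1) cl by (subst lsum_mult) (auto intro!: lsum_cong)
  have a_ed: "?a \<^bold>* ed f = \<^bold>0" if f: "f \<in> out_arcs E u" for f
  proof -
    have f': "f \<in> arcs E" "tail E f = u" using f by auto
    \<comment> \<open>Right multiplication by f removes the first edge of a ghost path beginning
      with f, lengthens p by f when the ghost path is empty, and kills every other term. The bound
      on ghost lengths thus drops to n.\<close>
    define good where "good = (\<lambda>(c :: 'k, v :: 'v, p :: 'e list, x :: 'v, q). q = [] \<or> hd q = f)"
    define g where "g = (\<lambda>(c :: 'k, v :: 'v, p, x :: 'v, q :: 'e list).
      if q = [] then (c, v, p @ [f], head E f, []) else (c, v, p, head E f, tl q))"
    have good: "mono_val t \<^bold>* ed f = mono_val (g t) \<and> g t \<in> monomials \<and>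
        (\<forall>c v p x q. g t = (c, v, p, x, q) \<longrightarrow> x = head E f \<and> length q \<le> n)"
      if t: "t \<in> set ts" "good t" for t
    proof -
      obtain c v p q y where tt: "t = (c, v, p, u, q)" "awalk v p y" "awalk u q y" "length q \<le> Suc n"
        using mono[OF t(1)] by blast
      show ?thesis
      proof (cases q)
        case Nil
        then have y: "y = u" using tt(3) by (auto simp: awalk_simps)
        have w: "awalk u [f] (head E f)" "awalk v (p @ [f]) (head E f)"
          using f' tt(2) y by (auto simp: awalk_simps)
        have "pel v (p @ [f]) = pel v p \<^bold>* ed f"
          using pel_append[OF tt(2), of "[f]" "head E f"] w y f' by (simp add: ed_vt)
        moreover have "pel v (p @ [f]) \<^bold>* vt (head E f) = pel v (p @ [f])"
          using pel_vt[OF w(2)] f' by simp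
        moreover have "mono_val t \<^bold>* ed f = c \<^bold>. (pel v p \<^bold>* ed f)"
          using tt f' Nil by (simp add: mono_val.simps scale_mult_left mult_assoc vt_ed awalk_hd_in_verts)
        ultimately show ?thesis
          using w f' Nil by (auto simp: tt(1) g_def mono_val.simps monomials_def awalk_simps)
      next
        case (Cons f0 q')
        then have q: "q = f # q'" using t(2) by (simp add: tt(1) good_def)
        have w: "awalk (head E f) q' y" using tt(3) q by (simp add: awalk_simps)
        have "gel u q \<^bold>* ed f = gel (head E f) q'"
          using w f' q by (simp add: mult_assoc gh_ed gel_vt)
        then have "mono_val t \<^bold>* ed f = c \<^bold>. (pel v p \<^bold>* gel (head E f) q')"
          using tt f' by (simp add: mono_val.simps scale_mult_left mult_assoc)
        then show ?thesis
          using tt w q by (auto simp: g_def mono_val.simps monomials_def)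
      qed
    qed
    have bad: "mono_val t \<^bold>* ed f = \<^bold>0" if t: "t \<in> set ts" "\<not> good t" for t
    proof -
      obtain c v p q y where tt: "t = (c, v, p, u, q)" "awalk v p y" "awalk u q y" "length q \<le> Suc n"
        using mono[OF t(1)] by blast
      obtain f0 q' where q: "q = f0 # q'" "f0 \<noteq> f"
        using t(2) by (cases q) (auto simp: tt(1) good_def)
      then have w: "awalk (head E f0) q' y" "f0 \<in> arcs E" using tt(3) by (auto simp: awalk_simps)
      have "gel u q \<^bold>* ed f = \<^bold>0"
        using w f' q by (simp add: mult_assoc gh_ed)
      then show ?thesis
        using tt f' by (simp add: mono_val.simps scale_mult_left mult_assoc)
    qed
    have "?a \<^bold>* ed f = lsum L (\<lambda>t. mono_val t \<^bold>* ed f) ts"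
      using cl f' by (intro lsum_mult) auto
    also have "\<dots> = lsum L (\<lambda>t. mono_val t \<^bold>* ed f) (filter good ts)"
      using cl f' bad by (intro lsum_filter[symmetric]) auto
    also have "\<dots> = lsum L mono_val (map g (filter good ts))"
      unfolding lsum_map using good by (intro lsum_cong) auto
    finally have eq: "?a \<^bold>* ed f = lsum L mono_val (map g (filter good ts))" .
    have "lsum L mono_val (map g (filter good ts)) = \<^bold>0"
    proof (rule Suc.IH)
      show "head E f \<in> verts E" using f' by simp
      show "x = head E f \<and> length q \<le> n" if "(c, v, p, x, q) \<in> set (map g (filter good ts))" for c v p x q
      proof -
        from that have "(c, v, p, x, q) \<in> g ` set (filter good ts)" by simp
        then obtain t where t: "(c, v, p, x, q) = g t" "t \<in> set (filter good ts)" by (rule imageE)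
        from t(2) have "t \<in> set ts" "good t" by simp_all
        from good[OF this] t(1)[symmetric] show ?thesis by blast
      qed
      show "set (map g (filter good ts)) \<subseteq> monomials" using good by auto
      show "\<phi> (lsum L mono_val (map g (filter good ts))) = \<^bold>0"
        unfolding eq[symmetric] using a f' Suc.prems(4) by (simp add: \<phi>_hom)
    qed
    then show ?thesis using eq by simp
  qed
  have via_sum: "?a = \<^bold>0" if F: "finite F" "F \<subseteq> out_arcs E u"
    "?a \<^bold>* asum L (\<lambda>f. ed f \<^bold>* gh f) F = ?a" for F
  proof -
    have "?a \<^bold>* asum L (\<lambda>f. ed f \<^bold>* gh f) F = asum L (\<lambda>f. ?a \<^bold>* (ed f \<^bold>* gh f)) F"
      using F a by (intro mult_asum) auto
    also have "\<dots> = \<^bold>0"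
    proof (rule asum_neutral[OF F(1)])
      fix f assume "f \<in> F"
      then have "f \<in> out_arcs E u" "f \<in> arcs E" using F(2) by auto
      then show "?a \<^bold>* (ed f \<^bold>* gh f) = \<^bold>0"
        using a a_ed by (simp add: mult_assoc[symmetric])
    qed
    finally show ?thesis using F(3) by simp
  qed
  show ?case
  proof (cases "finite (out_arcs E u)")
    case True
    show ?thesis
    proof (cases "out_arcs E u = {}")
      case False
      then have "regular_vertex E u" using True Suc.prems(1) by (simp add: regular_vertex_def)
      then show ?thesis using via_sum[OF True] ck2 a_vt by auto
    next
      case True
      \<comment> \<open>A sink admits only empty ghost paths, so the smaller bound already
        holds.\<close>
      have "length q \<le> n" if t: "(c, v, p, x, q) \<in> set ts" for c v p x q
      proof -
        obtain y where "awalk u q y" using mono[OF t] by auto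
        then have "q = []" using True by (cases q) (auto simp: awalk_simps)
        then show ?thesis by simp
      qed
      then show ?thesis using Suc.prems by (intro Suc.IH[of u]) blast+
    qed
  next
    case False
    define real where "real = (\<lambda>(c :: 'k, v :: 'v, p :: 'e list, x :: 'v, q :: 'e list). q = [])"
    define F where "F = (\<lambda>(c :: 'k, v :: 'v, p :: 'e list, x :: 'v, q). hd q) ` set (filter (\<lambda>t. \<not> real t) ts)"
    have F: "finite F" "F \<subseteq> out_arcs E u"
    proof -
      show "F \<subseteq> out_arcs E u"
      proof
        fix f assume "f \<in> F"
        then obtain c v p x q where t: "(c, v, p, x, q) \<in> set ts" "q \<noteq> []" "f = hd q"
          by (auto simp: F_def real_def)
        then obtain y where "awalk u q y" using mono[OF t(1)] by auto
        then show "f \<in> out_arcs E u" using t by (cases q) (auto simp: awalk_simps)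
      qed
    qed (simp add: F_def)
    obtain f where f: "f \<in> out_arcs E u" "f \<notin> F"
      using False F(1) by (meson finite_subset subsetI)
    have f': "f \<in> arcs E" "tail E f = u" using f by auto
    let ?R = "lsum L mono_val (filter real ts)" and ?G = "lsum L mono_val (filter (\<lambda>t. \<not> real t) ts)"
    have split: "?a = ?R \<^bold>+ ?G" using cl by (intro lsum_partition)
    have R: "?R \<in> carrier L" and G: "?G \<in> carrier L" using cl by (auto intro!: lsum_closed)
    have ghost: "\<exists>c v p f0 q y. t = (c, v, p, u, f0 # q) \<and> f0 \<in> F \<and> f0 \<in> arcs E \<and> awalk v p y
        \<and> awalk (head E f0) q y" if t: "t \<in> set (filter (\<lambda>t. \<not> real t) ts)" for t
    proof -
      from t have t0: "t \<in> set ts" by simp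
      obtain c v p q y where tt: "t = (c, v, p, u, q)" "awalk v p y" "awalk u q y"
        using mono[of t] t0 by blast
      then obtain f0 q' where q: "q = f0 # q'" using t by (cases q) (auto simp: real_def)
      have "hd q \<in> F" unfolding F_def using t tt(1) by force
      then show ?thesis using tt q by (auto simp: awalk_simps)
    qed
    have "mono_val t \<^bold>* ed f = \<^bold>0" if t: "t \<in> set (filter (\<lambda>t. \<not> real t) ts)" for t
    proof -
      obtain c v p f0 q y where tt: "t = (c, v, p, u, f0 # q)" "f0 \<in> F" "f0 \<in> arcs E" "awalk v p y"
          "awalk (head E f0) q y" using ghost[OF t] by blast
      then have "f0 \<noteq> f" using f(2) by blast
      then show ?thesis using tt f' by (simp add: mono_val.simps scale_mult_left mult_assoc gh_ed)
    qed
    then have G_ed: "?G \<^bold>* ed f = \<^bold>0"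
      using cl f' by (subst lsum_mult) (auto intro!: lsum_neutral)
    then have R_ed: "?R \<^bold>* ed f = \<^bold>0"
      using a_ed[OF f(1)] R G f' unfolding split by (simp add: distrib_right)
    define h where "h = (\<lambda>(c :: 'k, v :: 'v, p :: 'e list, x :: 'v, q :: 'e list). (c, v, p))"
    have h: "mono_val t = upath_val (h t) \<and> (\<forall>c v p. h t = (c, v, p) \<longrightarrow> awalk v p u)"
      if t: "t \<in> set (filter real ts)" for t
    proof -
      from t have t0: "t \<in> set ts" by simp
      obtain c v p q y where tt: "t = (c, v, p, u, q)" "awalk v p y" "awalk u q y"
        using mono[of t] t0 by blast
      then show ?thesis using t
        by (auto simp: h_def real_def awalk_simps mono_val.simps upath_val_def pel_vt)
    qed
    have R_eq: "?R = lsum L upath_val (map h (filter real ts))"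
      unfolding lsum_map using h by (intro lsum_cong) auto
    have "?R = \<^bold>0"
      unfolding R_eq
    proof (rule path_span_kernel)
      show "awalk u [f] (head E f)" using f' by (auto simp: awalk_simps)
      show "awalk v p u" if "(c, v, p) \<in> set (map h (filter real ts))" for c v p
      proof -
        from that have "(c, v, p) \<in> h ` set (filter real ts)" by simp
        then obtain t where t: "(c, v, p) = h t" "t \<in> set (filter real ts)" by (rule imageE)
        show ?thesis using conjunct2[OF h[OF t(2)]] t(1)[symmetric] by blast
      qed
      have "pel u [f] = ed f" using f' by (simp add: ed_vt)
      then show "\<phi> (lsum L upath_val (map h (filter real ts)) \<^bold>* pel u [f]) = \<^bold>0"
        using R_ed unfolding R_eq[symmetric] by (simp add: \<phi>_hom)
    qed
    then have a_G: "?a = ?G" using split G by simp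
    have F_arcs: "g \<in> arcs E" if "g \<in> F" for g using F(2) that by auto
    have e: "asum L (\<lambda>f. ed f \<^bold>* gh f) F \<in> carrier L" using F_arcs by (intro asum_closed) simp
    \<comment> \<open>The sum of f f* over the finite set F of first ghost edges is a right identity
      on these terms: a finite substitute for CK2.\<close>
    have "mono_val t \<^bold>* asum L (\<lambda>f. ed f \<^bold>* gh f) F = mono_val t"
      if t: "t \<in> set (filter (\<lambda>t. \<not> real t) ts)" for t
    proof -
      obtain c v p f0 q y where tt: "t = (c, v, p, u, f0 # q)" "f0 \<in> F" "f0 \<in> arcs E" "awalk v p y"
          "awalk (head E f0) q y" using ghost[OF t] by blast
      have "gh f0 \<^bold>* asum L (\<lambda>f. ed f \<^bold>* gh f) F = asum L (\<lambda>f. gh f0 \<^bold>* (ed f \<^bold>* gh f)) F"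
        using F(1) F_arcs tt by (intro mult_asum) auto
      also have "\<dots> = asum L (\<lambda>f. if f = f0 then gh f else \<^bold>0) F"
        using F_arcs tt by (intro asum_cong) (simp_all add: mult_assoc[symmetric] gh_ed vt_gh)
      also have "\<dots> = gh f0" using F(1) tt by (intro asum_delta) auto
      finally have "gh f0 \<^bold>* asum L (\<lambda>f. ed f \<^bold>* gh f) F = gh f0" .
      then show ?thesis using tt e by (simp add: mono_val.simps scale_mult_left mult_assoc)
    qed
    then have "?G \<^bold>* asum L (\<lambda>f. ed f \<^bold>* gh f) F = ?G"
      using cl e by (subst lsum_mult) (auto intro!: lsum_cong)
    then show ?thesis using via_sum[OF F] unfolding a_G by simp
  qed
qed

lemma kernel_trivial:
  assumes "a \<in> carrier L" "\<phi> a = \<^bold>0"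
  shows "a = \<^bold>0"
proof (rule eq_zero_if_mult_vt_eq_zero[OF assms(1)])
  fix u assume u: "u \<in> verts E"
  obtain ts where ts: "set ts \<subseteq> monomials" "a = lsum L mono_val ts" using mono_span[OF assms(1)] .
  define at_u where "at_u = (\<lambda>(c :: 'k, v :: 'v, p :: 'e list, x, q :: 'e list). x = u)"
  have cl: "mono_val t \<in> carrier L" if "t \<in> set ts" for t using ts(1) that by auto
  have mv: "mono_val t \<^bold>* vt u = (if at_u t then mono_val t else \<^bold>0)" if "t \<in> set ts" for t
  proof -
    obtain c v p x q where t: "t = (c, v, p, x, q)" by (cases t)
    then have "(c, v, p, x, q) \<in> monomials" using ts(1) that by auto
    then show ?thesis using u
      by (auto simp: t at_u_def monomials_def mono_val.simps scale_mult_left mult_assoc gel_vt)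
  qed
  have "a \<^bold>* vt u = lsum L (\<lambda>t. mono_val t \<^bold>* vt u) ts"
    unfolding ts(2) using cl u by (intro lsum_mult) auto
  also have "\<dots> = lsum L (\<lambda>t. mono_val t \<^bold>* vt u) (filter at_u ts)"
    using cl u mv by (intro lsum_filter[symmetric]) auto
  also have "\<dots> = lsum L mono_val (filter at_u ts)"
    using mv by (intro lsum_cong) auto
  finally have eq: "a \<^bold>* vt u = lsum L mono_val (filter at_u ts)" .
  have "lsum L mono_val (filter at_u ts) = \<^bold>0"
  proof (rule ghost_bounded_kernel[OF u])
    \<comment> \<open>Any common bound on the ghost lengths works; the sum of all lengths dominates
      each of them.\<close>
    let ?n = "sum_list (map (\<lambda>(c, v, p, x, q). length q) ts)"
    show "x = u \<and> length q \<le> ?n" if "(c, v, p, x, q) \<in> set (filter at_u ts)" for c v p x q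
      using that member_le_sum_list[of "length q" "map (\<lambda>(c, v, p, x, q). length q) ts"]
      by (force simp: at_u_def)
    show "set (filter at_u ts) \<subseteq> monomials" using ts(1) by auto
    show "\<phi> (lsum L mono_val (filter at_u ts)) = \<^bold>0"
      unfolding eq[symmetric] using assms u \<phi>_hom(1) by (simp add: \<phi>_hom)
  qed
  then show "a \<^bold>* vt u = \<^bold>0" using eq by simp
qed

lemma injective: "inj_on \<phi> (carrier L)"
proof (rule inj_onI)
  fix a b assume ab: "a \<in> carrier L" "b \<in> carrier L" "\<phi> a = \<phi> b"
  have neg: "(- 1) \<^bold>. b \<in> carrier L" using ab by simp
  have "\<phi> (a \<^bold>+ (- 1) \<^bold>. b) = \<phi> a \<^bold>+ (- 1) \<^bold>. \<phi> b"
    by (simp only: \<phi>_hom(2)[OF ab(1) neg] \<phi>_hom(4)[OF ab(2)])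
  also have "\<dots> = \<^bold>0" unfolding ab(3) by (rule add_neg[OF \<phi>_hom(1)[OF ab(2)]])
  finally have "a \<^bold>+ (- 1) \<^bold>. b = \<^bold>0" by (rule kernel_trivial[OF add_closed[OF ab(1) neg]])
  then have "(- 1) \<^bold>. b \<^bold>+ a = \<^bold>0" unfolding add_comm[OF ab(1) neg] .
  moreover have "(- 1) \<^bold>. b \<^bold>+ b = \<^bold>0" using add_neg[OF ab(2)] unfolding add_comm[OF ab(2) neg] .
  ultimately show "a = b" using add_left_cancel[OF neg ab(1,2)] by simp
qed

end


section \<open>The homomorphisms $\varphi_{P,Q}$\<close>

text \<open>The matrices are normalised to have entries in w L w, where w is the identity. The
  assumptions are symmetric in P and Q, so \<open>swap\<close> yields every statement about
  \<open>\<phi>_{Q,P}\<close> as well.\<close>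

locale edge_substitution = leavitt E L
  for E :: "('v, 'e) pre_digraph" and L :: "('k :: field, ('k, 'v, 'e) lpa) nu_algebra" +
  fixes n :: nat and v w :: 'v and e :: "nat \<Rightarrow> 'e" and P Q :: "nat \<times> nat \<Rightarrow> ('k, 'v, 'e) lpa"
  assumes vw [simp]: "v \<in> verts E" "w \<in> verts E"
    and inj: "inj_on e {1..n}"
    and e [simp]: "\<And>i. i \<in> {1..n} \<Longrightarrow> e i \<in> arcs E"
      "\<And>i. i \<in> {1..n} \<Longrightarrow> tail E (e i) = v" "\<And>i. i \<in> {1..n} \<Longrightarrow> head E (e i) = w"
    and P [simp]: "\<And>i j. \<lbrakk>i \<in> {1..n}; j \<in> {1..n}\<rbrakk> \<Longrightarrow> P (i, j) \<in> carrier L"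
      "\<And>i j. \<lbrakk>i \<in> {1..n}; j \<in> {1..n}\<rbrakk> \<Longrightarrow> vt w \<^bold>* P (i, j) = P (i, j)"
      "\<And>i j. \<lbrakk>i \<in> {1..n}; j \<in> {1..n}\<rbrakk> \<Longrightarrow> P (i, j) \<^bold>* vt w = P (i, j)"
    and Q [simp]: "\<And>i j. \<lbrakk>i \<in> {1..n}; j \<in> {1..n}\<rbrakk> \<Longrightarrow> Q (i, j) \<in> carrier L"
      "\<And>i j. \<lbrakk>i \<in> {1..n}; j \<in> {1..n}\<rbrakk> \<Longrightarrow> vt w \<^bold>* Q (i, j) = Q (i, j)"
      "\<And>i j. \<lbrakk>i \<in> {1..n}; j \<in> {1..n}\<rbrakk> \<Longrightarrow> Q (i, j) \<^bold>* vt w = Q (i, j)"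
    and PQ: "\<And>i j. \<lbrakk>i \<in> {1..n}; j \<in> {1..n}\<rbrakk> \<Longrightarrow>
      asum L (\<lambda>k. P (i, k) \<^bold>* Q (k, j)) {1..n} = (if i = j then vt w else \<^bold>0)"
    and QP: "\<And>i j. \<lbrakk>i \<in> {1..n}; j \<in> {1..n}\<rbrakk> \<Longrightarrow>
      asum L (\<lambda>k. Q (i, k) \<^bold>* P (k, j)) {1..n} = (if i = j then vt w else \<^bold>0)"
begin

section \<open>The images of the edges and ghosts and their relations\<close>

lemma swap: "edge_substitution E L n v w e Q P"
  by unfold_locales (fact vw inj e P Q PQ QP)+

lemma e_eq_iff: "\<lbrakk>i \<in> {1..n}; j \<in> {1..n}\<rbrakk> \<Longrightarrow> e i = e j \<longleftrightarrow> i = j"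
  using inj by (rule inj_on_eq_iff)

definition edge_img :: "nat \<Rightarrow> ('k, 'v, 'e) lpa" where
  "edge_img i = asum L (\<lambda>k. ed (e k) \<^bold>* P (k, i)) {1..n}"

definition ghost_img :: "nat \<Rightarrow> ('k, 'v, 'e) lpa" where
  "ghost_img i = asum L (\<lambda>k. Q (i, k) \<^bold>* gh (e k)) {1..n}"

lemma img_closed [simp]:
  "i \<in> {1..n} \<Longrightarrow> edge_img i \<in> carrier L"
  "i \<in> {1..n} \<Longrightarrow> ghost_img i \<in> carrier L"
  unfolding edge_img_def ghost_img_def by (rule asum_closed, simp)+

lemma vt_edge_img: "i \<in> {1..n} \<Longrightarrow> vt v \<^bold>* edge_img i = edge_img i"
  unfolding edge_img_def
  by (subst mult_asum; (intro asum_cong)?; simp add: mult_assoc[symmetric] vt_ed)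

lemma edge_img_vt: "i \<in> {1..n} \<Longrightarrow> edge_img i \<^bold>* vt w = edge_img i"
  unfolding edge_img_def
  by (subst asum_mult; (intro asum_cong)?; simp add: mult_assoc)

lemma vt_ghost_img: "i \<in> {1..n} \<Longrightarrow> vt w \<^bold>* ghost_img i = ghost_img i"
  unfolding ghost_img_def
  by (subst mult_asum; (intro asum_cong)?; simp add: mult_assoc[symmetric])

lemma ghost_img_vt: "i \<in> {1..n} \<Longrightarrow> ghost_img i \<^bold>* vt v = ghost_img i"
  unfolding ghost_img_def
  by (subst asum_mult; (intro asum_cong)?; simp add: mult_assoc gh_vt)

lemma gh_edge_img:
  assumes "f \<in> arcs E" "f \<notin> e ` {1..n}" "i \<in> {1..n}"
  shows "gh f \<^bold>* edge_img i = \<^bold>0"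
proof -
  have "gh f \<^bold>* (ed (e k) \<^bold>* P (k, i)) = \<^bold>0" if k: "k \<in> {1..n}" for k
  proof -
    have "f \<noteq> e k" using assms(2) k by blast
    then show ?thesis using assms k by (simp add: mult_assoc[symmetric] gh_ed)
  qed
  then show ?thesis
    unfolding edge_img_def using assms by (subst mult_asum; (intro asum_neutral)?; simp)
qed

lemma ghost_img_ed:
  assumes "f \<in> arcs E" "f \<notin> e ` {1..n}" "i \<in> {1..n}"
  shows "ghost_img i \<^bold>* ed f = \<^bold>0"
proof -
  have "(Q (i, k) \<^bold>* gh (e k)) \<^bold>* ed f = \<^bold>0" if k: "k \<in> {1..n}" for k
  proof -
    have "e k \<noteq> f" using assms(2) k by blast
    then show ?thesis using assms k by (simp add: mult_assoc gh_ed)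
  qed
  then show ?thesis
    unfolding ghost_img_def using assms by (subst asum_mult; (intro asum_neutral)?; simp)
qed

lemma gh_e_edge_img:
  assumes "k \<in> {1..n}" "j \<in> {1..n}"
  shows "gh (e k) \<^bold>* edge_img j = P (k, j)"
proof -
  have "gh (e k) \<^bold>* edge_img j = asum L (\<lambda>l. gh (e k) \<^bold>* (ed (e l) \<^bold>* P (l, j))) {1..n}"
    unfolding edge_img_def using assms by (intro mult_asum) simp_all
  also have "\<dots> = asum L (\<lambda>l. if l = k then P (l, j) else \<^bold>0) {1..n}"
    using assms by (intro asum_cong) (simp_all add: mult_assoc[symmetric] gh_ed e_eq_iff)
  also have "\<dots> = P (k, j)" using assms by (intro asum_delta) simp_all
  finally show ?thesis .
qed

text \<open>CK1 for the images: applying e_k* to the image of e_j reads off the entry (k,j) of P, so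
  the product is an entry of Q P.\<close>

lemma ghost_img_edge_img:
  assumes "i \<in> {1..n}" "j \<in> {1..n}"
  shows "ghost_img i \<^bold>* edge_img j = (if i = j then vt w else \<^bold>0)"
proof -
  have "ghost_img i \<^bold>* edge_img j = asum L (\<lambda>k. (Q (i, k) \<^bold>* gh (e k)) \<^bold>* edge_img j) {1..n}"
    unfolding ghost_img_def using assms by (intro asum_mult) simp_all
  also have "\<dots> = asum L (\<lambda>k. Q (i, k) \<^bold>* P (k, j)) {1..n}"
    using assms by (intro asum_cong) (simp_all add: mult_assoc gh_e_edge_img)
  finally show ?thesis using QP[OF assms] by simp
qed

text \<open>CK2 for the images uses the other product: exchanging sums gives e_k times the entry
  (k,l) of P Q times e_l*, summed over k and l. The substituted edges thus contribute the same block
  as before.\<close>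

lemma asum_edge_img_ghost_img:
  "asum L (\<lambda>i. edge_img i \<^bold>* ghost_img i) {1..n} = asum L (\<lambda>k. ed (e k) \<^bold>* gh (e k)) {1..n}"
proof -
  have "edge_img i \<^bold>* ghost_img i = asum L (\<lambda>k. ed (e k) \<^bold>* (P (k, i) \<^bold>* ghost_img i)) {1..n}"
    if "i \<in> {1..n}" for i
    unfolding edge_img_def using that by (subst asum_mult; (intro asum_cong)?; simp add: mult_assoc)
  then have "asum L (\<lambda>i. edge_img i \<^bold>* ghost_img i) {1..n}
      = asum L (\<lambda>i. asum L (\<lambda>k. ed (e k) \<^bold>* (P (k, i) \<^bold>* ghost_img i)) {1..n}) {1..n}"
    by (intro asum_cong) simp_all
  also have "\<dots> = asum L (\<lambda>k. asum L (\<lambda>i. ed (e k) \<^bold>* (P (k, i) \<^bold>* ghost_img i)) {1..n}) {1..n}"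
    by (intro asum_swap) simp_all
  also have "\<dots> = asum L (\<lambda>k. ed (e k) \<^bold>* gh (e k)) {1..n}"
  proof (rule asum_cong)
    fix k assume k: "k \<in> {1..n}"
    have "asum L (\<lambda>i. P (k, i) \<^bold>* ghost_img i) {1..n}
        = asum L (\<lambda>i. asum L (\<lambda>l. (P (k, i) \<^bold>* Q (i, l)) \<^bold>* gh (e l)) {1..n}) {1..n}"
      using k unfolding ghost_img_def
      by (intro asum_cong[OF HOL.refl]; subst mult_asum; (intro asum_cong)?; simp add: mult_assoc)
    also have "\<dots> = asum L (\<lambda>l. asum L (\<lambda>i. (P (k, i) \<^bold>* Q (i, l)) \<^bold>* gh (e l)) {1..n}) {1..n}"
      using k by (intro asum_swap) simp_all
    also have "\<dots> = asum L (\<lambda>l. if l = k then gh (e l) else \<^bold>0) {1..n}"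
    proof (rule asum_cong)
      fix l assume l: "l \<in> {1..n}"
      have "asum L (\<lambda>i. (P (k, i) \<^bold>* Q (i, l)) \<^bold>* gh (e l)) {1..n}
          = asum L (\<lambda>i. P (k, i) \<^bold>* Q (i, l)) {1..n} \<^bold>* gh (e l)"
        using k l by (intro asum_mult[symmetric]) simp_all
      then show "asum L (\<lambda>i. (P (k, i) \<^bold>* Q (i, l)) \<^bold>* gh (e l)) {1..n} = (if l = k then gh (e l) else \<^bold>0)"
        using PQ[OF k l] l by (simp add: vt_gh)
    qed simp_all
    also have "\<dots> = gh (e k)" using k by (intro asum_delta) simp_all
    finally show "asum L (\<lambda>i. ed (e k) \<^bold>* (P (k, i) \<^bold>* ghost_img i)) {1..n} = ed (e k) \<^bold>* gh (e k)"
      using k mult_asum[of "{1..n}" "\<lambda>i. P (k, i) \<^bold>* ghost_img i" "ed (e k)"] by simp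
  qed simp_all
  finally show ?thesis .
qed

lemma is_lpa_phi_iff:
  "is_lpa_phi E n e P Q \<phi> \<longleftrightarrow> \<phi> \<in> alg_hom L L \<and> (\<forall>u\<in>verts E. \<phi> (vt u) = vt u) \<and>
     (\<forall>f\<in>arcs E - e ` {1..n}. \<phi> (ed f) = ed f \<and> \<phi> (gh f) = gh f) \<and>
     (\<forall>i\<in>{1..n}. \<phi> (ed (e i)) = edge_img i \<and> \<phi> (gh (e i)) = ghost_img i)"
  unfolding is_lpa_phi_def edge_img_def ghost_img_def L_def[symmetric] ..

lemma hom_eqI:
  assumes "\<phi> \<in> alg_hom L L" "\<psi> \<in> alg_hom L L"
    and "\<And>u. u \<in> verts E \<Longrightarrow> \<phi> (vt u) = \<psi> (vt u)"
    and "\<And>f. \<lbrakk>f \<in> arcs E; f \<notin> e ` {1..n}\<rbrakk> \<Longrightarrow> \<phi> (ed f) = \<psi> (ed f)"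
    and "\<And>f. \<lbrakk>f \<in> arcs E; f \<notin> e ` {1..n}\<rbrakk> \<Longrightarrow> \<phi> (gh f) = \<psi> (gh f)"
    and "\<And>i. i \<in> {1..n} \<Longrightarrow> \<phi> (ed (e i)) = \<psi> (ed (e i))"
    and "\<And>i. i \<in> {1..n} \<Longrightarrow> \<phi> (gh (e i)) = \<psi> (gh (e i))"
  shows "\<phi> = \<psi>"
proof (rule presented_algebra_hom_unique[OF nu_algebra_axioms])
  show "\<phi> \<in> alg_hom (presented_algebra (lpa_gens E) (lpa_rels E)) L"
    "\<psi> \<in> alg_hom (presented_algebra (lpa_gens E) (lpa_rels E)) L"
    using assms(1,2) by (simp_all add: L_def leavitt_path_algebra_def)
  fix x assume "x \<in> lpa_gens E"
  then consider u where "x = Vert u" "u \<in> verts E" | f where "x = Edge f" "f \<in> arcs E"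
    | f where "x = Ghost f" "f \<in> arcs E"
    by (auto simp: lpa_gens_def)
  then show "\<phi> (cls (lpa_gens E) (lpa_rels E) (Gen x)) = \<psi> (cls (lpa_gens E) (lpa_rels E) (Gen x))"
    unfolding lpa_vert_def[symmetric] lpa_edge_def[symmetric] lpa_ghost_def[symmetric]
  proof cases
    case 1
    then show ?thesis using assms(3) by (simp flip: lpa_vert_def)
  next
    case 2
    then show ?thesis using assms(4,6) by (cases "f \<in> e ` {1..n}") (auto simp flip: lpa_edge_def)
  next
    case 3
    then show ?thesis using assms(5,7) by (cases "f \<in> e ` {1..n}") (auto simp flip: lpa_ghost_def)
  qed
qed

lemma phi_exists: "\<exists>\<phi>. is_lpa_phi E n e P Q \<phi>"
proof -
  define N where "N = e ` {1..n}"
  define idx where "idx = the_inv_into {1..n} e"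
  have idx: "idx (e i) = i" if "i \<in> {1..n}" for i
    unfolding idx_def using inj that by (rule the_inv_into_f_f)
  define D where "D f = (if f \<in> N then edge_img (idx f) else ed f)" for f
  define H where "H f = (if f \<in> N then ghost_img (idx f) else gh f)" for f
  have on_N: "D (e i) = edge_img i" "H (e i) = ghost_img i" if "i \<in> {1..n}" for i
    using that by (simp_all add: D_def H_def N_def idx)
  have off_N: "D f = ed f" "H f = gh f" if "f \<notin> N" for f
    using that by (simp_all add: D_def H_def)
  have N_cases: "(\<exists>i \<in> {1..n}. f = e i) \<or> f \<notin> N" for f by (auto simp: N_def)
  have D: "D f \<in> carrier L" "vt (tail E f) \<^bold>* D f = D f" "D f \<^bold>* vt (head E f) = D f"
    and H: "H f \<in> carrier L" "vt (head E f) \<^bold>* H f = H f" "H f \<^bold>* vt (tail E f) = H f"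
    if "f \<in> arcs E" for f
  proof -
    have "D f \<in> carrier L \<and> vt (tail E f) \<^bold>* D f = D f \<and> D f \<^bold>* vt (head E f) = D f \<and>
      H f \<in> carrier L \<and> vt (head E f) \<^bold>* H f = H f \<and> H f \<^bold>* vt (tail E f) = H f"
      using N_cases[of f]
    proof
      assume "\<exists>i \<in> {1..n}. f = e i"
      then obtain i where "i \<in> {1..n}" "f = e i" by blast
      then show ?thesis
        by (simp add: on_N vt_edge_img edge_img_vt vt_ghost_img ghost_img_vt)
    next
      assume "f \<notin> N"
      then show ?thesis using that by (simp add: off_N vt_ed ed_vt vt_gh gh_vt)
    qed
    then show "D f \<in> carrier L" "vt (tail E f) \<^bold>* D f = D f" "D f \<^bold>* vt (head E f) = D f"
      "H f \<in> carrier L" "vt (head E f) \<^bold>* H f = H f" "H f \<^bold>* vt (tail E f) = H f" by simp_all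
  qed
  have HD: "H f \<^bold>* D g = (if f = g then vt (head E f) else \<^bold>0)" if fg: "f \<in> arcs E" "g \<in> arcs E" for f g
    using N_cases[of f]
  proof
    assume f: "f \<notin> N"
    show ?thesis using N_cases[of g]
    proof
      assume "\<exists>i \<in> {1..n}. g = e i"
      then obtain i where i: "i \<in> {1..n}" "g = e i" by blast
      then have "f \<noteq> g" using f by (auto simp: N_def)
      then show ?thesis using gh_edge_img[OF fg(1) f[unfolded N_def] i(1)] i f by (simp add: off_N on_N)
    next
      assume "g \<notin> N"
      then show ?thesis using f fg by (simp add: off_N gh_ed)
    qed
  next
    assume "\<exists>i \<in> {1..n}. f = e i"
    then obtain i where i: "i \<in> {1..n}" "f = e i" by blast
    show ?thesis using N_cases[of g]
    proof
      assume "\<exists>i \<in> {1..n}. g = e i"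
      then obtain j where j: "j \<in> {1..n}" "g = e j" by blast
      show ?thesis using ghost_img_edge_img[OF i(1) j(1)] i j by (simp add: on_N e_eq_iff)
    next
      assume g: "g \<notin> N"
      then have "f \<noteq> g" using i by (auto simp: N_def)
      then show ?thesis using ghost_img_ed[OF fg(2) g[unfolded N_def] i(1)] i g by (simp add: off_N on_N)
    qed
  qed
  have DH_sum: "asum L (\<lambda>f. D f \<^bold>* H f) (out_arcs E u) = vt u" if u: "regular_vertex E u" for u
  proof -
    have fin: "finite (out_arcs E u)" using u by (simp add: regular_vertex_def)
    have out: "f \<in> arcs E" if "f \<in> out_arcs E u" for f using that by simp
    have off: "asum L (\<lambda>f. D f \<^bold>* H f) (out_arcs E u - N) = asum L (\<lambda>f. ed f \<^bold>* gh f) (out_arcs E u - N)"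
      using out by (intro asum_cong) (auto simp: off_N)
    \<comment> \<open>All e_i leave v, so in the CK2 sum at v they appear together and at any other
      vertex none of them appears.\<close>
    have on: "asum L (\<lambda>f. D f \<^bold>* H f) (out_arcs E u \<inter> N) = asum L (\<lambda>f. ed f \<^bold>* gh f) (out_arcs E u \<inter> N)"
    proof (cases "u = v")
      case True
      then have "out_arcs E u \<inter> N = e ` {1..n}" by (auto simp: N_def)
      moreover have "asum L (\<lambda>f. D f \<^bold>* H f) (e ` {1..n}) = asum L (\<lambda>i. edge_img i \<^bold>* ghost_img i) {1..n}"
        using inj by (subst asum_reindex; (intro asum_cong)?; simp add: on_N)
      moreover have "asum L (\<lambda>f. ed f \<^bold>* gh f) (e ` {1..n}) = asum L (\<lambda>i. ed (e i) \<^bold>* gh (e i)) {1..n}"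
        using inj by (intro asum_reindex) simp_all
      ultimately show ?thesis using asum_edge_img_ghost_img by simp
    next
      case False
      then have "out_arcs E u \<inter> N = {}" by (auto simp: N_def)
      then show ?thesis by simp
    qed
    have split: "asum L g (out_arcs E u) = asum L g (out_arcs E u - N) \<^bold>+ asum L g (out_arcs E u \<inter> N)"
      if "\<And>f. f \<in> arcs E \<Longrightarrow> g f \<in> carrier L" for g
    proof -
      have "asum L g ((out_arcs E u - N) \<union> (out_arcs E u \<inter> N))
          = asum L g (out_arcs E u - N) \<^bold>+ asum L g (out_arcs E u \<inter> N)"
        using fin that by (intro asum_Un_disjoint) auto
      moreover have "(out_arcs E u - N) \<union> (out_arcs E u \<inter> N) = out_arcs E u" by blast
      ultimately show ?thesis by simp
    qed
    have "asum L (\<lambda>f. D f \<^bold>* H f) (out_arcs E u) = asum L (\<lambda>f. ed f \<^bold>* gh f) (out_arcs E u)"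
      unfolding split[of "\<lambda>f. ed f \<^bold>* gh f", simplified] using split[of "\<lambda>f. D f \<^bold>* H f"] D(1) H(1) on off
      by simp
    then show ?thesis using ck2[OF u] by simp
  qed
  define G where "G = case_lpa_gen vt D H"
  have G [simp]: "G (Vert u) = vt u" "G (Edge f) = D f" "G (Ghost f) = H f" for u f
    by (simp_all add: G_def)
  have G_closed: "G x \<in> carrier L" if "x \<in> lpa_gens E" for x
    using that by (cases x) (auto simp: D(1) H(1))
  have sum: "aeval L G (foldr Add (map (\<lambda>e. Mult (Gen (Edge e)) (Gen (Ghost e))) es) Zero)
      = lsum L (\<lambda>f. D f \<^bold>* H f) es" for es
    by (induction es) simp_all
  have rel: "aeval L G s = aeval L G t" if "(s, t) \<in> lpa_rels E" for s t
    using that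
  proof cases
    case (ck2 u es)
    have "f \<in> arcs E" if "f \<in> set es" for f using that ck2(4) by simp
    then have "lsum L (\<lambda>f. D f \<^bold>* H f) es = asum L (\<lambda>f. D f \<^bold>* H f) (set es)"
      using ck2(5) D(1) H(1) by (intro asum_set[symmetric]) simp_all
    then show ?thesis using DH_sum[OF ck2(3)] ck2(4) by (simp add: ck2(1,2) sum)
  qed (simp_all add: vt_vt D H HD)
  obtain \<phi> where \<phi>: "\<phi> \<in> alg_hom L L"
    and gen: "\<And>x. x \<in> lpa_gens E \<Longrightarrow> \<phi> (cls (lpa_gens E) (lpa_rels E) (Gen x)) = G x"
    using presented_algebra_hom_exists[of "lpa_gens E" G "lpa_rels E", OF G_closed rel]
    unfolding L_def leavitt_path_algebra_def by blast
  have "\<phi> (vt u) = vt u" if "u \<in> verts E" for u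
    using gen[of "Vert u"] that by (simp add: lpa_vert_def)
  moreover have "\<phi> (ed f) = D f" "\<phi> (gh f) = H f" if "f \<in> arcs E" for f
    using gen[of "Edge f"] gen[of "Ghost f"] that by (simp_all add: lpa_edge_def lpa_ghost_def)
  ultimately have "is_lpa_phi E n e P Q \<phi>"
    unfolding is_lpa_phi_iff using \<phi> by (auto simp: on_N off_N N_def)
  then show ?thesis by blast
qed

lemma phi_unique: "\<lbrakk>is_lpa_phi E n e P Q \<phi>; is_lpa_phi E n e P Q \<psi>\<rbrakk> \<Longrightarrow> \<phi> = \<psi>"
  by (rule hom_eqI) (simp_all add: is_lpa_phi_iff)

text \<open>X = X (Y Z) = (X Y) Z = Z. As w is an identity only on the corner, the hypotheses record
  that it fixes X on the right and Z on the left.\<close>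

lemma matrix_left_right_inverse:
  assumes X: "\<And>i j. \<lbrakk>i \<in> {1..n}; j \<in> {1..n}\<rbrakk> \<Longrightarrow> X i j \<in> carrier L \<and> X i j \<^bold>* vt w = X i j"
    and Y: "\<And>i j. \<lbrakk>i \<in> {1..n}; j \<in> {1..n}\<rbrakk> \<Longrightarrow> Y i j \<in> carrier L"
    and Z: "\<And>i j. \<lbrakk>i \<in> {1..n}; j \<in> {1..n}\<rbrakk> \<Longrightarrow> Z i j \<in> carrier L \<and> vt w \<^bold>* Z i j = Z i j"
    and XY: "\<And>i j. \<lbrakk>i \<in> {1..n}; j \<in> {1..n}\<rbrakk> \<Longrightarrow>
      asum L (\<lambda>k. X i k \<^bold>* Y k j) {1..n} = (if i = j then vt w else \<^bold>0)"
    and YZ: "\<And>i j. \<lbrakk>i \<in> {1..n}; j \<in> {1..n}\<rbrakk> \<Longrightarrow>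
      asum L (\<lambda>k. Y i k \<^bold>* Z k j) {1..n} = (if i = j then vt w else \<^bold>0)"
    and i: "i \<in> {1..n}" and j: "j \<in> {1..n}"
  shows "X i j = Z i j"
proof -
  have "X i j = asum L (\<lambda>l. if l = j then X i l else \<^bold>0) {1..n}"
    using X i j by (intro asum_delta[symmetric]) simp_all
  also have "\<dots> = asum L (\<lambda>l. asum L (\<lambda>k. (X i l \<^bold>* Y l k) \<^bold>* Z k j) {1..n}) {1..n}"
  proof (rule asum_cong)
    fix l assume l: "l \<in> {1..n}"
    have "asum L (\<lambda>k. (X i l \<^bold>* Y l k) \<^bold>* Z k j) {1..n} = asum L (\<lambda>k. X i l \<^bold>* (Y l k \<^bold>* Z k j)) {1..n}"
      using X Y Z i j l by (intro asum_cong) (simp_all add: mult_assoc)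
    also have "\<dots> = X i l \<^bold>* asum L (\<lambda>k. Y l k \<^bold>* Z k j) {1..n}"
      using X Y Z i j l by (intro mult_asum[symmetric]) simp_all
    also have "\<dots> = (if l = j then X i l else \<^bold>0)"
      using X i l YZ[OF l j] by simp
    finally show "(if l = j then X i l else \<^bold>0) = asum L (\<lambda>k. (X i l \<^bold>* Y l k) \<^bold>* Z k j) {1..n}" ..
  qed simp
  also have "\<dots> = asum L (\<lambda>k. asum L (\<lambda>l. (X i l \<^bold>* Y l k) \<^bold>* Z k j) {1..n}) {1..n}"
    using X Y Z i j by (intro asum_swap) simp_all
  also have "\<dots> = asum L (\<lambda>k. if k = i then Z k j else \<^bold>0) {1..n}"
  proof (rule asum_cong)
    fix k assume k: "k \<in> {1..n}"
    have "asum L (\<lambda>l. (X i l \<^bold>* Y l k) \<^bold>* Z k j) {1..n} = asum L (\<lambda>l. X i l \<^bold>* Y l k) {1..n} \<^bold>* Z k j"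
      using X Y Z i j k by (intro asum_mult[symmetric]) simp_all
    then show "asum L (\<lambda>l. (X i l \<^bold>* Y l k) \<^bold>* Z k j) {1..n} = (if k = i then Z k j else \<^bold>0)"
      using XY[OF i k] Z[OF i j] Z[OF k j] by (cases "k = i") simp_all
  qed (use Z j in simp_all)
  also have "\<dots> = Z i j" using Z i j by (intro asum_delta) simp_all
  finally show ?thesis .
qed

text \<open>Since \<open>\<phi>\<close> fixes w, it carries P Q = w I to the same equation for the
  images. If one factor is unchanged, the other and its image are inverse to the same matrix, hence
  equal.\<close>

lemma phi_fixes_both:
  assumes \<phi>: "is_lpa_phi E n e P Q \<phi>"
    and "(\<forall>i\<in>{1..n}. \<forall>j\<in>{1..n}. \<phi> (P (i, j)) = P (i, j)) \<or>
      (\<forall>i\<in>{1..n}. \<forall>j\<in>{1..n}. \<phi> (Q (i, j)) = Q (i, j))"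
    and ij: "i \<in> {1..n}" "j \<in> {1..n}"
  shows "\<phi> (P (i, j)) = P (i, j) \<and> \<phi> (Q (i, j)) = Q (i, j)"
proof -
  have hom: "\<phi> \<in> alg_hom L L" and vt: "\<phi> (vt w) = vt w"
    using \<phi> by (simp_all add: is_lpa_phi_iff)
  note nu = nu_algebra_axioms nu_algebra_axioms
  have \<phi>P: "\<phi> (P (i, j)) \<in> carrier L \<and> vt w \<^bold>* \<phi> (P (i, j)) = \<phi> (P (i, j)) \<and> \<phi> (P (i, j)) \<^bold>* vt w = \<phi> (P (i, j))"
    and \<phi>Q: "\<phi> (Q (i, j)) \<in> carrier L \<and> vt w \<^bold>* \<phi> (Q (i, j)) = \<phi> (Q (i, j)) \<and> \<phi> (Q (i, j)) \<^bold>* vt w = \<phi> (Q (i, j))"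
    if "i \<in> {1..n}" "j \<in> {1..n}" for i j
    using that hom_mult[OF hom, of "vt w" "P (i, j)"] hom_mult[OF hom, of "P (i, j)" "vt w"]
      hom_mult[OF hom, of "vt w" "Q (i, j)"] hom_mult[OF hom, of "Q (i, j)" "vt w"]
      hom_closed[OF hom] by (simp_all add: vt)
  have \<phi>PQ: "asum L (\<lambda>k. \<phi> (P (i, k)) \<^bold>* \<phi> (Q (k, j))) {1..n} = (if i = j then vt w else \<^bold>0)"
    if "i \<in> {1..n}" "j \<in> {1..n}" for i j
  proof -
    have "\<phi> (asum L (\<lambda>k. P (i, k) \<^bold>* Q (k, j)) {1..n}) = asum L (\<lambda>k. \<phi> (P (i, k) \<^bold>* Q (k, j))) {1..n}"
      using that by (intro hom_asum[OF hom nu]) simp_all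
    also have "\<dots> = asum L (\<lambda>k. \<phi> (P (i, k)) \<^bold>* \<phi> (Q (k, j))) {1..n}"
      using that \<phi>P \<phi>Q by (intro asum_cong) (simp_all add: hom_mult[OF hom])
    finally show ?thesis using PQ[OF that] vt hom_zero[OF hom nu] by (cases "i = j") simp_all
  qed
  from assms(2) show ?thesis
  proof
    assume fix_P: "\<forall>i\<in>{1..n}. \<forall>j\<in>{1..n}. \<phi> (P (i, j)) = P (i, j)"
    have "asum L (\<lambda>k. P (i, k) \<^bold>* \<phi> (Q (k, j))) {1..n} = (if i = j then vt w else \<^bold>0)"
      if "i \<in> {1..n}" "j \<in> {1..n}" for i j
    proof -
      have "asum L (\<lambda>k. P (i, k) \<^bold>* \<phi> (Q (k, j))) {1..n} = asum L (\<lambda>k. \<phi> (P (i, k)) \<^bold>* \<phi> (Q (k, j))) {1..n}"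
        using fix_P that by (intro asum_cong) simp_all
      then show ?thesis using \<phi>PQ[OF that] by simp
    qed
    then have "Q (i, j) = \<phi> (Q (i, j))"
      using \<phi>Q QP ij
      by (intro matrix_left_right_inverse[of "\<lambda>i j. Q (i, j)" "\<lambda>i j. P (i, j)" "\<lambda>i j. \<phi> (Q (i, j))" i j]) simp_all
    then show ?thesis using fix_P ij by simp
  next
    assume fix_Q: "\<forall>i\<in>{1..n}. \<forall>j\<in>{1..n}. \<phi> (Q (i, j)) = Q (i, j)"
    have "asum L (\<lambda>k. \<phi> (P (i, k)) \<^bold>* Q (k, j)) {1..n} = (if i = j then vt w else \<^bold>0)"
      if "i \<in> {1..n}" "j \<in> {1..n}" for i j
    proof -
      have "asum L (\<lambda>k. \<phi> (P (i, k)) \<^bold>* Q (k, j)) {1..n} = asum L (\<lambda>k. \<phi> (P (i, k)) \<^bold>* \<phi> (Q (k, j))) {1..n}"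
        using fix_Q that by (intro asum_cong) simp_all
      then show ?thesis using \<phi>PQ[OF that] by simp
    qed
    then have "\<phi> (P (i, j)) = P (i, j)"
      using \<phi>P QP ij
      by (intro matrix_left_right_inverse[of "\<lambda>i j. \<phi> (P (i, j))" "\<lambda>i j. Q (i, j)" "\<lambda>i j. P (i, j)" i j]) simp_all
    then show ?thesis using fix_Q ij by simp
  qed
qed

text \<open>Once the entries are fixed, \<open>\<phi>\<close> only substitutes the e_k and e_k*
  inside the images under \<open>\<psi>\<close>. This produces the matrix P Q between the edges and
  their coefficients in both cases, and P Q = w I returns e_i and e_i*.\<close>

lemma phi_right_inverse:
  assumes \<phi>: "is_lpa_phi E n e P Q \<phi>" and \<psi>: "is_lpa_phi E n e Q P \<psi>"
    and "(\<forall>i\<in>{1..n}. \<forall>j\<in>{1..n}. \<phi> (P (i, j)) = P (i, j)) \<or>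
      (\<forall>i\<in>{1..n}. \<forall>j\<in>{1..n}. \<phi> (Q (i, j)) = Q (i, j))"
    and a: "a \<in> carrier L"
  shows "\<phi> (\<psi> a) = a"
proof -
  interpret S: edge_substitution E L n v w e Q P by (rule swap)
  note nu = nu_algebra_axioms nu_algebra_axioms
  have hom: "\<phi> \<in> alg_hom L L" and hom': "\<psi> \<in> alg_hom L L"
    using \<phi> \<psi> by (simp_all add: is_lpa_phi_iff S.is_lpa_phi_iff)
  have fix_P: "\<phi> (P (i, j)) = P (i, j)" and fix_Q: "\<phi> (Q (i, j)) = Q (i, j)"
    if "i \<in> {1..n}" "j \<in> {1..n}" for i j
    using phi_fixes_both[OF \<phi> assms(3) that] by simp_all
  let ?\<theta> = "restrict (\<lambda>a. \<phi> (\<psi> a)) (carrier L)"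
  have "?\<theta> = restrict (\<lambda>a. a) (carrier L)"
  proof (rule hom_eqI)
    show "?\<theta> \<in> alg_hom L L" by (rule hom_comp[OF nu_algebra_axioms hom' hom])
    show "restrict (\<lambda>a. a) (carrier L) \<in> alg_hom L L" by (rule hom_id[OF nu_algebra_axioms])
  next
    fix i assume i: "i \<in> {1..n}"
    have "\<phi> (S.edge_img i) = asum L (\<lambda>k. \<phi> (ed (e k) \<^bold>* Q (k, i))) {1..n}"
      unfolding S.edge_img_def using i by (intro hom_asum[OF hom nu]) simp_all
    also have "\<dots> = asum L (\<lambda>k. edge_img k \<^bold>* Q (k, i)) {1..n}"
      using i \<phi> by (intro asum_cong) (simp_all add: hom_mult[OF hom] fix_Q is_lpa_phi_iff)
    also have "\<dots> = asum L (\<lambda>k. asum L (\<lambda>l. ed (e l) \<^bold>* (P (l, k) \<^bold>* Q (k, i))) {1..n}) {1..n}"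
      using i unfolding edge_img_def
      by (intro asum_cong[OF HOL.refl]; subst asum_mult; (intro asum_cong)?; simp add: mult_assoc)
    also have "\<dots> = asum L (\<lambda>l. asum L (\<lambda>k. ed (e l) \<^bold>* (P (l, k) \<^bold>* Q (k, i))) {1..n}) {1..n}"
      using i by (intro asum_swap) simp_all
    also have "\<dots> = asum L (\<lambda>l. if l = i then ed (e l) else \<^bold>0) {1..n}"
    proof (rule asum_cong)
      fix l assume l: "l \<in> {1..n}"
      have "asum L (\<lambda>k. ed (e l) \<^bold>* (P (l, k) \<^bold>* Q (k, i))) {1..n}
          = ed (e l) \<^bold>* asum L (\<lambda>k. P (l, k) \<^bold>* Q (k, i)) {1..n}"
        using i l by (intro mult_asum[symmetric]) simp_all
      then show "asum L (\<lambda>k. ed (e l) \<^bold>* (P (l, k) \<^bold>* Q (k, i))) {1..n} = (if l = i then ed (e l) else \<^bold>0)"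
        using PQ[OF l i] l by (simp add: ed_vt)
    qed simp_all
    also have "\<dots> = ed (e i)" using i by (intro asum_delta) simp_all
    finally show "?\<theta> (ed (e i)) = restrict (\<lambda>a. a) (carrier L) (ed (e i))"
      using i \<psi> by (simp add: S.is_lpa_phi_iff)
  next
    fix i assume i: "i \<in> {1..n}"
    have "\<phi> (S.ghost_img i) = asum L (\<lambda>k. \<phi> (P (i, k) \<^bold>* gh (e k))) {1..n}"
      unfolding S.ghost_img_def using i by (intro hom_asum[OF hom nu]) simp_all
    also have "\<dots> = asum L (\<lambda>k. P (i, k) \<^bold>* ghost_img k) {1..n}"
      using i \<phi> by (intro asum_cong) (simp_all add: hom_mult[OF hom] fix_P is_lpa_phi_iff)
    also have "\<dots> = asum L (\<lambda>k. asum L (\<lambda>l. (P (i, k) \<^bold>* Q (k, l)) \<^bold>* gh (e l)) {1..n}) {1..n}"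
      using i unfolding ghost_img_def
      by (intro asum_cong[OF HOL.refl]; subst mult_asum; (intro asum_cong)?; simp add: mult_assoc)
    also have "\<dots> = asum L (\<lambda>l. asum L (\<lambda>k. (P (i, k) \<^bold>* Q (k, l)) \<^bold>* gh (e l)) {1..n}) {1..n}"
      using i by (intro asum_swap) simp_all
    also have "\<dots> = asum L (\<lambda>l. if l = i then gh (e l) else \<^bold>0) {1..n}"
    proof (rule asum_cong)
      fix l assume l: "l \<in> {1..n}"
      have "asum L (\<lambda>k. (P (i, k) \<^bold>* Q (k, l)) \<^bold>* gh (e l)) {1..n}
          = asum L (\<lambda>k. P (i, k) \<^bold>* Q (k, l)) {1..n} \<^bold>* gh (e l)"
        using i l by (intro asum_mult[symmetric]) simp_all
      then show "asum L (\<lambda>k. (P (i, k) \<^bold>* Q (k, l)) \<^bold>* gh (e l)) {1..n} = (if l = i then gh (e l) else \<^bold>0)"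
        using PQ[OF i l] l by (simp add: vt_gh)
    qed simp_all
    also have "\<dots> = gh (e i)" using i by (intro asum_delta) simp_all
    finally show "?\<theta> (gh (e i)) = restrict (\<lambda>a. a) (carrier L) (gh (e i))"
      using i \<psi> by (simp add: S.is_lpa_phi_iff)
  qed (use \<phi> \<psi> in \<open>simp_all add: is_lpa_phi_iff S.is_lpa_phi_iff\<close>)
  then have "?\<theta> a = restrict (\<lambda>a. a) (carrier L) a" by (rule fun_cong)
  then show ?thesis using a by simp
qed

lemma phi_isomorphism:
  assumes \<phi>: "is_lpa_phi E n e P Q \<phi>" and \<psi>: "is_lpa_phi E n e Q P \<psi>"
    and "(\<forall>i\<in>{1..n}. \<forall>j\<in>{1..n}. \<phi> (P (i, j)) = P (i, j)) \<or>
      (\<forall>i\<in>{1..n}. \<forall>j\<in>{1..n}. \<phi> (Q (i, j)) = Q (i, j))"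
  shows "\<phi> \<in> alg_iso L L" "restrict (inv_into (carrier L) \<phi>) (carrier L) = \<psi>"
proof -
  interpret S: edge_substitution E L n v w e Q P by (rule swap)
  have hom: "\<phi> \<in> alg_hom L L" and hom': "\<psi> \<in> alg_hom L L"
    using \<phi> \<psi> by (simp_all add: is_lpa_phi_iff S.is_lpa_phi_iff)
  note inv = phi_right_inverse[OF assms]
  have surj: "\<phi> ` carrier L = carrier L"
  proof
    show "\<phi> ` carrier L \<subseteq> carrier L" using hom_closed[OF hom] by blast
    show "carrier L \<subseteq> \<phi> ` carrier L"
    proof
      fix a assume a: "a \<in> carrier L"
      show "a \<in> \<phi> ` carrier L"
        using imageI[OF hom_closed[OF hom' a], of \<phi>] inv[OF a] by simp
    qed
  qed
  interpret vertex_fixing_surjection E L \<phi>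
    using \<phi> surj by unfold_locales (simp_all add: is_lpa_phi_iff)
  show "\<phi> \<in> alg_iso L L" using hom surj injective by (simp add: alg_iso_def bij_betw_def)
  show "restrict (inv_into (carrier L) \<phi>) (carrier L) = \<psi>"
  proof (rule extensionalityI)
    show "\<psi> \<in> extensional (carrier L)" by (rule hom_extensional[OF hom'])
    fix a assume a: "a \<in> carrier L"
    have "inv_into (carrier L) \<phi> (\<phi> (\<psi> a)) = \<psi> a"
      by (rule inv_into_f_f[OF injective hom_closed[OF hom' a]])
    then show "restrict (inv_into (carrier L) \<phi>) (carrier L) a = \<psi> a"
      using a inv[OF a] by simp
  qed simp
qed

end

section \<open>From matrices commuting with w to matrices over w L w\<close>

context leavitt
begin

lemma lpa_phi_isomorphism:
  fixes n :: nat and e :: "nat \<Rightarrow> 'e" and P Q :: "nat \<times> nat \<Rightarrow> ('k, 'v, 'e) lpa"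
  assumes "v \<in> verts E" and "w \<in> verts E"
    and "inj_on e {1..n}"
    and "\<And>i. i \<in> {1..n} \<Longrightarrow> e i \<in> arcs E \<and> tail E (e i) = v \<and> head E (e i) = w"
    and "P \<in> mats L n"
    and "Q \<in> mats L n"
    and "mat_lmult L n (vt w) P = mat_rmult L n P (vt w)"
    and "mat_lmult L n (vt w) Q = mat_rmult L n Q (vt w)"
    and "mat_lmult L n (vt w) (mat_prod L n P Q) = mat_diag L n (vt w)"
    and "mat_lmult L n (vt w) (mat_prod L n Q P) = mat_diag L n (vt w)"
  shows "(\<exists>!\<phi>. is_lpa_phi E n e P Q \<phi>) \<and>
    ((\<forall>i\<in>{1..n}. \<forall>j\<in>{1..n}.
        amult L (vt w) (lpa_phi E n e P Q (P (i, j)))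
          = amult L (vt w) (P (i, j))) \<or>
     (\<forall>i\<in>{1..n}. \<forall>j\<in>{1..n}.
        amult L (vt w) (lpa_phi E n e P Q (Q (i, j)))
          = amult L (vt w) (Q (i, j)))
     \<longrightarrow> lpa_phi E n e P Q \<in> alg_iso L L \<and>
         restrict (inv_into (carrier L) (lpa_phi E n e P Q))
           (carrier L) = lpa_phi E n e Q P)"
proof -
  have P: "P (i, j) \<in> carrier L" and Q: "Q (i, j) \<in> carrier L"
    if "i \<in> {1..n}" "j \<in> {1..n}" for i j
    using assms(5,6) that by (auto simp: mats_def)
  have commP: "vt w \<^bold>* P (i, j) = P (i, j) \<^bold>* vt w" and commQ: "vt w \<^bold>* Q (i, j) = Q (i, j) \<^bold>* vt w"
    if "i \<in> {1..n}" "j \<in> {1..n}" for i j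
    using fun_cong[OF assms(7), of "(i, j)"] fun_cong[OF assms(8), of "(i, j)"] that
    by (simp_all add: mat_lmult_def mat_rmult_def)
  define P' where "P' = (\<lambda>ij. vt w \<^bold>* P ij)"
  define Q' where "Q' = (\<lambda>ij. vt w \<^bold>* Q ij)"
  have w: "vt w \<in> carrier L" "vt w \<^bold>* vt w = vt w" using assms(2) by (simp_all add: vt_vt)
  have w_left: "vt w \<^bold>* (vt w \<^bold>* a) = vt w \<^bold>* a" if "a \<in> carrier L" for a
    using w that by (simp add: mult_assoc[symmetric])
  \<comment> \<open>Commuting with w lets the two factors w merge, so products of w P and w Q are w
    times the original products.\<close>
  have corner: "(vt w \<^bold>* a) \<^bold>* (vt w \<^bold>* b) = vt w \<^bold>* (a \<^bold>* b)"
    if "a \<in> carrier L" "b \<in> carrier L" "vt w \<^bold>* a = a \<^bold>* vt w" for a b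
    using w that by (metis mult_assoc mult_closed)
  have corner_prod: "asum L (\<lambda>k. (vt w \<^bold>* X (i, k)) \<^bold>* (vt w \<^bold>* Y (k, j))) {1..n} = (if i = j then vt w else \<^bold>0)"
    if prod: "mat_lmult L n (vt w) (mat_prod L n X Y) = mat_diag L n (vt w)"
      and X: "\<And>i j. \<lbrakk>i \<in> {1..n}; j \<in> {1..n}\<rbrakk> \<Longrightarrow> X (i, j) \<in> carrier L \<and> vt w \<^bold>* X (i, j) = X (i, j) \<^bold>* vt w"
      and Y: "\<And>i j. \<lbrakk>i \<in> {1..n}; j \<in> {1..n}\<rbrakk> \<Longrightarrow> Y (i, j) \<in> carrier L"
      and ij: "i \<in> {1..n}" "j \<in> {1..n}" for X Y i j
  proof -
    have "asum L (\<lambda>k. (vt w \<^bold>* X (i, k)) \<^bold>* (vt w \<^bold>* Y (k, j))) {1..n}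
        = asum L (\<lambda>k. vt w \<^bold>* (X (i, k) \<^bold>* Y (k, j))) {1..n}"
      using X Y w ij by (intro asum_cong corner) simp_all
    also have "\<dots> = vt w \<^bold>* asum L (\<lambda>k. X (i, k) \<^bold>* Y (k, j)) {1..n}"
      using X Y w ij by (intro mult_asum[symmetric]) simp_all
    also have "\<dots> = (if i = j then vt w else \<^bold>0)"
      using fun_cong[OF prod, of "(i, j)"] ij by (simp add: mat_lmult_def mat_prod_def mat_diag_def)
    finally show ?thesis .
  qed
  interpret S: edge_substitution E L n v w e P' Q'
  proof unfold_locales
    fix i j assume ij: "i \<in> {1..n}" "j \<in> {1..n}"
    show "P' (i, j) \<in> carrier L" "Q' (i, j) \<in> carrier L" using w P Q ij by (simp_all add: P'_def Q'_def)
    show "vt w \<^bold>* P' (i, j) = P' (i, j)" "vt w \<^bold>* Q' (i, j) = Q' (i, j)"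
      using w_left P Q ij by (simp_all add: P'_def Q'_def)
    show "P' (i, j) \<^bold>* vt w = P' (i, j)" "Q' (i, j) \<^bold>* vt w = Q' (i, j)"
      using w P Q ij by (simp_all add: P'_def Q'_def commP commQ mult_assoc)
    show "asum L (\<lambda>k. P' (i, k) \<^bold>* Q' (k, j)) {1..n} = (if i = j then vt w else \<^bold>0)"
      unfolding P'_def Q'_def by (rule corner_prod[OF assms(9)]) (use P Q commP ij in simp_all)
    show "asum L (\<lambda>k. Q' (i, k) \<^bold>* P' (k, j)) {1..n} = (if i = j then vt w else \<^bold>0)"
      unfolding P'_def Q'_def by (rule corner_prod[OF assms(10)]) (use P Q commQ ij in simp_all)
  qed (use assms(1-4) in simp_all)
  interpret T: edge_substitution E L n v w e Q' P' by (rule S.swap)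
  \<comment> \<open>Passing to w P and w Q leaves the images of the generators unchanged, because
    e_k w = e_k and w e_k* = e_k*. On the ghost side w must first be moved past the entry, which
    uses the commutation hypotheses.\<close>
  have ed_w: "ed (e k) \<^bold>* (vt w \<^bold>* a) = ed (e k) \<^bold>* a" if "k \<in> {1..n}" "a \<in> carrier L" for k a
    using assms(4)[OF that(1)] that(2) w by (simp add: mult_assoc[symmetric] ed_vt)
  have gh_w: "(vt w \<^bold>* a) \<^bold>* gh (e k) = a \<^bold>* gh (e k)"
    if "k \<in> {1..n}" "a \<in> carrier L" "vt w \<^bold>* a = a \<^bold>* vt w" for k a
    unfolding that(3) using assms(4)[OF that(1)] that(2) w by (simp add: mult_assoc vt_gh)
  have edP: "asum L (\<lambda>k. ed (e k) \<^bold>* P' (k, i)) {1..n} = asum L (\<lambda>k. ed (e k) \<^bold>* P (k, i)) {1..n}"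
    and edQ: "asum L (\<lambda>k. ed (e k) \<^bold>* Q' (k, i)) {1..n} = asum L (\<lambda>k. ed (e k) \<^bold>* Q (k, i)) {1..n}"
    and ghP: "asum L (\<lambda>k. P' (i, k) \<^bold>* gh (e k)) {1..n} = asum L (\<lambda>k. P (i, k) \<^bold>* gh (e k)) {1..n}"
    and ghQ: "asum L (\<lambda>k. Q' (i, k) \<^bold>* gh (e k)) {1..n} = asum L (\<lambda>k. Q (i, k) \<^bold>* gh (e k)) {1..n}"
    if "i \<in> {1..n}" for i
    unfolding P'_def Q'_def
    using that
    by (intro asum_cong[OF HOL.refl], simp add: ed_w gh_w P Q commP[symmetric] commQ[symmetric])+
  have phi_PQ: "is_lpa_phi E n e P Q \<phi> \<longleftrightarrow> is_lpa_phi E n e P' Q' \<phi>" for \<phi>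
    unfolding is_lpa_phi_def L_def[symmetric] 
    by (intro arg_cong2[where f = "(\<and>)"] HOL.refl ball_cong) (simp_all only: edP ghQ)
  have phi_QP: "is_lpa_phi E n e Q P \<phi> \<longleftrightarrow> is_lpa_phi E n e Q' P' \<phi>" for \<phi>
    unfolding is_lpa_phi_def L_def[symmetric] 
    by (intro arg_cong2[where f = "(\<and>)"] HOL.refl ball_cong) (simp_all only: edQ ghP)
  obtain \<phi> where \<phi>: "is_lpa_phi E n e P' Q' \<phi>" using S.phi_exists by blast
  obtain \<psi> where \<psi>: "is_lpa_phi E n e Q' P' \<psi>" using T.phi_exists by blast
  have ex1: "\<exists>!\<phi>. is_lpa_phi E n e P Q \<phi>" unfolding phi_PQ using \<phi> S.phi_unique by blast
  have lpa_phi: "lpa_phi E n e P Q = \<phi>" "lpa_phi E n e Q P = \<psi>"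
    unfolding lpa_phi_def phi_PQ phi_QP
    using \<phi> \<psi> S.phi_unique T.phi_unique by (blast intro: the_equality)+
  have hom: "\<phi> \<in> alg_hom L L" and vt: "\<phi> (vt w) = vt w"
    using \<phi> assms(2) by (simp_all add: S.is_lpa_phi_iff)
  \<comment> \<open>Since \<open>\<phi>\<close> fixes w, the condition of (ii) on an entry a says
    precisely that \<open>\<phi>\<close> fixes the corner entry w a.\<close>
  have fixed: "\<phi> (vt w \<^bold>* a) = vt w \<^bold>* a" if "a \<in> carrier L" "vt w \<^bold>* \<phi> a = vt w \<^bold>* a" for a
    using that w by (simp add: hom_mult[OF hom] vt)
  have "\<phi> \<in> alg_iso L L \<and> restrict (inv_into (carrier L) \<phi>) (carrier L) = \<psi>"
    if "(\<forall>i\<in>{1..n}. \<forall>j\<in>{1..n}. vt w \<^bold>* \<phi> (P (i, j)) = vt w \<^bold>* P (i, j)) \<or>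
      (\<forall>i\<in>{1..n}. \<forall>j\<in>{1..n}. vt w \<^bold>* \<phi> (Q (i, j)) = vt w \<^bold>* Q (i, j))"
  proof -
    have "(\<forall>i\<in>{1..n}. \<forall>j\<in>{1..n}. \<phi> (P' (i, j)) = P' (i, j)) \<or>
        (\<forall>i\<in>{1..n}. \<forall>j\<in>{1..n}. \<phi> (Q' (i, j)) = Q' (i, j))"
      unfolding P'_def Q'_def using that
      by (elim disj_forward) (simp_all add: fixed P Q)
    then show ?thesis using S.phi_isomorphism[OF \<phi> \<psi>] by (intro conjI)
  qed
  then show ?thesis unfolding lpa_phi by (intro conjI[OF ex1] impI)
qed

end

theorem theorem2p2:
  fixes E :: "('v, 'e) pre_digraph"
    and n :: nat and v w :: 'v and e :: "nat \<Rightarrow> 'e"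
    and P Q :: "nat \<times> nat \<Rightarrow> ('k :: field, 'v, 'e) lpa"
  assumes "wf_digraph E" and "n \<ge> 1"
    and "v \<in> verts E" and "w \<in> verts E"
    and "inj_on e {1..n}"
    and "\<And>i. i \<in> {1..n} \<Longrightarrow> e i \<in> arcs E \<and> tail E (e i) = v \<and> head E (e i) = w"
    and "P \<in> mats (leavitt_path_algebra E) n"
    and "Q \<in> mats (leavitt_path_algebra E) n"
    and "mat_lmult (leavitt_path_algebra E) n (lpa_vert E w) P
       = mat_rmult (leavitt_path_algebra E) n P (lpa_vert E w)"
    and "mat_lmult (leavitt_path_algebra E) n (lpa_vert E w) Q
       = mat_rmult (leavitt_path_algebra E) n Q (lpa_vert E w)"
    and "mat_lmult (leavitt_path_algebra E) n (lpa_vert E w)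
           (mat_prod (leavitt_path_algebra E) n P Q)
       = mat_diag (leavitt_path_algebra E) n (lpa_vert E w)"
    and "mat_lmult (leavitt_path_algebra E) n (lpa_vert E w)
           (mat_prod (leavitt_path_algebra E) n Q P)
       = mat_diag (leavitt_path_algebra E) n (lpa_vert E w)"
  shows "(\<exists>!\<phi>. is_lpa_phi E n e P Q \<phi>) \<and>
    ((\<forall>i\<in>{1..n}. \<forall>j\<in>{1..n}.
        amult (leavitt_path_algebra E) (lpa_vert E w) (lpa_phi E n e P Q (P (i, j)))
          = amult (leavitt_path_algebra E) (lpa_vert E w) (P (i, j))) \<or>
     (\<forall>i\<in>{1..n}. \<forall>j\<in>{1..n}.
        amult (leavitt_path_algebra E) (lpa_vert E w) (lpa_phi E n e P Q (Q (i, j)))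
          = amult (leavitt_path_algebra E) (lpa_vert E w) (Q (i, j)))
     \<longrightarrow> lpa_phi E n e P Q \<in> alg_iso (leavitt_path_algebra E) (leavitt_path_algebra E) \<and>
         restrict (inv_into (carrier (leavitt_path_algebra E)) (lpa_phi E n e P Q))
           (carrier (leavitt_path_algebra E)) = lpa_phi E n e Q P)"
  by (rule leavitt.lpa_phi_isomorphism[OF leavittI[OF assms(1)] assms(3-)])

end
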